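(* Let $K$ be a field complete with respect to a discrete non-archimedean valuation, with residue field $k$. Let $\mathcal{A}=\{\alpha_1<\alpha_2<\cdots<\alpha_t\}\subset\mathbb{Z}$ be a finite set with $t\ge 2$. If $k$ is algebraically closed with $\mathrm{char}(k)=0$ or $\mathrm{char}(k)>\max_{\alpha,\beta\in\mathcal{A}}|\alpha-\beta|$, then $$2-\frac{2}{t}\le E(\mathcal{A},K)\le 2\ln(t),$$ where $E(\mathcal{A},K)$ is the limit, as $M\to\infty$, of the expected number of roots in $K^\ast$ of a random polynomial with support $\mathcal{A}$, in the random model described in the context (for any choice of the distributions of the first digits and of the tails).
   Context: Let $v:K\to\mathbb{R}\cup\{\infty\}$ be the discrete (nontrivial) valuation, $A$ its valuation ring, $\mathfrak{M}=\pi A$ its maximal ideal with a fixed generator $\pi$, $k=A/\mathfrak{M}$. The first digit of $x\in K^\ast$ is $\delta(x)=\pi^{-v(x)/v(\pi)}x\bmod\mathfrak{M}\in k^\ast$. Fix a set $\Delta\subseteq A\setminus\mathfrak{M}$ of representatives of $k^\ast$, and let $\Delta(x)\in\Delta$ be the representative of $\delta(x)$. Every $x\in K^\ast$ factors uniquely as $x=\pi^{v(x)/v(\pi)}\Delta(x)e(x)$ with $e(x)\in 1+\mathfrak{M}$ (the tail), so $x\mapsto(v(x),\delta(x),e(x))$ is a bijection $K^\ast\to v(\pi)\mathbb{Z}\times k^\ast\times(1+\mathfrak{M})$. Random model: let $D_1$ be a probability distribution on $k^\ast$, $D_2$ a probability distribution on $1+\mathfrak{M}$ and $M>0$. A random element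 of $K^\ast$ is obtained by choosing independently its valuation uniformly in $[-M,M]\cap v(\pi)\mathbb{Z}$, its first digit according to $D_1$, and its tail according to $D_2$. A random polynomial $f=\sum_{\alpha\in\mathcal{A}}a_\alpha X^\alpha$ with support exactly $\mathcal{A}$ is obtained by choosing the coefficients $a_\alpha\in K^\ast$ independently in this way (root counts are assumed measurable so that expectations make sense). $E(\mathcal{A},D_1,D_2,M,K)$ is the expected number of roots of $f$ in $K^\ast$, and $E(\mathcal{A},K)=\lim_{M\to\infty}E(\mathcal{A},D_1,D_2,M,K)$; when $k$ is algebraically closed (with the stated condition on the characteristic) this limit exists and does not depend on $D_1,D_2$. *)

theory Defs
  imports "HOL-Probability.Probability" "HOL-Algebra.Algebraic_Closure_Type"
begin

section \<open>Discretely valued fields and their residue fields\<close>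

definition valuation :: "('a::field \<Rightarrow> ereal) \<Rightarrow> bool" where
  "valuation v \<longleftrightarrow>
     (\<forall>x. v x \<noteq> -\<infinity>) \<and>
     (\<forall>x. v x = \<infinity> \<longleftrightarrow> x = 0) \<and>
     (\<forall>x y. v (x * y) = v x + v y) \<and>
     (\<forall>x y. min (v x) (v y) \<le> v (x + y))"

text \<open>The value group is a nontrivial discrete subgroup of the reals, not necessarily the integers.\<close>
definition discrete_valuation :: "('a::field \<Rightarrow> ereal) \<Rightarrow> bool" where
  "discrete_valuation v \<longleftrightarrow> valuation v \<and>
     (\<exists>c::real. c > 0 \<and> v ` (- {0}) = range (\<lambda>n::int. ereal (of_int n * c)))"

definition valuation_Cauchy :: "('a::field \<Rightarrow> ereal) \<Rightarrow> (nat \<Rightarrow> 'a) \<Rightarrow> bool" where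
  "valuation_Cauchy v s \<longleftrightarrow> (\<forall>B::real. \<exists>N. \<forall>m\<ge>N. \<forall>n\<ge>N. v (s m - s n) \<ge> ereal B)"

definition valuation_limit :: "('a::field \<Rightarrow> ereal) \<Rightarrow> (nat \<Rightarrow> 'a) \<Rightarrow> 'a \<Rightarrow> bool" where
  "valuation_limit v s x \<longleftrightarrow> (\<forall>B::real. \<exists>N. \<forall>n\<ge>N. v (s n - x) \<ge> ereal B)"

definition valuation_complete :: "('a::field \<Rightarrow> ereal) \<Rightarrow> bool" where
  "valuation_complete v \<longleftrightarrow> (\<forall>s. valuation_Cauchy v s \<longrightarrow> (\<exists>x. valuation_limit v s x))"

definition valuation_ring :: "('a::field \<Rightarrow> ereal) \<Rightarrow> 'a ring" where
  "valuation_ring v = ring_of_type_algebra\<lparr>carrier := {x. v x \<ge> 0}\<rparr>"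

definition max_ideal :: "('a::field \<Rightarrow> ereal) \<Rightarrow> 'a set" where
  "max_ideal v = {x. v x > 0}"

definition uniformizer :: "('a::field \<Rightarrow> ereal) \<Rightarrow> 'a \<Rightarrow> bool" where
  "uniformizer v p \<longleftrightarrow> max_ideal v = (\<lambda>a. p * a) ` carrier (valuation_ring v)"

text \<open>The elements of the residue field are the cosets of the maximal ideal, i.e. subsets of
  the valuation ring.\<close>
definition residue_field :: "('a::field \<Rightarrow> ereal) \<Rightarrow> 'a set ring" where
  "residue_field v = valuation_ring v Quot max_ideal v"

definition residue_units :: "('a::field \<Rightarrow> ereal) \<Rightarrow> 'a set set" where
  "residue_units v = carrier (residue_field v) - {\<zero>\<^bsub>residue_field v\<^esub>}"

text \<open>HOL-Algebra has no notion of characteristic; this mirrors the definition of \<open>CHAR\<close>.\<close>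
definition ring_char :: "('a, 'b) ring_scheme \<Rightarrow> nat" where
  "ring_char R = Gcd {n::nat. [n] \<cdot>\<^bsub>R\<^esub> \<one>\<^bsub>R\<^esub> = \<zero>\<^bsub>R\<^esub>}"

definition digit_representatives :: "('a::field \<Rightarrow> ereal) \<Rightarrow> 'a set \<Rightarrow> bool" where
  "digit_representatives v \<Delta> \<longleftrightarrow>
     \<Delta> \<subseteq> carrier (valuation_ring v) - max_ideal v \<and>
     (\<forall>d\<in>residue_units v. \<exists>!a. a \<in> \<Delta> \<and> a \<in> d)"

definition representative :: "'a set \<Rightarrow> 'a set \<Rightarrow> 'a" where
  "representative \<Delta> d = (THE a. a \<in> \<Delta> \<and> a \<in> d)"


section \<open>The random model\<close>

text \<open>The nonzero element with valuation \<open>r\<close>, first digit \<open>d\<close> and tail \<open>e\<close>. Here \<open>r\<close> is meant to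
  be an integral multiple of the valuation of \<open>p\<close>, so that the floor is exact.\<close>
definition compose_element ::
    "('a::field \<Rightarrow> ereal) \<Rightarrow> 'a \<Rightarrow> 'a set \<Rightarrow> real \<times> 'a set \<times> 'a \<Rightarrow> 'a" where
  "compose_element v p \<Delta> = (\<lambda>(r, d, e).
     p powi \<lfloor>r / real_of_ereal (v p)\<rfloor> * representative \<Delta> d * e)"

definition valuation_range :: "('a::field \<Rightarrow> ereal) \<Rightarrow> 'a \<Rightarrow> real \<Rightarrow> real set" where
  "valuation_range v p M = {-M..M} \<inter> range (\<lambda>n::int. of_int n * real_of_ereal (v p))"

text \<open>The sigma-algebras carried by the two distributions are arbitrary.\<close>
definition digit_distribution :: "('a::field \<Rightarrow> ereal) \<Rightarrow> 'a set measure \<Rightarrow> bool" where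
  "digit_distribution v D1 \<longleftrightarrow> prob_space D1 \<and> space D1 = residue_units v"

definition tail_distribution :: "('a::field \<Rightarrow> ereal) \<Rightarrow> 'a measure \<Rightarrow> bool" where
  "tail_distribution v D2 \<longleftrightarrow> prob_space D2 \<and> space D2 = (\<lambda>m. 1 + m) ` max_ideal v"

definition random_element ::
    "('a::field \<Rightarrow> ereal) \<Rightarrow> 'a \<Rightarrow> 'a set measure \<Rightarrow> 'a measure \<Rightarrow> real
      \<Rightarrow> (real \<times> 'a set \<times> 'a) measure" where
  "random_element v p D1 D2 M =
     measure_pmf (pmf_of_set (valuation_range v p M)) \<Otimes>\<^sub>M (D1 \<Otimes>\<^sub>M D2)"

definition random_polynomial ::
    "('a::field \<Rightarrow> ereal) \<Rightarrow> 'a \<Rightarrow> int set \<Rightarrow> 'a set measure \<Rightarrow> 'a measure \<Rightarrow> real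
      \<Rightarrow> (int \<Rightarrow> real \<times> 'a set \<times> 'a) measure" where
  "random_polynomial v p A D1 D2 M = (\<Pi>\<^sub>M \<alpha>\<in>A. random_element v p D1 D2 M)"

text \<open>Roots are counted without multiplicity; exponents may be negative.\<close>
definition nonzero_roots :: "int set \<Rightarrow> (int \<Rightarrow> 'a::field) \<Rightarrow> 'a set" where
  "nonzero_roots A a = {x. x \<noteq> 0 \<and> (\<Sum>\<alpha>\<in>A. a \<alpha> * x powi \<alpha>) = 0}"

definition root_count ::
    "('a::field \<Rightarrow> ereal) \<Rightarrow> 'a \<Rightarrow> 'a set \<Rightarrow> int set \<Rightarrow> (int \<Rightarrow> real \<times> 'a set \<times> 'a) \<Rightarrow> real" where
  "root_count v p \<Delta> A \<omega> = real (card (nonzero_roots A (\<lambda>\<alpha>. compose_element v p \<Delta> (\<omega> \<alpha>))))"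

definition expected_roots ::
    "('a::field \<Rightarrow> ereal) \<Rightarrow> 'a \<Rightarrow> 'a set \<Rightarrow> int set \<Rightarrow> 'a set measure \<Rightarrow> 'a measure
      \<Rightarrow> real \<Rightarrow> real" where
  "expected_roots v p \<Delta> A D1 D2 M =
     (\<integral>\<omega>. root_count v p \<Delta> A \<omega> \<partial>random_polynomial v p A D1 D2 M)"

end

theory Submission
  imports Defs
begin

text \<open>
  Let the valuation of the coefficient of \<open>X^\<alpha>\<close> be \<open>n \<alpha>\<close> times the generator \<open>c\<close> of the value
  group, and put a point of height \<open>n \<alpha>\<close> over every exponent \<open>\<alpha> \<in> A\<close>. If a sum in a valued field
  vanishes, its least valuation is attained twice. Hence a root of valuation \<open>m * c\<close> singles out a
  line of slope \<open>-m\<close> that supports the points from below and meets two of them; when no three points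
  are collinear, this is an edge \<open>(\<alpha>, \<beta>)\<close> of the lower convex hull. Rescaling the variable turns
  the polynomial into a perturbation of a binomial of degree \<open>\<beta> - \<alpha>\<close> whose coefficients are units.
  The residue field is algebraically closed and \<open>\<beta> - \<alpha>\<close> is invertible in it, so this binomial has
  \<open>\<beta> - \<alpha>\<close> distinct residual roots, and each lifts uniquely by Hensel's lemma. The number of roots is
  therefore the total length \<open>integral_width\<close> of the hull edges of integral slope
  (\<open>card_nonzero_roots\<close>).

  First digits and tails thus matter only if three of the points are collinear, which has
  probability \<open>O(1/M)\<close>, while the number of roots is bounded. So the expectation is, up to \<open>O(1/M)\<close>,
  the average of \<open>integral_width\<close> over a cube of lattice points
  (\<open>expected_roots_near_cube_avg\<close>).

  To compute the limit of that average, cut the cube into blocks of side \<open>L\<close>. Whether \<open>(\<alpha>, \<beta>)\<close> is an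
  edge depends only on the block, except for a proportion \<open>O(1/K)\<close> of the \<open>K ^ card A\<close> blocks. This
  makes the frequency of an edge a Cauchy sequence in the side of the cube. With \<open>L = \<beta> - \<alpha>\<close> the
  slope is integral at one place out of \<open>\<beta> - \<alpha>\<close> in each block, which cancels the length \<open>\<beta> - \<alpha>\<close> of
  the edge. Consequently the limit \<open>E\<close> exists and is the limit of the average number of hull edges.

  For the bounds, let \<open>t = card A\<close>. Fix a direction and count the edges along which the height grows
  in that direction. Each of them is determined by its upper end \<open>\<beta>\<close>, which is lowest among the
  points from \<open>\<beta>\<close> onwards but not lowest of all. If there are \<open>j\<close> points from \<open>\<beta>\<close> onwards, the
  probability of this tends to \<open>1/j - 1/t\<close>, and summing over \<open>\<beta>\<close> gives at most \<open>harm t - 1 \<le> ln t\<close>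
  edges on average. On the other hand such an edge leaves the lowest point unless that point is the
  last one, so there are at least \<open>1 - 1/t\<close> on average. Adding both directions gives the two
  inequalities (\<open>integral_width_avg_tendsto\<close>).
\<close>

section \<open>Discretely valued fields\<close>

text \<open>Dividing valuations by the generator \<open>c\<close> of the value group gives the integral heights of the
  points from which convex hulls will be formed.\<close>

locale discretely_valued_field =
  fixes v :: "'a::field \<Rightarrow> ereal" and p :: 'a and c :: real
  assumes v_0: "v x = \<infinity> \<longleftrightarrow> x = 0"
    and v_not_MInf: "v x \<noteq> -\<infinity>"
    and v_mult: "v (x * y) = v x + v y"
    and v_add: "min (v x) (v y) \<le> v (x + y)"
    and c_pos: "c > 0"
    and value_group: "x \<noteq> 0 \<Longrightarrow> \<exists>m::int. v x = ereal (of_int m * c)"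
    and v_p: "v p = ereal c"
begin

lemma v_1 [simp]: "v 1 = 0"
proof -
  have "v 1 = v 1 + v 1" using v_mult[of 1 1] by simp
  moreover obtain r where "v 1 = ereal r" using value_group[of 1] by auto
  ultimately show ?thesis by (simp add: zero_ereal_def)
qed

lemma v_zero [simp]: "v 0 = \<infinity>" using v_0 by simp

lemma v_uminus [simp]: "v (- x) = v x"
proof -
  have "v (-1) + v (-1) = 0" using v_mult[of "-1" "-1"] by simp
  moreover obtain r where "v (-1) = ereal r" using value_group[of "-1"] by auto
  ultimately have "v (-1) = 0" by (simp add: zero_ereal_def)
  then show ?thesis using v_mult[of "-1" x] by simp
qed

lemma v_add_ge: "b \<le> v x \<Longrightarrow> b \<le> v y \<Longrightarrow> b \<le> v (x + y)"
  using v_add[of x y] by (meson min.boundedI order_trans)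

lemma v_add_gt: "b < v x \<Longrightarrow> b < v y \<Longrightarrow> b < v (x + y)"
  using v_add[of x y] by (meson min_less_iff_conj less_le_trans)

lemma v_diff_ge: "b \<le> v x \<Longrightarrow> b \<le> v y \<Longrightarrow> b \<le> v (x - y)"
  using v_add_ge[of b x "-y"] by simp

lemma v_diff_gt: "b < v x \<Longrightarrow> b < v y \<Longrightarrow> b < v (x - y)"
  using v_add_gt[of b x "-y"] by simp

lemma v_minus_commute: "v (x - y) = v (y - x)"
  using v_uminus[of "x - y"] by simp

lemma v_mult_ge0: "0 \<le> v x \<Longrightarrow> 0 \<le> v y \<Longrightarrow> 0 \<le> v (x * y)"
  by (simp add: v_mult)

lemma v_mult_pos: "0 < v x \<Longrightarrow> 0 \<le> v y \<Longrightarrow> 0 < v (x * y)"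
  by (simp add: v_mult add_pos_nonneg)

lemma v_mult_pos': "0 \<le> v x \<Longrightarrow> 0 < v y \<Longrightarrow> 0 < v (x * y)"
  using v_mult_pos[of y x] by (simp add: mult.commute)

lemma v_mult_unit: "v x = 0 \<Longrightarrow> v y = 0 \<Longrightarrow> v (x * y) = 0"
  by (simp add: v_mult)

lemma v_sum_ge: "(\<And>i. i \<in> I \<Longrightarrow> b \<le> v (f i)) \<Longrightarrow> b \<le> v (sum f I)"
  by (induction I rule: infinite_finite_induct) (auto intro: v_add_ge)

lemma v_sum_gt: "b < \<infinity> \<Longrightarrow> (\<And>i. i \<in> I \<Longrightarrow> b < v (f i)) \<Longrightarrow> b < v (sum f I)"
  by (induction I rule: infinite_finite_induct) (auto intro: v_add_gt)

lemma v_of_nat_ge0: "0 \<le> v (of_nat n)"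
  by (induction n) (auto intro: v_add_ge)

lemma v_power_unit: "v x = 0 \<Longrightarrow> v (x ^ n) = 0"
  by (induction n) (auto simp: v_mult)

lemma v_power_ge0: "0 \<le> v x \<Longrightarrow> 0 \<le> v (x ^ n)"
  by (induction n) (auto simp: v_mult)

lemma v_add_strict: "v x < v y \<Longrightarrow> v (x + y) = v x"
proof -
  assume a: "v x < v y"
  have "v x \<le> v (x + y)" by - (rule v_add_ge, use a in auto)
  moreover have "\<not> v x < v (x + y)"
  proof
    assume "v x < v (x + y)"
    then have "v x < v ((x + y) - y)" by - (rule v_diff_gt, use a in auto)
    then show False by simp
  qed
  ultimately show ?thesis by (simp add: order.antisym)
qed

lemma unit_cong: "v y = 0 \<Longrightarrow> 0 < v (x - y) \<Longrightarrow> v x = 0"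
  using v_add_strict[of y "x - y"] by simp

lemma unit_factors: "v (x * y) = 0 \<Longrightarrow> 0 \<le> v x \<Longrightarrow> 0 \<le> v y \<Longrightarrow> v x = 0 \<and> v y = 0"
  by (simp add: v_mult add_nonneg_eq_0_iff)

lemma v_inverse_unit: "v x = 0 \<Longrightarrow> v (inverse x) = 0"
  using v_mult[of x "inverse x"] v_0[of x] by (cases "x = 0") auto

lemma v_powi: assumes "x \<noteq> 0" "v x = ereal r" shows "v (x powi m) = ereal (of_int m * r)"
proof -
  have nat: "v (x ^ n) = ereal (of_nat n * r)" for n
    by (induction n) (auto simp: v_mult assms algebra_simps zero_ereal_def)
  show ?thesis
  proof (cases "m \<ge> 0")
    case True
    then show ?thesis using nat[of "nat m"] by (simp add: power_int_def)
  next
    case False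
    define n where "n = nat (-m)"
    have m: "m = - int n" using False by (simp add: n_def)
    have e: "x powi m * x ^ n = 1"
      using assms(1) by (simp add: m power_int_minus)
    have "v (x powi m) + ereal (real n * r) = 0"
      using v_mult[of "x powi m" "x ^ n"] nat[of n] e by simp
    moreover obtain s where "v (x powi m) = ereal s"
      using value_group[of "x powi m"] assms(1) by auto
    ultimately show ?thesis by (simp add: m zero_ereal_def)
  qed
qed

lemma p_nonzero: "p \<noteq> 0" using v_p v_0[of p] by auto

text \<open>Discreteness: the least positive valuation is \<open>c\<close>. It makes every congruence worth at least
  one factor \<open>p\<close>, so that successive approximations converge.\<close>

lemma v_pos_iff: "0 < v x \<longleftrightarrow> ereal c \<le> v x"
proof
  assume pos: "0 < v x"
  show "ereal c \<le> v x"
  proof (cases "x = 0")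
    case False
    then obtain m :: int where m: "v x = ereal (of_int m * c)" using value_group by blast
    with pos c_pos have "0 < m" by (simp add: zero_less_mult_iff zero_ereal_def)
    then have "1 * c \<le> of_int m * c" using c_pos by (intro mult_right_mono) auto
    then show ?thesis using m by simp
  qed simp
qed (use c_pos less_le_trans[of 0 "ereal c"] in \<open>auto simp: zero_ereal_def\<close>)

end

section \<open>Hensel's lemma\<close>

context discretely_valued_field
begin

lemma v_poly_ge0: "(\<And>i. 0 \<le> v (Polynomial.coeff f i)) \<Longrightarrow> 0 \<le> v y \<Longrightarrow> 0 \<le> v (poly f y)"
  by (simp add: poly_altdef) (intro v_sum_ge v_mult_ge0 v_power_ge0)

lemma v_poly_pos: "(\<And>i. 0 < v (Polynomial.coeff f i)) \<Longrightarrow> 0 \<le> v y \<Longrightarrow> 0 < v (poly f y)"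
  by (simp add: poly_altdef) (intro v_sum_gt v_mult_pos v_power_ge0, auto)

lemma v_coeff_pderiv_ge0: "(\<And>i. 0 \<le> v (Polynomial.coeff f i)) \<Longrightarrow> 0 \<le> v (Polynomial.coeff (pderiv f) i)"
  unfolding coeff_pderiv by (intro v_mult_ge0 v_of_nat_ge0)

lemma v_coeff_pderiv_pos: "(\<And>i. 0 < v (Polynomial.coeff f i)) \<Longrightarrow> 0 < v (Polynomial.coeff (pderiv f) i)"
  unfolding coeff_pderiv by (intro v_mult_pos' v_of_nat_ge0)

lemma poly_cong:
  assumes "\<And>i. 0 \<le> v (Polynomial.coeff f i)" "0 \<le> v a" "0 < v (x - a)"
  shows "0 < v (poly f x - poly f a)"
  using assms(1)
proof (induction f)
  case (pCons b f)
  have x: "0 \<le> v x" using v_add_ge[of 0 "x - a" a] assms by simp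
  have f: "\<And>i. 0 \<le> v (Polynomial.coeff f i)" using pCons.prems[of "Suc _"] by simp
  have "poly (pCons b f) x - poly (pCons b f) a = (x - a) * poly f x + a * (poly f x - poly f a)"
    by (simp add: algebra_simps)
  moreover have "0 < v ((x - a) * poly f x)"
    using assms f x by (intro v_mult_pos v_poly_ge0)
  moreover have "0 < v (a * (poly f x - poly f a))"
    using assms f by (intro v_mult_pos' pCons.IH)
  ultimately show ?case by (simp only: v_add_gt)
qed simp

text \<open>The difference quotient is a polynomial in \<open>x\<close> and \<open>y\<close> with integral coefficients that becomes
  \<open>pderiv f\<close> on the diagonal. It takes the place of the Taylor expansion, both for uniqueness and
  for existence in Hensel's lemma.\<close>

lemma poly_difference_quotient:
  assumes "\<And>i. 0 \<le> v (Polynomial.coeff f i)" "0 \<le> v a" "0 < v (x - a)" "0 < v (y - a)"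
  shows "\<exists>q. poly f x - poly f y = (x - y) * q \<and> 0 < v (q - poly (pderiv f) a)"
  using assms(1)
proof (induction f)
  case 0
  show ?case by (rule exI[of _ 0]) simp
next
  case (pCons b f)
  have y: "0 \<le> v y" using v_add_ge[of 0 "y - a" a] assms by simp
  have f: "\<And>i. 0 \<le> v (Polynomial.coeff f i)" using pCons.prems[of "Suc _"] by simp
  obtain q where q: "poly f x - poly f y = (x - y) * q" "0 < v (q - poly (pderiv f) a)"
    using pCons.IH f by blast
  have "poly (pCons b f) x - poly (pCons b f) y = (x - y) * poly f x + y * (poly f x - poly f y)"
    by (simp add: algebra_simps)
  also have "\<dots> = (x - y) * (poly f x + y * q)" by (simp add: q algebra_simps)
  finally have 1: "poly (pCons b f) x - poly (pCons b f) y = (x - y) * (poly f x + y * q)" .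
  have "poly f x + y * q - poly (pderiv (pCons b f)) a
      = (poly f x - poly f a) + (y * (q - poly (pderiv f) a) + (y - a) * poly (pderiv f) a)"
    by (simp add: pderiv_pCons algebra_simps)
  moreover have "0 < v (poly f x - poly f a)" using assms f by (intro poly_cong)
  moreover have "0 < v (y * (q - poly (pderiv f) a))" using y q(2) by (rule v_mult_pos')
  moreover have "0 < v ((y - a) * poly (pderiv f) a)"
    using assms f by (intro v_mult_pos v_poly_ge0 v_coeff_pderiv_ge0)
  ultimately have "0 < v (poly f x + y * q - poly (pderiv (pCons b f)) a)"
    by (simp only: v_add_gt)
  with 1 show ?case by blast
qed

lemma hensel_unique:
  assumes "\<And>i. 0 \<le> v (Polynomial.coeff f i)" "0 \<le> v a" "v (poly (pderiv f) a) = 0"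
    and "0 < v (x - a)" "0 < v (y - a)" "poly f x = 0" "poly f y = 0"
  shows "x = y"
proof -
  obtain q where q: "poly f x - poly f y = (x - y) * q" "0 < v (q - poly (pderiv f) a)"
    using poly_difference_quotient[OF assms(1,2,4,5)] by blast
  have "v q = 0" using unit_cong[OF assms(3) q(2)] .
  then have "q \<noteq> 0" using v_0[of q] by auto
  then show ?thesis using q(1) assms by simp
qed

text \<open>Newton's iteration with the derivative frozen at \<open>a\<close>. The convergence is only linear, but each
  step raises the valuation of \<open>f\<close> by at least \<open>c\<close>, and the difference quotient is all that is
  needed to see this.\<close>

lemma hensel_exists:
  assumes "valuation_complete v"
    and f: "\<And>i. 0 \<le> v (Polynomial.coeff f i)" and a: "0 \<le> v a" and u: "v (poly (pderiv f) a) = 0"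
    and fa: "0 < v (poly f a)"
  shows "\<exists>x. poly f x = 0 \<and> 0 < v (x - a)"
proof -
  define u where "u = poly (pderiv f) a"
  have u0: "v u = 0" "u \<noteq> 0" using u v_0[of u] by (auto simp: u_def)
  have iu: "v (inverse u) = 0" using v_inverse_unit u0 by simp
  \<comment> \<open>\<open>u\<close> is the frozen derivative.\<close>
  define s where "s = rec_nat a (\<lambda>_ x. x - poly f x * inverse u)"
  have s_simps: "s 0 = a" "\<And>n. s (Suc n) = s n - poly f (s n) * inverse u"
    by (simp_all add: s_def)
  have inv: "0 < v (s n - a) \<and> ereal (real (Suc n) * c) \<le> v (poly f (s n))" for n
  proof (induction n)
    case 0
    show ?case using fa by (simp add: s_simps v_pos_iff)
  next
    case (Suc n)
    let ?x = "s n"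
    have vf: "ereal (real (Suc n) * c) \<le> v (poly f ?x)" using Suc by simp
    have vf': "0 < v (poly f ?x)"
      by (rule less_le_trans[OF _ vf]) (use c_pos in \<open>simp add: zero_ereal_def\<close>)
    have "s (Suc n) - a = (s n - a) - poly f (s n) * inverse u" by (simp add: s_simps)
    moreover have "0 < v (poly f (s n) * inverse u)" using vf' iu by (intro v_mult_pos) auto
    ultimately have near: "0 < v (s (Suc n) - a)"
      using Suc by (simp only: v_diff_gt)
    obtain q where q: "poly f (s (Suc n)) - poly f ?x = (s (Suc n) - ?x) * q" "0 < v (q - u)"
      using poly_difference_quotient[OF f a near] Suc unfolding u_def by blast
    have "poly f (s (Suc n)) = poly f ?x + (s (Suc n) - ?x) * q" using q(1) by (simp add: algebra_simps)
    also have "\<dots> = poly f ?x * (inverse u * (u - q))"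
      using u0 by (simp add: s_simps algebra_simps)
    finally have "v (poly f (s (Suc n))) = v (poly f ?x) + v (u - q)"
      by (simp add: v_mult iu)
    moreover have "ereal c \<le> v (u - q)" using q(2) v_minus_commute[of u q] v_pos_iff by simp
    ultimately have "ereal (real (Suc n) * c) + ereal c \<le> v (poly f (s (Suc n)))"
      using vf by (simp only: add_mono)
    then show ?case using near by (simp add: algebra_simps)
  qed
  have step: "ereal (real N * c) \<le> v (s n - s N)" if "N \<le> n" for N n
    using that
  proof (induction n rule: dec_induct)
    case (step n)
    have "v (s (Suc n) - s n) = v (poly f (s n))"
      using iu by (simp add: s_simps v_mult)
    then have "ereal (real (Suc n) * c) \<le> v (s (Suc n) - s n)" using inv[of n] by simp
    moreover have "ereal (real N * c) \<le> ereal (real (Suc n) * c)"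
      using step c_pos by simp
    ultimately have "ereal (real N * c) \<le> v (s (Suc n) - s n)" by (rule order_trans[rotated])
    then have "ereal (real N * c) \<le> v ((s (Suc n) - s n) + (s n - s N))"
      by - (rule v_add_ge, use step.IH in auto)
    then show ?case by simp
  qed simp
  have arch: "\<exists>N::nat. B \<le> real N * c" for B
    using reals_Archimedean3[OF c_pos] less_imp_le by metis
  have "valuation_Cauchy v s"
    unfolding valuation_Cauchy_def
  proof
    fix B
    obtain N where N: "B \<le> real N * c" using arch by blast
    have "ereal B \<le> v (s m - s n)" if "N \<le> m" "N \<le> n" for m n
    proof -
      have "ereal (real N * c) \<le> v ((s m - s N) - (s n - s N))"
        by - (rule v_diff_ge, use step that in auto)
      then show ?thesis using N by (auto intro: order_trans[rotated])
    qed
    then show "\<exists>N. \<forall>m\<ge>N. \<forall>n\<ge>N. ereal B \<le> v (s m - s n)" by blast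
  qed
  then obtain x where x: "\<And>B. \<exists>N. \<forall>n\<ge>N. ereal B \<le> v (s n - x)"
    using assms(1) unfolding valuation_complete_def valuation_limit_def by blast
  have xa: "0 < v (x - a)"
  proof -
    obtain N where "ereal c \<le> v (s N - x)" using x[of c] by blast
    then have "0 < v (s N - x)" by (simp add: v_pos_iff)
    then have "0 < v ((s N - a) - (s N - x))" by - (rule v_diff_gt, use inv[of N] in auto)
    then show ?thesis by simp
  qed
  have "ereal B \<le> v (poly f x)" for B
  proof -
    obtain N1 where N1: "\<forall>n\<ge>N1. ereal B \<le> v (s n - x)" using x by blast
    obtain N2 where N2: "B \<le> real N2 * c" using arch by blast
    define n where "n = max N1 N2"
    have "B \<le> real (Suc n) * c"
      using N2 c_pos order_trans[OF N2, of "real (Suc n) * c"] by (simp add: n_def)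
    then have 1: "ereal B \<le> v (poly f (s n))" using inv[of n] by (auto intro: order_trans[rotated])
    obtain q where q: "poly f (s n) - poly f x = (s n - x) * q" "0 < v (q - u)"
      using poly_difference_quotient[OF f a _ xa, of "s n"] inv[of n] unfolding u_def by blast
    have "v q = 0" using unit_cong[OF u0(1) q(2)] .
    then have "ereal B \<le> v (poly f (s n) - poly f x)"
      using q(1) N1 by (simp add: v_mult n_def)
    then have "ereal B \<le> v (poly f (s n) - (poly f (s n) - poly f x))"
      by - (rule v_diff_ge, use 1 in auto)
    then show ?thesis by simp
  qed
  then have "v (poly f x) = \<infinity>" by (meson ereal_top)
  then show ?thesis using xa v_0 by blast
qed

text \<open>The reduction of \<open>f\<close> is a separable polynomial over an algebraically closed field, so it has as
  many distinct roots as its degree. The argument stays in the valuation ring, where a root of the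
  reduction is a point at which \<open>f\<close> has positive valuation: one such point \<open>a\<close> is split off by
  division by \<open>X - a\<close>, and the product rule passes separability on to the quotient.\<close>

lemma incongruent_approximate_roots:
  assumes approx: "\<And>f. (\<And>i. 0 \<le> v (Polynomial.coeff f i)) \<Longrightarrow> Polynomial.lead_coeff f = 1 \<Longrightarrow> 0 < Polynomial.degree f
        \<Longrightarrow> \<exists>a. 0 \<le> v a \<and> 0 < v (poly f a)"
    and "\<And>i. 0 \<le> v (Polynomial.coeff f i)" "Polynomial.lead_coeff f = 1"
    and "\<And>y. 0 \<le> v y \<Longrightarrow> 0 < v (poly f y) \<Longrightarrow> v (poly (pderiv f) y) = 0"
  shows "\<exists>S. finite S \<and> card S = Polynomial.degree f \<and> (\<forall>a\<in>S. 0 \<le> v a \<and> 0 < v (poly f a))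
          \<and> (\<forall>a\<in>S. \<forall>b\<in>S. a \<noteq> b \<longrightarrow> v (a - b) = 0)
          \<and> (\<forall>y. 0 \<le> v y \<longrightarrow> 0 < v (poly f y) \<longrightarrow> (\<exists>a\<in>S. 0 < v (y - a)))"
  using assms(2-)
proof (induction "Polynomial.degree f" arbitrary: f)
  case 0
  obtain b where b: "f = [:b:]" using 0(1)[symmetric] by (rule degree_eq_zeroE)
  with 0(3) have "f = 1" by (simp add: one_pCons)
  then show ?case by (intro exI[of _ "{}"]) simp
next
  case (Suc n)
  obtain a where a: "0 \<le> v a" "0 < v (poly f a)"
    using approx[OF Suc.prems(1,2)] Suc.hyps(2) by auto
  define q where "q = synthetic_div f a"
  have f: "f = [:-a, 1:] * q + [:poly f a:]"
    using synthetic_div_correct'[of a f] by (simp add: q_def)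
  have degq: "Polynomial.degree q = n" using Suc.hyps(2) by (simp add: q_def degree_synthetic_div)
  have fS: "Polynomial.coeff f (Suc i) = Polynomial.coeff q i - a * Polynomial.coeff q (Suc i)" for i
    by (subst f) (simp add: coeff_pCons)
  have lq: "Polynomial.lead_coeff q = 1"
  proof -
    have "Polynomial.lead_coeff f = Polynomial.coeff q n - a * Polynomial.coeff q (Suc n)"
      using fS[of n] Suc.hyps(2) by simp
    then show ?thesis using Suc.prems(2) degq by (simp add: Polynomial.coeff_eq_0)
  qed
  \<comment> \<open>Synthetic division by a monic linear factor keeps the coefficients integral; they are computed
    from the leading one downwards.\<close>
  have q_int: "0 \<le> v (Polynomial.coeff q i)" for i
  proof (cases "i \<le> Suc n")
    case True
    then show ?thesis
    proof (induction i rule: inc_induct)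
      case base
      show ?case using degq by (simp add: Polynomial.coeff_eq_0)
    next
      case (step i)
      have "Polynomial.coeff q i = Polynomial.coeff f (Suc i) + a * Polynomial.coeff q (Suc i)" using fS[of i] by simp
      then show ?case using Suc.prems(1) step.IH a by (simp add: v_add_ge v_mult_ge0)
    qed
  qed (simp add: degq Polynomial.coeff_eq_0)
  have fy: "poly f y = (y - a) * poly q y + poly f a" for y
    using arg_cong[OF f, of "\<lambda>g. poly g y"] by (simp add: algebra_simps)
  have "pderiv f = pderiv ([:-a, 1:] * q) + pderiv [:poly f a:]"
    using arg_cong[OF f, of pderiv] by (simp only: pderiv_add)
  also have "\<dots> = [:-a, 1:] * pderiv q + q * [:1:]"
    by (simp only: pderiv_mult pderiv_pCons) simp
  finally have f': "pderiv f = [:-a, 1:] * pderiv q + q * [:1:]" .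
  have f'y: "poly (pderiv f) y = (y - a) * poly (pderiv q) y + poly q y" for y
    unfolding f' by (simp add: algebra_simps)
  have sub: "0 \<le> v (y - a)" if "0 \<le> v y" for y by - (rule v_diff_ge, use that a in auto)
  \<comment> \<open>Approximate roots of the quotient are approximate roots of \<open>f\<close> that are incongruent to \<open>a\<close>, and
    the quotient is again separable.\<close>
  have key: "0 < v (poly f y) \<and> v (y - a) = 0 \<and> v (poly (pderiv q) y) = 0"
    if y: "0 \<le> v y" "0 < v (poly q y)" for y
  proof -
    have f1: "0 < v (poly f y)"
      by (subst fy) (use y a sub in \<open>auto intro!: v_add_gt v_mult_pos'\<close>)
    have "v (poly (pderiv f) y) = 0" using Suc.prems(3) y f1 by blast
    then have "v ((y - a) * poly (pderiv q) y) = 0"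
      using unit_cong[of "poly (pderiv f) y" "(y - a) * poly (pderiv q) y"] y
        v_minus_commute[of "(y - a) * poly (pderiv q) y" "poly (pderiv f) y"]
      by (simp add: f'y algebra_simps)
    then show ?thesis
      using unit_factors[OF _ sub[OF y(1)] v_poly_ge0[OF v_coeff_pderiv_ge0[OF q_int] y(1)]] f1
      by simp
  qed
  obtain S where S: "finite S" "card S = n" "\<forall>a\<in>S. 0 \<le> v a \<and> 0 < v (poly q a)"
      "\<forall>a\<in>S. \<forall>b\<in>S. a \<noteq> b \<longrightarrow> v (a - b) = 0"
      "\<forall>y. 0 \<le> v y \<longrightarrow> 0 < v (poly q y) \<longrightarrow> (\<exists>a\<in>S. 0 < v (y - a))"
    using Suc.hyps(1)[OF degq[symmetric] q_int lq conjunct2[OF conjunct2[OF key]]] degq by auto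
  have Sa: "v (b - a) = 0" "v (a - b) = 0" if "b \<in> S" for b
    using key S(3) that v_minus_commute[of a b] by auto
  have "a \<notin> S" using Sa[of a] by auto
  moreover have "\<exists>b\<in>insert a S. 0 < v (y - b)" if y: "0 \<le> v y" "0 < v (poly f y)" for y
  proof (cases "0 < v (y - a)")
    case False
    then have ya: "v (y - a) = 0" using sub[OF y(1)] by simp
    have "0 < v (poly f y - poly f a)" by - (rule v_diff_gt, use y a in auto)
    then have "0 < v ((y - a) * poly q y)" using fy[of y] by simp
    then have "0 < v (poly q y)" using ya by (simp add: v_mult)
    then show ?thesis using S(5) y by blast
  qed auto
  moreover have "0 < v (poly f b)" if "b \<in> S" for b using key[of b] S(3) that by blast
  ultimately show ?case
    using S(1-4) a Sa Suc.hyps(2) by (intro exI[of _ "insert a S"] conjI) simp_all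
qed

text \<open>Hensel's lemma matches the residue classes represented in \<open>S\<close> with the roots of \<open>f\<close>.\<close>

lemma card_roots_lifting:
  assumes "valuation_complete v"
    and f: "\<And>i. 0 \<le> v (Polynomial.coeff f i)"
    and S: "\<forall>a\<in>S. 0 \<le> v a \<and> 0 < v (poly f a) \<and> v (poly (pderiv f) a) = 0"
      "\<forall>a\<in>S. \<forall>b\<in>S. a \<noteq> b \<longrightarrow> v (a - b) = 0"
      "\<forall>y\<in>Y. 0 < v (poly f y) \<longrightarrow> (\<exists>a\<in>S. 0 < v (y - a))"
      "\<And>a y. a \<in> S \<Longrightarrow> 0 < v (y - a) \<Longrightarrow> y \<in> Y"
  shows "card {y\<in>Y. poly f y = 0} = card S"
proof -
  define g where "g a = (SOME x. poly f x = 0 \<and> 0 < v (x - a))" for a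
  have g: "poly f (g a) = 0" "0 < v (g a - a)" if "a \<in> S" for a
  proof -
    have "\<exists>x. poly f x = 0 \<and> 0 < v (x - a)"
      using S(1) that by (intro hensel_exists[OF assms(1) f]) auto
    then have "poly f (g a) = 0 \<and> 0 < v (g a - a)" unfolding g_def by (rule someI_ex)
    then show "poly f (g a) = 0" "0 < v (g a - a)" by auto
  qed
  have "bij_betw g S {y\<in>Y. poly f y = 0}"
    unfolding bij_betw_def
  proof
    show "inj_on g S"
    proof (rule inj_onI, rule ccontr)
      fix a b assume ab: "a \<in> S" "b \<in> S" "g a = g b" "a \<noteq> b"
      have "0 < v ((g b - b) - (g a - a))" by (rule v_diff_gt[OF g(2)[OF ab(2)] g(2)[OF ab(1)]])
      then have "0 < v (a - b)" using ab(3) by simp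
      moreover have "v (a - b) = 0" using S(2) ab by blast
      ultimately show False by simp
    qed
    show "g ` S = {y\<in>Y. poly f y = 0}"
    proof (intro equalityI subsetI)
      fix y assume y: "y \<in> {y\<in>Y. poly f y = 0}"
      then have "\<exists>a\<in>S. 0 < v (y - a)" using S(3) by auto
      then obtain a where a: "a \<in> S" "0 < v (y - a)" by blast
      have "y = g a"
        using hensel_unique[OF f _ _ a(2) g(2)[OF a(1)]] S(1) a(1) g(1)[OF a(1)] y by simp
      then show "y \<in> g ` S" using a(1) by blast
    next
      fix y assume "y \<in> g ` S"
      then obtain a where "a \<in> S" "y = g a" by blast
      then show "y \<in> {y\<in>Y. poly f y = 0}" using g[of a] S(4)[of a y] by simp
    qed
  qed
  then show ?thesis using bij_betw_same_card by metis
qed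

end

section \<open>Roots whose valuation is the slope of a given edge\<close>

text \<open>Exponents may be negative; factoring out the lowest power leaves an honest polynomial.\<close>

lemma laurent_sum_eq_poly:
  fixes b :: "int \<Rightarrow> 'a::field"
  assumes A: "finite A" and y: "y \<noteq> 0"
  shows "(\<Sum>\<gamma>\<in>A. b \<gamma> * y powi \<gamma>)
    = y powi Min A * poly (\<Sum>\<gamma>\<in>A. Polynomial.monom (b \<gamma>) (nat (\<gamma> - Min A))) y"
proof -
  have "y powi \<gamma> = y powi Min A * y ^ nat (\<gamma> - Min A)" if "\<gamma> \<in> A" for \<gamma>
  proof -
    have "y powi (Min A + int (nat (\<gamma> - Min A))) = y powi Min A * y powi (int (nat (\<gamma> - Min A)))"
      using y by (intro power_int_add) auto
    moreover have "Min A + int (nat (\<gamma> - Min A)) = \<gamma>" using Min_le[OF A that] by simp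
    ultimately show ?thesis by (simp only: power_int_of_nat)
  qed
  then show ?thesis
    by (simp add: poly_sum poly_monom sum_distrib_left mult.left_commute)
qed

text \<open>A crude bound that needs no genericity. It limits the damage done by the exceptional
  coefficients for which three points are collinear.\<close>

lemma card_nonzero_roots_le:
  fixes a :: "int \<Rightarrow> 'a::field"
  assumes A: "finite A" "\<alpha> \<in> A" "a \<alpha> \<noteq> 0"
  shows "card (nonzero_roots A a) \<le> nat (Max A - Min A)"
proof -
  define P where "P = (\<Sum>\<gamma>\<in>A. Polynomial.monom (a \<gamma>) (nat (\<gamma> - Min A)))"
  have exponent: "nat (\<gamma> - Min A) = nat (\<alpha> - Min A) \<longleftrightarrow> \<gamma> = \<alpha>" if "\<gamma> \<in> A" for \<gamma>
    using Min_le[OF A(1) that] Min_le[OF A(1,2)] by auto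
  have "Polynomial.coeff P (nat (\<alpha> - Min A)) = (\<Sum>\<gamma>\<in>A. if \<gamma> = \<alpha> then a \<gamma> else 0)"
    unfolding P_def Polynomial.coeff_sum by (intro sum.cong) (simp_all add: exponent)
  then have "Polynomial.coeff P (nat (\<alpha> - Min A)) = a \<alpha>" using A by simp
  then have P: "P \<noteq> 0" using A(3) by auto
  have "Polynomial.degree P \<le> nat (Max A - Min A)"
    unfolding P_def
  proof (rule degree_sum_le[OF A(1)])
    fix \<gamma> assume "\<gamma> \<in> A"
    then have "nat (\<gamma> - Min A) \<le> nat (Max A - Min A)" using Max_ge[OF A(1)] by (intro nat_mono) simp
    then show "Polynomial.degree (Polynomial.monom (a \<gamma>) (nat (\<gamma> - Min A))) \<le> nat (Max A - Min A)"
      using Polynomial.degree_monom_le[of "a \<gamma>" "nat (\<gamma> - Min A)"] by linarith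
  qed
  moreover have "nonzero_roots A a \<subseteq> {x. poly P x = 0}"
    using laurent_sum_eq_poly[OF A(1), of _ a] by (auto simp: nonzero_roots_def P_def)
  then have "card (nonzero_roots A a) \<le> card {x. poly P x = 0}"
    by (intro card_mono poly_roots_finite P)
  moreover have "card {x. poly P x = 0} \<le> Polynomial.degree P" by (rule card_poly_roots_bound[OF P])
  ultimately show ?thesis by simp
qed

text \<open>The two ways in which the residue field enters the count of roots: it is algebraically closed,
  and the integers up to \<open>W\<close> are invertible in it.\<close>

locale alg_closed_residue_field = discretely_valued_field +
  fixes W :: int
  assumes complete: "valuation_complete v"
    and approximate_root: "(\<And>i. 0 \<le> v (Polynomial.coeff f i)) \<Longrightarrow> Polynomial.lead_coeff f = 1 \<Longrightarrow>
      0 < Polynomial.degree f \<Longrightarrow> \<exists>a. 0 \<le> v a \<and> 0 < v (poly f a)"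
    and v_of_nat: "0 < d \<Longrightarrow> int d \<le> W \<Longrightarrow> v (of_nat d) = 0"
begin

text \<open>Modulo the maximal ideal the sum is \<open>b \<beta> * y ^ \<alpha> * (y ^ (\<beta> - \<alpha>) + u)\<close> for a unit \<open>u\<close>. Its last
  factor is separable since \<open>\<beta> - \<alpha>\<close> is invertible, so its residual roots lift one by one.\<close>

lemma card_unit_roots:
  assumes A: "finite A" "\<alpha> \<in> A" "\<beta> \<in> A" "\<alpha> < \<beta>" "\<beta> - \<alpha> \<le> W"
    and b: "v (b \<alpha>) = 0" "v (b \<beta>) = 0" "\<And>\<gamma>. \<gamma> \<in> A - {\<alpha>, \<beta>} \<Longrightarrow> 0 < v (b \<gamma>)"
  shows "card {y. v y = 0 \<and> (\<Sum>\<gamma>\<in>A. b \<gamma> * y powi \<gamma>) = 0} = nat (\<beta> - \<alpha>)"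
proof -
  define lo where "lo = Min A"
  define e where "e \<gamma> = nat (\<gamma> - lo)" for \<gamma>
  define d where "d = nat (\<beta> - \<alpha>)"
  have d: "0 < d" "int d \<le> W" using A by (simp_all add: d_def)
  have lo: "lo \<le> \<gamma>" if "\<gamma> \<in> A" for \<gamma> using A(1) that by (simp add: lo_def)
  have e_\<beta>: "e \<beta> = e \<alpha> + d" using lo[OF A(2)] A(4) by (simp add: e_def d_def)
  define P where "P = (\<Sum>\<gamma>\<in>A. Polynomial.monom (b \<gamma>) (e \<gamma>))"
  define R where "R = (\<Sum>\<gamma>\<in>A - {\<alpha>, \<beta>}. Polynomial.monom (b \<gamma>) (e \<gamma>))"
  define u where "u = b \<alpha> / b \<beta>"
  define f where "f = Polynomial.monom 1 d + Polynomial.monom u 0"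
  have b\<beta>: "b \<beta> \<noteq> 0" using b(2) v_0[of "b \<beta>"] by auto
  have u: "v u = 0"
    using v_mult_unit[OF b(1) v_inverse_unit[OF b(2)]] by (simp add: u_def divide_inverse)
  \<comment> \<open>The part \<open>R\<close> vanishes modulo the maximal ideal.\<close>
  have P_split: "P = Polynomial.smult (b \<beta>) (Polynomial.monom 1 (e \<alpha>) * f) + R"
  proof -
    let ?g = "\<lambda>\<gamma>. Polynomial.monom (b \<gamma>) (e \<gamma>)"
    have "P = ?g \<alpha> + sum ?g (A - {\<alpha>})"
      unfolding P_def by (rule sum.remove) (use A in auto)
    also have "sum ?g (A - {\<alpha>}) = ?g \<beta> + sum ?g (A - {\<alpha>} - {\<beta>})"
      by (rule sum.remove) (use A in auto)
    also have "A - {\<alpha>} - {\<beta>} = A - {\<alpha>, \<beta>}" by blast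
    finally have "P = ?g \<alpha> + (?g \<beta> + R)" unfolding R_def .
    moreover have "Polynomial.smult (b \<beta>) (Polynomial.monom 1 (e \<alpha>) * f)
        = Polynomial.monom (b \<beta>) (e \<beta>) + Polynomial.monom (b \<alpha>) (e \<alpha>)"
      unfolding f_def distrib_left mult_monom smult_add_right smult_monom
      using b\<beta> by (simp add: e_\<beta> u_def)
    ultimately show ?thesis by (simp only: ac_simps)
  qed
  have R_coeff: "0 < v (Polynomial.coeff R i)" for i
    unfolding R_def Polynomial.coeff_sum using b(3) by (intro v_sum_gt) auto
  have P_coeff: "0 \<le> v (Polynomial.coeff P i)" for i
  proof -
    have "0 \<le> v (b \<gamma>)" if "\<gamma> \<in> A" for \<gamma>
      using b that by (cases "\<gamma> \<in> {\<alpha>, \<beta>}") (auto intro: less_imp_le)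
    then show ?thesis unfolding P_def Polynomial.coeff_sum by (intro v_sum_ge) auto
  qed
  have f_coeff: "0 \<le> v (Polynomial.coeff f i)" for i
    using u by (simp add: f_def v_add_ge)
  have f_monic: "Polynomial.lead_coeff f = 1" and f_deg: "Polynomial.degree f = d"
  proof -
    show "Polynomial.degree f = d"
    proof -
      have "Polynomial.degree (Polynomial.monom u 0) < Polynomial.degree (Polynomial.monom (1::'a) d)"
        using d(1) Polynomial.degree_monom_le[of u 0] by (simp add: Polynomial.degree_monom_eq)
      then show ?thesis
        by (simp add: f_def Polynomial.degree_add_eq_left Polynomial.degree_monom_eq)
    qed
    then show "Polynomial.lead_coeff f = 1"
      using d(1) by (simp add: f_def)
  qed
  have f_at: "poly f y = y ^ d + u" for y by (simp add: f_def poly_monom)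
  have f_root_unit: "v y = 0" if "0 \<le> v y" "0 < v (poly f y)" for y
  proof -
    have "v (y ^ d) = 0"
      using unit_cong[of "- u" "y ^ d"] that(2) u by (simp add: f_at)
    moreover have "y ^ d = y * y ^ (d - 1)" using d(1) by (cases d) simp_all
    ultimately have "v (y * y ^ (d - 1)) = 0" by metis
    then show ?thesis using unit_factors[OF _ that(1) v_power_ge0[OF that(1)]] by blast
  qed
  have f'_unit: "v (poly (pderiv f) y) = 0" if "0 \<le> v y" "0 < v (poly f y)" for y
  proof -
    have "poly (pderiv f) y = of_nat d * y ^ (d - 1)"
      by (simp add: f_def pderiv_add pderiv_monom poly_monom pderiv_pCons)
    then show ?thesis
      using v_mult_unit[OF v_of_nat[OF d] v_power_unit[OF f_root_unit[OF that]]] by simp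
  qed
  have "\<exists>S. finite S \<and> card S = Polynomial.degree f \<and> (\<forall>a\<in>S. 0 \<le> v a \<and> 0 < v (poly f a))
          \<and> (\<forall>a\<in>S. \<forall>b\<in>S. a \<noteq> b \<longrightarrow> v (a - b) = 0)
          \<and> (\<forall>y. 0 \<le> v y \<longrightarrow> 0 < v (poly f y) \<longrightarrow> (\<exists>a\<in>S. 0 < v (y - a)))"
    by (rule incongruent_approximate_roots)
      (rule approximate_root f_coeff f_monic f'_unit; assumption)+
  then obtain S where S: "finite S" "card S = Polynomial.degree f"
      "\<forall>a\<in>S. 0 \<le> v a \<and> 0 < v (poly f a)"
      "\<forall>a\<in>S. \<forall>b\<in>S. a \<noteq> b \<longrightarrow> v (a - b) = 0"
      "\<forall>y. 0 \<le> v y \<longrightarrow> 0 < v (poly f y) \<longrightarrow> (\<exists>a\<in>S. 0 < v (y - a))"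
    by (elim exE conjE) (rule that)
  have P_at: "poly P y = b \<beta> * y ^ e \<alpha> * poly f y + poly R y" for y
    by (simp add: P_split poly_monom mult.assoc)
  have P_unit: "0 < v (poly P y) \<longleftrightarrow> 0 < v (poly f y)" if y: "v y = 0" for y
  proof -
    have R: "0 < v (poly R y)" using v_poly_pos[OF R_coeff] y by simp
    have w: "v (b \<beta> * y ^ e \<alpha> * poly f y) = v (poly f y)"
      using v_power_unit[OF y] b(2) by (simp add: v_mult)
    have "0 < v (poly P y)" if "0 < v (poly f y)"
      unfolding P_at by (rule v_add_gt) (use w that R in auto)
    moreover have "0 < v (poly f y)" if "0 < v (poly P y)"
    proof -
      have "0 < v (poly P y - poly R y)" by (rule v_diff_gt) (use that R in auto)
      then show ?thesis using w by (simp add: P_at)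
    qed
    ultimately show ?thesis by blast
  qed
  have P'_unit: "v (poly (pderiv P) a) = 0" if a: "a \<in> S" for a
  proof -
    have a1: "0 \<le> v a" "0 < v (poly f a)" using S(3) a by auto
    have a0: "v a = 0" using f_root_unit a1 .
    have "poly (pderiv P) a = b \<beta> * a ^ e \<alpha> * poly (pderiv f) a
        + (b \<beta> * poly (pderiv (Polynomial.monom 1 (e \<alpha>))) a * poly f a + poly (pderiv R) a)"
      unfolding P_split pderiv_add pderiv_smult pderiv_mult poly_add poly_smult poly_mult poly_monom
      by (simp only: mult_1 distrib_left distrib_right ac_simps)
    moreover have "0 < v (b \<beta> * poly (pderiv (Polynomial.monom 1 (e \<alpha>))) a * poly f a + poly (pderiv R) a)"
    proof (rule v_add_gt)
      have "0 \<le> v (poly (pderiv (Polynomial.monom 1 (e \<alpha>))) a)"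
        unfolding pderiv_monom poly_monom
        by (intro v_mult_ge0 v_power_ge0 v_of_nat_ge0 a1) simp
      then show "0 < v (b \<beta> * poly (pderiv (Polynomial.monom 1 (e \<alpha>))) a * poly f a)"
        using a1 b(2) by (intro v_mult_pos' v_mult_ge0) auto
      show "0 < v (poly (pderiv R) a)" using v_poly_pos[OF v_coeff_pderiv_pos[OF R_coeff] a1(1)] .
    qed
    moreover have "v (b \<beta> * a ^ e \<alpha> * poly (pderiv f) a) = 0"
      using b(2) v_power_unit[OF a0] f'_unit[OF a1] by (simp add: v_mult)
    ultimately show ?thesis using v_add_strict[of "b \<beta> * a ^ e \<alpha> * poly (pderiv f) a"] by simp
  qed
  have S_unit: "v a = 0" if "a \<in> S" for a
    using bspec[OF S(3) that] by (intro f_root_unit) simp_all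
  have card: "card {y \<in> {y. v y = 0}. poly P y = 0} = card S"
  proof (rule card_roots_lifting[OF complete P_coeff _ S(4)])
    show "\<forall>a\<in>S. 0 \<le> v a \<and> 0 < v (poly P a) \<and> v (poly (pderiv P) a) = 0"
    proof
      fix a assume a: "a \<in> S"
      show "0 \<le> v a \<and> 0 < v (poly P a) \<and> v (poly (pderiv P) a) = 0"
        using bspec[OF S(3) a] P'_unit[OF a] P_unit[OF S_unit[OF a]] by simp
    qed
    show "\<forall>y\<in>{y. v y = 0}. 0 < v (poly P y) \<longrightarrow> (\<exists>a\<in>S. 0 < v (y - a))"
    proof (intro ballI impI)
      fix y assume y: "y \<in> {y. v y = 0}" "0 < v (poly P y)"
      then have "0 \<le> v y" "0 < v (poly f y)" using P_unit[of y] by simp_all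
      then show "\<exists>a\<in>S. 0 < v (y - a)" using S(5) by simp
    qed
    show "y \<in> {y. v y = 0}" if "a \<in> S" "0 < v (y - a)" for a y
      using unit_cong[OF S_unit[OF that(1)] that(2)] by simp
  qed
  have "(\<Sum>\<gamma>\<in>A. b \<gamma> * y powi \<gamma>) = y powi lo * poly P y" if "v y = 0" for y
    using laurent_sum_eq_poly[OF A(1), of y b] that v_0[of y]
    by (cases "y = 0") (simp_all add: P_def e_def lo_def)
  moreover have "y powi lo \<noteq> 0" if "v y = 0" for y
    using that v_0[of y] by (cases "y = 0") simp_all
  ultimately have "{y. v y = 0 \<and> (\<Sum>\<gamma>\<in>A. b \<gamma> * y powi \<gamma>) = 0} = {y \<in> {y. v y = 0}. poly P y = 0}"
    by (simp cong: conj_cong)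
  then show ?thesis using card by (simp only: S(2) f_deg d_def)
qed

text \<open>The substitution \<open>x = p powi m * y\<close> followed by division by \<open>p powi h\<close> lowers the supporting line
  of the edge to height zero, where the coefficients at its ends are units and the others lie in the
  maximal ideal.\<close>

lemma card_roots_of_edge:
  assumes A: "finite A" "\<alpha> \<in> A" "\<beta> \<in> A" "\<alpha> < \<beta>" "\<beta> - \<alpha> \<le> W"
    and a: "\<And>\<gamma>. \<gamma> \<in> A \<Longrightarrow> v (a \<gamma>) = ereal (of_int (n \<gamma>) * c)"
    and n: "n \<alpha> + m * \<alpha> = h" "n \<beta> + m * \<beta> = h" "\<And>\<gamma>. \<gamma> \<in> A - {\<alpha>, \<beta>} \<Longrightarrow> h < n \<gamma> + m * \<gamma>"
  shows "card {x \<in> nonzero_roots A a. v x = ereal (of_int m * c)} = nat (\<beta> - \<alpha>)"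
proof -
  define b where "b \<gamma> = a \<gamma> * p powi (m * \<gamma> - h)" for \<gamma>
  have b: "v (b \<gamma>) = ereal (of_int (n \<gamma> + m * \<gamma> - h) * c)" if "\<gamma> \<in> A" for \<gamma>
    using a[OF that] v_powi[OF p_nonzero v_p]
    by (simp add: b_def v_mult algebra_simps)
  have 1: "card {y. v y = 0 \<and> (\<Sum>\<gamma>\<in>A. b \<gamma> * y powi \<gamma>) = 0} = nat (\<beta> - \<alpha>)"
  proof (rule card_unit_roots[OF A])
    have "n \<alpha> + m * \<alpha> - h = 0" "n \<beta> + m * \<beta> - h = 0" using n by simp_all
    then show "v (b \<alpha>) = 0" "v (b \<beta>) = 0"
      using b[OF A(2)] b[OF A(3)] by (simp_all only: of_int_0 mult_zero_left zero_ereal_def)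
    show "0 < v (b \<gamma>)" if "\<gamma> \<in> A - {\<alpha>, \<beta>}" for \<gamma>
    proof -
      have "0 < of_int (n \<gamma> + m * \<gamma> - h) * c"
        using n(3)[OF that] c_pos
        by (intro mult_pos_pos) (simp_all only: of_int_0_less_iff diff_gt_0_iff_gt)
      then show ?thesis using b[of \<gamma>] that by (simp add: zero_ereal_def)
    qed
  qed
  have eq: "(\<Sum>\<gamma>\<in>A. a \<gamma> * (p powi m * y) powi \<gamma>) = p powi h * (\<Sum>\<gamma>\<in>A. b \<gamma> * y powi \<gamma>)" for y
  proof -
    have "a \<gamma> * (p powi m * y) powi \<gamma> = p powi h * (b \<gamma> * y powi \<gamma>)" for \<gamma>
    proof -
      have "p powi (m * \<gamma>) = p powi h * p powi (m * \<gamma> - h)"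
        using power_int_add[of p h "m * \<gamma> - h"] p_nonzero by simp
      then show ?thesis by (simp add: b_def power_int_mult_distrib power_int_mult)
    qed
    then show ?thesis by (simp add: sum_distrib_left)
  qed
  define Y where "Y = {y. v y = 0 \<and> (\<Sum>\<gamma>\<in>A. b \<gamma> * y powi \<gamma>) = 0}"
  have pm: "p powi m \<noteq> 0" "v (p powi m) = ereal (of_int m * c)" "p powi h \<noteq> 0"
    using p_nonzero v_powi[OF p_nonzero v_p] by simp_all
  have root: "p powi m * y \<in> nonzero_roots A a \<and> v (p powi m * y) = ereal (of_int m * c) \<longleftrightarrow> y \<in> Y" for y
  proof -
    have "v (p powi m * y) = ereal (of_int m * c) \<longleftrightarrow> v y = 0"
      unfolding v_mult pm(2) by (cases "v y") (simp_all add: zero_ereal_def)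
    moreover have "y \<noteq> 0" if "v y = 0" using that v_0[of y] by (cases "y = 0") simp_all
    ultimately show ?thesis
      unfolding nonzero_roots_def Y_def mem_Collect_eq eq using pm(1,3) by (metis mult_eq_0_iff)
  qed
  have "{x \<in> nonzero_roots A a. v x = ereal (of_int m * c)} = (\<lambda>y. p powi m * y) ` Y"
  proof (intro equalityI subsetI)
    fix x assume x: "x \<in> {x \<in> nonzero_roots A a. v x = ereal (of_int m * c)}"
    have xy: "p powi m * (inverse (p powi m) * x) = x" using pm(1) by simp
    then have "inverse (p powi m) * x \<in> Y"
      using x root[of "inverse (p powi m) * x"] unfolding xy by simp
    then show "x \<in> (\<lambda>y. p powi m * y) ` Y" using xy[symmetric] by (rule rev_image_eqI)
  next
    fix x assume "x \<in> (\<lambda>y. p powi m * y) ` Y"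
    then obtain y where "x = p powi m * y" "y \<in> Y" by (rule imageE)
    then show "x \<in> {x \<in> nonzero_roots A a. v x = ereal (of_int m * c)}" using root[of y] by simp
  qed
  moreover have "inj_on (\<lambda>y. p powi m * y) Y" using p_nonzero by (simp add: inj_on_def)
  ultimately show ?thesis using 1 by (simp add: card_image Y_def)
qed

end

section \<open>Newton polygons and the number of roots\<close>

text \<open>The height of the point over \<open>\<gamma>\<close> above the line through the points over \<open>\<alpha>\<close> and \<open>\<beta>\<close>, multiplied
  by \<open>(\<beta> - \<alpha>)\<^sup>2\<close>. This multiple is an integer and symmetric in \<open>\<alpha>\<close> and \<open>\<beta>\<close>.\<close>

definition excess :: "int \<Rightarrow> int \<Rightarrow> int \<Rightarrow> (int \<Rightarrow> int) \<Rightarrow> int" where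
  "excess \<alpha> \<beta> \<gamma> n = (\<beta> - \<alpha>) * ((\<beta> - \<alpha>) * n \<gamma> - (\<beta> - \<gamma>) * n \<alpha> - (\<gamma> - \<alpha>) * n \<beta>)"

definition hull_edge :: "int set \<Rightarrow> (int \<Rightarrow> int) \<Rightarrow> int \<Rightarrow> int \<Rightarrow> bool" where
  "hull_edge A n \<alpha> \<beta> \<longleftrightarrow> \<alpha> \<in> A \<and> \<beta> \<in> A \<and> \<alpha> \<noteq> \<beta> \<and> (\<forall>\<gamma>\<in>A - {\<alpha>, \<beta>}. 0 < excess \<alpha> \<beta> \<gamma> n)"

text \<open>For \<open>B = 0\<close> this says that three of the points are collinear. Excluding it for a positive \<open>B\<close>
  makes the hull stable under small changes of the heights.\<close>

definition nearly_collinear :: "int set \<Rightarrow> int \<Rightarrow> (int \<Rightarrow> int) \<Rightarrow> bool" where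
  "nearly_collinear A B n \<longleftrightarrow>
     (\<exists>\<alpha>\<in>A. \<exists>\<beta>\<in>A. \<exists>\<gamma>\<in>A. \<alpha> \<noteq> \<beta> \<and> \<gamma> \<noteq> \<alpha> \<and> \<gamma> \<noteq> \<beta> \<and> \<bar>excess \<alpha> \<beta> \<gamma> n\<bar> \<le> B)"

definition ordered_pairs :: "int set \<Rightarrow> (int \<times> int) set" where
  "ordered_pairs A = {(\<alpha>, \<beta>) \<in> A \<times> A. \<alpha> < \<beta>}"

text \<open>An edge contributes its horizontal length if its slope is an integer, that is, the valuation of
  an element of the field.\<close>

definition integral_width :: "int set \<Rightarrow> (int \<Rightarrow> int) \<Rightarrow> int" where
  "integral_width A n = (\<Sum>(\<alpha>, \<beta>)\<in>ordered_pairs A.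
     if hull_edge A n \<alpha> \<beta> \<and> \<beta> - \<alpha> dvd n \<alpha> - n \<beta> then \<beta> - \<alpha> else 0)"

lemma excess_from_line:
  assumes "n \<alpha> + m * \<alpha> = h" "n \<beta> + m * \<beta> = h"
  shows "excess \<alpha> \<beta> \<gamma> n = (\<beta> - \<alpha>)\<^sup>2 * (n \<gamma> + m * \<gamma> - h)"
proof -
  have n: "n \<alpha> = h - m * \<alpha>" "n \<beta> = h - m * \<beta>" using assms by simp_all
  show ?thesis unfolding excess_def n by (simp add: power2_eq_square algebra_simps)
qed

lemma hull_edge_iff_line:
  assumes "n \<alpha> + m * \<alpha> = h" "n \<beta> + m * \<beta> = h" "\<alpha> \<in> A" "\<beta> \<in> A" "\<alpha> < \<beta>"
  shows "hull_edge A n \<alpha> \<beta> \<longleftrightarrow> (\<forall>\<gamma>\<in>A - {\<alpha>, \<beta>}. h < n \<gamma> + m * \<gamma>)"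
proof -
  have "(0::int) < (\<beta> - \<alpha>)\<^sup>2" using assms(5) by simp
  then show ?thesis
    using assms(3-5) by (auto simp: hull_edge_def excess_from_line[OF assms(1,2)] zero_less_mult_iff)
qed

lemma finite_ordered_pairs: "finite A \<Longrightarrow> finite (ordered_pairs A)"
  by (rule finite_subset[of _ "A \<times> A"]) (auto simp: ordered_pairs_def)

context alg_closed_residue_field
begin

text \<open>Among the terms of a vanishing sum the least valuation occurs at least twice, and it occurs at
  most twice because three terms of equal valuation belong to three collinear points.\<close>

lemma root_valuation_on_edge:
  assumes A: "finite A" and a: "\<And>\<gamma>. \<gamma> \<in> A \<Longrightarrow> v (a \<gamma>) = ereal (of_int (n \<gamma>) * c)"
    and generic: "\<not> nearly_collinear A 0 n" and ne: "A \<noteq> {}"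
    and x: "x \<in> nonzero_roots A a" "v x = ereal (of_int m * c)"
  shows "\<exists>(\<alpha>, \<beta>) \<in> ordered_pairs A. n \<alpha> + m * \<alpha> = n \<beta> + m * \<beta>
           \<and> (\<forall>\<gamma>\<in>A - {\<alpha>, \<beta>}. n \<alpha> + m * \<alpha> < n \<gamma> + m * \<gamma>)"
proof -
  \<comment> \<open>\<open>t \<gamma> * c\<close> is the valuation of the term of exponent \<open>\<gamma>\<close> at \<open>x\<close>.\<close>
  define t where "t \<gamma> = n \<gamma> + m * \<gamma>" for \<gamma>
  have x0: "x \<noteq> 0" "(\<Sum>\<gamma>\<in>A. a \<gamma> * x powi \<gamma>) = 0" using x by (auto simp: nonzero_roots_def)
  have v_term: "v (a \<gamma> * x powi \<gamma>) = ereal (of_int (t \<gamma>) * c)" if "\<gamma> \<in> A" for \<gamma>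
    using a[OF that] v_powi[OF x0(1) x(2)] by (simp add: v_mult t_def algebra_simps)
  obtain \<alpha> where \<alpha>: "\<alpha> \<in> A" "\<And>\<gamma>. \<gamma> \<in> A \<Longrightarrow> t \<alpha> \<le> t \<gamma>"
    using ex_min_if_finite[of "t ` A"] A ne by (metis (no_types, lifting) finite_imageI image_eqI image_iff image_is_empty linorder_not_less)
  have "\<exists>\<beta>\<in>A. \<beta> \<noteq> \<alpha> \<and> t \<beta> = t \<alpha>"
  proof (rule ccontr)
    assume neg: "\<not> (\<exists>\<beta>\<in>A. \<beta> \<noteq> \<alpha> \<and> t \<beta> = t \<alpha>)"
    have strict: "t \<alpha> < t \<gamma>" if "\<gamma> \<in> A - {\<alpha>}" for \<gamma>
      using \<alpha>(2)[of \<gamma>] neg that by fastforce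
    have "v (a \<alpha> * x powi \<alpha>) < v (\<Sum>\<gamma>\<in>A - {\<alpha>}. a \<gamma> * x powi \<gamma>)"
    proof (rule v_sum_gt)
      show "v (a \<alpha> * x powi \<alpha>) < \<infinity>" using v_term[OF \<alpha>(1)] by simp
      show "v (a \<alpha> * x powi \<alpha>) < v (a \<gamma> * x powi \<gamma>)" if "\<gamma> \<in> A - {\<alpha>}" for \<gamma>
        using v_term[OF \<alpha>(1)] v_term[of \<gamma>] strict[OF that] that c_pos by simp
    qed
    then have "v (a \<alpha> * x powi \<alpha> + (\<Sum>\<gamma>\<in>A - {\<alpha>}. a \<gamma> * x powi \<gamma>)) = v (a \<alpha> * x powi \<alpha>)"
      by (rule v_add_strict)
    then show False using x0(2) v_term[OF \<alpha>(1)] sum.remove[OF A \<alpha>(1), of "\<lambda>\<gamma>. a \<gamma> * x powi \<gamma>"] by simp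
  qed
  then obtain \<beta> where \<beta>: "\<beta> \<in> A" "\<beta> \<noteq> \<alpha>" "t \<beta> = t \<alpha>" by blast
  have "t \<alpha> < t \<gamma>" if "\<gamma> \<in> A - {\<alpha>, \<beta>}" for \<gamma>
  proof -
    have "t \<gamma> \<noteq> t \<alpha>"
    proof
      assume "t \<gamma> = t \<alpha>"
      then have "excess \<alpha> \<beta> \<gamma> n = 0"
        using excess_from_line[of n \<alpha> m "t \<alpha>" \<beta> \<gamma>] \<beta> by (simp add: t_def)
      then show False using generic \<alpha> \<beta> that unfolding nearly_collinear_def by fastforce
    qed
    then show ?thesis using \<alpha>(2)[of \<gamma>] that by simp
  qed
  then have sep: "\<forall>\<gamma>\<in>A - {\<alpha>, \<beta>}. t \<alpha> < t \<gamma>" "\<forall>\<gamma>\<in>A - {\<beta>, \<alpha>}. t \<beta> < t \<gamma>" using \<beta>(3) by auto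
  show ?thesis
  proof (cases "\<alpha> < \<beta>")
    case True
    then show ?thesis using sep \<alpha> \<beta> unfolding t_def ordered_pairs_def by force
  next
    case False
    then have "(\<beta>, \<alpha>) \<in> ordered_pairs A" using \<alpha> \<beta> by (simp add: ordered_pairs_def)
    then show ?thesis using sep \<beta>(3) unfolding t_def by force
  qed
qed

text \<open>The roots are sorted according to the edge on which they lie. The edges partition them, since the
  valuation of a root determines the two terms of least valuation.\<close>

theorem card_nonzero_roots:
  assumes A: "finite A" and a: "\<And>\<gamma>. \<gamma> \<in> A \<Longrightarrow> v (a \<gamma>) = ereal (of_int (n \<gamma>) * c)"
    and generic: "\<not> nearly_collinear A 0 n" and ne: "A \<noteq> {}"
    and W: "\<And>\<alpha> \<beta>. \<alpha> \<in> A \<Longrightarrow> \<beta> \<in> A \<Longrightarrow> \<beta> - \<alpha> \<le> W"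
  shows "int (card (nonzero_roots A a)) = integral_width A n"
proof -
  \<comment> \<open>The line of slope \<open>-m\<close> through the points over \<open>\<alpha>\<close> and \<open>\<beta>\<close> lies strictly below all others.\<close>
  define on_edge where "on_edge \<alpha> \<beta> m \<longleftrightarrow> n \<alpha> + m * \<alpha> = n \<beta> + m * \<beta>
           \<and> (\<forall>\<gamma>\<in>A - {\<alpha>, \<beta>}. n \<alpha> + m * \<alpha> < n \<gamma> + m * \<gamma>)" for \<alpha> \<beta> m :: int
  define R where "R e = {x \<in> nonzero_roots A a. \<exists>m. v x = ereal (of_int m * c) \<and> on_edge (fst e) (snd e) m}" for e
  have m_unique: "m = m'" if "ereal (of_int m * c) = ereal (of_int m' * c)" for m m' :: int
    using that c_pos by simp
  have on_edge_min: "n \<alpha> + m * \<alpha> \<le> n \<gamma> + m * \<gamma>"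
    if "on_edge \<alpha> \<beta> m" "\<gamma> \<in> A" for \<alpha> \<beta> m \<gamma>
    using that unfolding on_edge_def by (cases "\<gamma> \<in> {\<alpha>, \<beta>}") (auto intro: less_imp_le)
  have on_edge_min_only: "\<gamma> \<in> {\<alpha>, \<beta>}"
    if "on_edge \<alpha> \<beta> m" "\<gamma> \<in> A" "n \<alpha> + m * \<alpha> = n \<gamma> + m * \<gamma>" for \<alpha> \<beta> m \<gamma>
    using that unfolding on_edge_def by (cases "\<gamma> \<in> {\<alpha>, \<beta>}") auto
  have cover: "nonzero_roots A a = (\<Union>e\<in>ordered_pairs A. R e)"
  proof (intro equalityI subsetI)
    fix x assume x: "x \<in> nonzero_roots A a"
    then have "x \<noteq> 0" by (simp add: nonzero_roots_def)
    then obtain m :: int where m: "v x = ereal (of_int m * c)" using value_group by blast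
    from root_valuation_on_edge[OF A a generic ne x m]
    show "x \<in> (\<Union>e\<in>ordered_pairs A. R e)"
      using x m unfolding R_def on_edge_def by fastforce
  qed (auto simp: R_def)
  have disjoint: "R e \<inter> R e' = {}" if e: "e \<in> ordered_pairs A" "e' \<in> ordered_pairs A" "e \<noteq> e'" for e e'
  proof (rule ccontr)
    assume "R e \<inter> R e' \<noteq> {}"
    then obtain x m m' where x: "v x = ereal (of_int m * c)" "on_edge (fst e) (snd e) m"
        "v x = ereal (of_int m' * c)" "on_edge (fst e') (snd e') m'"
      unfolding R_def by blast
    then have "m' = m" using m_unique by simp
    obtain \<alpha> \<beta> \<alpha>' \<beta>' where ee: "e = (\<alpha>, \<beta>)" "e' = (\<alpha>', \<beta>')" by (metis surj_pair)
    have mem: "\<alpha> \<in> A" "\<beta> \<in> A" "\<alpha> < \<beta>" "\<alpha>' \<in> A" "\<beta>' \<in> A" "\<alpha>' < \<beta>'"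
      using e ee by (auto simp: ordered_pairs_def)
    have on: "on_edge \<alpha> \<beta> m" "on_edge \<alpha>' \<beta>' m" using x(2,4) ee \<open>m' = m\<close> by simp_all
    have "n \<alpha> + m * \<alpha> = n \<alpha>' + m * \<alpha>'"
      using on_edge_min[OF on(1) mem(4)] on_edge_min[OF on(2) mem(1)] by simp
    then have "\<alpha>' \<in> {\<alpha>, \<beta>}" "\<beta>' \<in> {\<alpha>, \<beta>}"
      using on_edge_min_only[OF on(1) mem(4)] on_edge_min_only[OF on(1) mem(5)] on(2)
      by (simp_all add: on_edge_def)
    then have "e = e'" using mem ee by auto
    then show False using e by simp
  qed
  have cardR: "finite (R e) \<and> int (card (R e))
      = (case e of (\<alpha>, \<beta>) \<Rightarrow> if hull_edge A n \<alpha> \<beta> \<and> \<beta> - \<alpha> dvd n \<alpha> - n \<beta> then \<beta> - \<alpha> else 0)"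
    if e: "e \<in> ordered_pairs A" for e
  proof -
    obtain \<alpha> \<beta> where ee: "e = (\<alpha>, \<beta>)" by (metis surj_pair)
    have mem: "\<alpha> \<in> A" "\<beta> \<in> A" "\<alpha> < \<beta>" using e ee by (auto simp: ordered_pairs_def)
    have on_edge_iff: "on_edge \<alpha> \<beta> m \<longleftrightarrow> n \<alpha> - n \<beta> = (\<beta> - \<alpha>) * m \<and> hull_edge A n \<alpha> \<beta>" for m
      using hull_edge_iff_line[of n \<alpha> m "n \<alpha> + m * \<alpha>" \<beta> A] mem
      unfolding on_edge_def by (auto simp: algebra_simps)
    show ?thesis
    proof (cases "hull_edge A n \<alpha> \<beta> \<and> \<beta> - \<alpha> dvd n \<alpha> - n \<beta>")
      case True
      then obtain m where m: "n \<alpha> - n \<beta> = (\<beta> - \<alpha>) * m" by (auto elim: dvdE)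
      have on: "on_edge \<alpha> \<beta> m" using on_edge_iff m True by simp
      have "on_edge \<alpha> \<beta> m' \<longleftrightarrow> m' = m" for m'
        using on_edge_iff m True mem by auto
      then have "R e = {x \<in> nonzero_roots A a. v x = ereal (of_int m * c)}"
        unfolding R_def ee by auto
      moreover have "card {x \<in> nonzero_roots A a. v x = ereal (of_int m * c)} = nat (\<beta> - \<alpha>)"
        using on unfolding on_edge_def
        by (intro card_roots_of_edge[OF A mem W[OF mem(1,2)] a, where h = "n \<alpha> + m * \<alpha>"]) auto
      ultimately show ?thesis using True mem card_ge_0_finite[of "R e"] by (simp add: ee)
    next
      case False
      then have "R e = {}" unfolding R_def ee using on_edge_iff by auto
      then show ?thesis using False by (auto simp: ee)
    qed
  qed
  have "card (nonzero_roots A a) = (\<Sum>e\<in>ordered_pairs A. card (R e))"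
    unfolding cover using finite_ordered_pairs[OF A] cardR disjoint
    by (intro card_UN_disjoint) auto
  then have "int (card (nonzero_roots A a)) = (\<Sum>e\<in>ordered_pairs A. int (card (R e)))"
    by simp
  also have "\<dots> = integral_width A n"
    unfolding integral_width_def using cardR by (intro sum.cong) auto
  finally show ?thesis .
qed

end

section \<open>The residue field\<close>

context discretely_valued_field
begin

lemma valuation_ring_ring: "ring (valuation_ring v)"
  and valuation_ring_minus: "a_inv (ring_of_type_algebra :: 'a ring) x = - x"
proof -
  interpret T: ring "ring_of_type_algebra :: 'a ring" by (rule ring_from_type_algebra)
  show minus: "a_inv (ring_of_type_algebra :: 'a ring) x = - x" for x :: 'a
    by (rule T.minus_equality) (simp_all add: ring_of_type_algebra_def)
  have "subring {x. 0 \<le> v x} (ring_of_type_algebra :: 'a ring)"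
    by (rule T.subringI)
      (simp_all add: minus, simp_all add: ring_of_type_algebra_def v_mult_ge0 v_add_ge)
  then show "ring (valuation_ring v)"
    unfolding valuation_ring_def by (rule T.subring_is_ring)
qed

lemma valuation_ring_simps [simp]:
  "carrier (valuation_ring v) = {x. 0 \<le> v x}"
  "x \<otimes>\<^bsub>valuation_ring v\<^esub> y = x * y"
  "x \<oplus>\<^bsub>valuation_ring v\<^esub> y = x + y"
  "\<one>\<^bsub>valuation_ring v\<^esub> = 1"
  "\<zero>\<^bsub>valuation_ring v\<^esub> = 0"
  by (simp_all add: valuation_ring_def ring_of_type_algebra_def)

lemma max_ideal_ideal: "ideal (max_ideal v) (valuation_ring v)"
proof (rule idealI)
  interpret ring "valuation_ring v" by (rule valuation_ring_ring)
  show "ring (valuation_ring v)" by (rule valuation_ring_ring)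
  show "subgroup (max_ideal v) (add_monoid (valuation_ring v))"
  proof (rule add.subgroupI)
    show "max_ideal v \<subseteq> carrier (valuation_ring v)" by (auto simp: max_ideal_def)
    have "0 \<in> max_ideal v" by (simp add: max_ideal_def)
    then show "max_ideal v \<noteq> {}" by blast
    fix a assume a: "a \<in> max_ideal v"
    have "a_inv (valuation_ring v) a = - a"
      using a by (intro minus_equality) (auto simp: max_ideal_def)
    then show "a_inv (valuation_ring v) a \<in> max_ideal v" using a by (simp add: max_ideal_def)
    fix b assume "b \<in> max_ideal v"
    then show "a \<oplus>\<^bsub>valuation_ring v\<^esub> b \<in> max_ideal v" using a by (simp add: max_ideal_def v_add_gt)
  qed
qed (auto simp: max_ideal_def v_mult_pos v_mult_pos')

lemma residue_hom:
  "ring_hom_ring (valuation_ring v) (residue_field v) (a_r_coset (valuation_ring v) (max_ideal v))"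
  unfolding residue_field_def by (rule ideal.rcos_ring_hom_ring[OF max_ideal_ideal])

lemma residue_eq_zero_iff:
  assumes "0 \<le> v x"
  shows "a_r_coset (valuation_ring v) (max_ideal v) x = \<zero>\<^bsub>residue_field v\<^esub> \<longleftrightarrow> 0 < v x"
proof -
  interpret ideal "max_ideal v" "valuation_ring v" by (rule max_ideal_ideal)
  have "\<zero>\<^bsub>residue_field v\<^esub> = max_ideal v" by (simp add: residue_field_def FactRing_def)
  moreover have "x \<in> max_ideal v \<longleftrightarrow> 0 < v x" by (simp add: max_ideal_def)
  ultimately show ?thesis using rcos_const_imp_mem[of x] a_rcos_const[of x] assms by auto
qed

lemma eval_valuation_ring:
  "ring.eval (valuation_ring v) xs x = poly (Poly (rev xs)) x"
proof -
  interpret ring "valuation_ring v" by (rule valuation_ring_ring)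
  have pow: "x [^]\<^bsub>valuation_ring v\<^esub> n = x ^ n" for n :: nat
    by (induction n) (simp_all add: mult.commute)
  show ?thesis
    by (induction xs) (simp_all add: Poly_append poly_monom pow add.commute)
qed

text \<open>Reducing the coefficients of \<open>f\<close> gives a monic polynomial over the residue field; a
  representative of one of its roots is the element sought.\<close>

lemma approximate_root_from_residue_field:
  assumes ac: "algebraically_closed (residue_field v)"
    and f: "\<And>i. 0 \<le> v (Polynomial.coeff f i)" "Polynomial.lead_coeff f = 1" "0 < Polynomial.degree f"
  shows "\<exists>a. 0 \<le> v a \<and> 0 < v (poly f a)"
proof -
  define \<phi> where "\<phi> = a_r_coset (valuation_ring v) (max_ideal v)"
  interpret S: algebraically_closed "residue_field v" by (rule ac)
  interpret ring_hom_ring "valuation_ring v" "residue_field v" \<phi>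
    unfolding \<phi>_def by (rule residue_hom)
  define xs where "xs = rev (coeffs f)"
  have xs: "set xs \<subseteq> carrier (valuation_ring v)"
    using f(1) by (auto simp: xs_def coeffs_def)
  have f0: "f \<noteq> 0" using f(3) by auto
  have xs_ne: "xs \<noteq> []" and len: "length xs = Suc (Polynomial.degree f)"
    using f0 by (simp_all add: xs_def length_coeffs_degree)
  have hd: "hd xs = 1"
    using f0 f(2) by (simp add: xs_def hd_rev last_coeffs_eq_coeff_degree)
  have "\<phi> 1 = \<one>\<^bsub>residue_field v\<^esub>" using hom_one by simp
  then have "hd (map \<phi> xs) \<noteq> \<zero>\<^bsub>residue_field v\<^esub>"
    using xs_ne hd S.one_not_zero by (simp add: hd_map)
  then have P: "map \<phi> xs \<in> carrier (poly_ring (residue_field v))"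
    using xs hom_closed by (auto simp: univ_poly_def polynomial_def)
  have "S.splitted (map \<phi> xs)" by (rule S.roots_over_carrier[OF P])
  then have "S.roots (map \<phi> xs) \<noteq> {#}"
    using len f(3) unfolding S.splitted_def by auto
  then obtain r where "r \<in># S.roots (map \<phi> xs)" by blast
  then have "S.is_root (map \<phi> xs) r" using S.roots_mem_iff_is_root[OF P] by simp
  then have r: "r \<in> carrier (residue_field v)" "S.eval (map \<phi> xs) r = \<zero>\<^bsub>residue_field v\<^esub>"
    by (simp_all add: S.is_root_def)
  then obtain a where a: "a \<in> carrier (valuation_ring v)" "r = \<phi> a"
    unfolding residue_field_def FactRing_def A_RCOSETS_def' \<phi>_def by auto
  have "\<phi> (poly f a) = \<zero>\<^bsub>residue_field v\<^esub>"
    using eval_hom'[OF a(1) xs] r(2) a(2) by (simp add: eval_valuation_ring xs_def)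
  then have "0 < v (poly f a)"
    using residue_eq_zero_iff[of "poly f a"] v_poly_ge0[OF f(1)] a(1) unfolding \<phi>_def by simp
  then show ?thesis using a(1) by auto
qed

lemma v_of_nat_from_residue_char:
  assumes ac: "algebraically_closed (residue_field v)"
    and char: "ring_char (residue_field v) = 0 \<or> W < int (ring_char (residue_field v))"
    and d: "0 < d" "int d \<le> W"
  shows "v (of_nat d) = 0"
proof (rule ccontr)
  define \<phi> where "\<phi> = a_r_coset (valuation_ring v) (max_ideal v)"
  interpret S: algebraically_closed "residue_field v" by (rule ac)
  interpret ring_hom_ring "valuation_ring v" "residue_field v" \<phi>
    unfolding \<phi>_def by (rule residue_hom)
  assume "v (of_nat d) \<noteq> 0"
  then have "0 < v (of_nat d)" using v_of_nat_ge0[of d] by simp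
  then have zero: "\<phi> (of_nat d) = \<zero>\<^bsub>residue_field v\<^esub>"
    unfolding \<phi>_def using residue_eq_zero_iff[OF v_of_nat_ge0] by blast
  have nat: "[n] \<cdot>\<^bsub>residue_field v\<^esub> \<one>\<^bsub>residue_field v\<^esub> = \<phi> (of_nat n)" for n :: nat
  proof (induction n)
    case 0
    show ?case using hom_zero by simp
  next
    case (Suc n)
    have "\<phi> (of_nat n + 1) = \<phi> (of_nat n) \<oplus>\<^bsub>residue_field v\<^esub> \<phi> 1"
      using hom_add[of "of_nat n" 1] v_of_nat_ge0 by simp
    moreover have "\<phi> 1 = \<one>\<^bsub>residue_field v\<^esub>" using hom_one by simp
    ultimately show ?case using Suc by (simp add: S.add.nat_pow_Suc add.commute)
  qed
  have "ring_char (residue_field v) dvd d"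
    unfolding ring_char_def by (rule Gcd_dvd) (use nat[of d] zero in simp)
  then show False using char d dvd_imp_le[of "ring_char (residue_field v)" d] by auto
qed

end

text \<open>An element of valuation \<open>c\<close> lies in the maximal ideal and is thus a multiple of \<open>p\<close>. This gives
  \<open>v p \<le> c\<close>, and \<open>c\<close> is the least positive value.\<close>

lemma discretely_valued_fieldI:
  assumes "discrete_valuation v" "uniformizer v p"
  shows "\<exists>c. discretely_valued_field v p c"
proof -
  have val: "\<And>x. v x \<noteq> -\<infinity>" "\<And>x. v x = \<infinity> \<longleftrightarrow> x = 0" "\<And>x y. v (x * y) = v x + v y"
      "\<And>x y. min (v x) (v y) \<le> v (x + y)"
    using assms(1) by (auto simp: discrete_valuation_def valuation_def)
  obtain c where c: "c > 0" "v ` (- {0}) = range (\<lambda>n::int. ereal (of_int n * c))"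
    using assms(1) by (auto simp: discrete_valuation_def)
  have group: "\<exists>m::int. v x = ereal (of_int m * c)" if "x \<noteq> 0" for x
  proof -
    have "v x \<in> v ` (- {0})" using that by simp
    then show ?thesis unfolding c(2) by blast
  qed
  have "ereal (of_int 1 * c) \<in> v ` (- {0})" unfolding c(2) by blast
  then obtain x where "ereal (of_int 1 * c) = v x" by (rule imageE)
  then have x: "v x = ereal c" by simp
  have carrier: "carrier (valuation_ring v) = {x. 0 \<le> v x}" by (simp add: valuation_ring_def)
  have max: "max_ideal v = (\<lambda>a. p * a) ` {x. 0 \<le> v x}"
    using assms(2) by (simp add: uniformizer_def carrier)
  have "x \<in> max_ideal v" using x c(1) by (simp add: max_ideal_def zero_ereal_def)
  then obtain a where a: "x = p * a" "0 \<le> v a" unfolding max by blast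
  have p0: "p \<noteq> 0" using a x val(2)[of x] by auto
  obtain m where m: "v p = ereal (of_int m * c)" using group[OF p0] by blast
  have "v 1 = v 1 + v 1" using val(3)[of 1 1] by simp
  then have "v 1 = 0" using group[of 1] by (auto simp: zero_ereal_def)
  then have "p * 1 \<in> max_ideal v" unfolding max by (intro imageI) simp
  then have "0 < of_int m * c" using m by (simp add: max_ideal_def zero_ereal_def)
  then have "1 \<le> m" using c(1) by (simp add: zero_less_mult_iff)
  moreover have "m \<le> 1"
  proof -
    have "v p + 0 \<le> v p + v a" using a(2) by (intro add_left_mono)
    then have "of_int m * c \<le> of_int 1 * c" using x a m val(3)[of p a] by simp
    then show ?thesis using c(1) by (simp add: mult_le_cancel_right)
  qed
  ultimately have "v p = ereal c" using m by simp
  then have "discretely_valued_field v p c"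
    using val c(1) group by unfold_locales auto
  then show ?thesis by blast
qed

lemma alg_closed_residue_fieldI:
  assumes "discretely_valued_field v p c" "valuation_complete v"
    and "algebraically_closed (residue_field v)"
    and "ring_char (residue_field v) = 0 \<or> W < int (ring_char (residue_field v))"
  shows "alg_closed_residue_field v p c W"
proof -
  interpret discretely_valued_field v p c by (rule assms(1))
  show ?thesis
    by unfold_locales (rule assms(2) approximate_root_from_residue_field[OF assms(3)]
        v_of_nat_from_residue_char[OF assms(3,4)]; assumption)+
qed

section \<open>Averages over cubes of lattice points\<close>

text \<open>Functions on \<open>A\<close> are made extensional so that a cube is a finite set.\<close>

definition cube :: "int set \<Rightarrow> nat \<Rightarrow> (int \<Rightarrow> int) set" where
  "cube A K = (\<Pi>\<^sub>E \<alpha>\<in>A. {0..<int K})"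

definition cube_avg :: "int set \<Rightarrow> nat \<Rightarrow> ((int \<Rightarrow> int) \<Rightarrow> real) \<Rightarrow> real" where
  "cube_avg A K f = (\<Sum>n\<in>cube A K. f n) / real K ^ card A"

lemma finite_cube: "finite A \<Longrightarrow> finite (cube A K)"
  unfolding cube_def by (intro finite_PiE) auto

lemma card_cube: "finite A \<Longrightarrow> card (cube A K) = K ^ card A"
  unfolding cube_def by (simp add: card_PiE)

lemma cube_mem: "n \<in> cube A K \<Longrightarrow> \<alpha> \<in> A \<Longrightarrow> 0 \<le> n \<alpha> \<and> n \<alpha> < int K"
  unfolding cube_def by (auto dest: PiE_mem)

lemma cube_mono: "K \<le> K' \<Longrightarrow> cube A K \<subseteq> cube A K'"
  unfolding cube_def by (intro PiE_mono) auto

lemma cube_avg_mono: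
  "(\<And>n. n \<in> cube A K \<Longrightarrow> f n \<le> g n) \<Longrightarrow> cube_avg A K f \<le> cube_avg A K g"
  unfolding cube_avg_def by (intro divide_right_mono sum_mono) auto

lemma cube_avg_nonneg: "(\<And>n. n \<in> cube A K \<Longrightarrow> 0 \<le> f n) \<Longrightarrow> 0 \<le> cube_avg A K f"
  unfolding cube_avg_def by (intro divide_nonneg_nonneg sum_nonneg) auto

lemma cube_avg_const: "finite A \<Longrightarrow> 0 < K \<Longrightarrow> cube_avg A K (\<lambda>n. x) = x"
  unfolding cube_avg_def by (simp add: card_cube)

lemma cube_avg_add: "cube_avg A K (\<lambda>n. f n + g n) = cube_avg A K f + cube_avg A K g"
  unfolding cube_avg_def by (simp add: sum.distrib add_divide_distrib)

lemma cube_avg_diff: "cube_avg A K (\<lambda>n. f n - g n) = cube_avg A K f - cube_avg A K g"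
  unfolding cube_avg_def by (simp add: sum_subtractf diff_divide_distrib)

lemma cube_avg_cmult: "cube_avg A K (\<lambda>n. x * f n) = x * cube_avg A K f"
  unfolding cube_avg_def by (simp add: sum_distrib_left)

lemma cube_avg_sum: "cube_avg A K (\<lambda>n. \<Sum>i\<in>I. f i n) = (\<Sum>i\<in>I. cube_avg A K (f i))"
  unfolding cube_avg_def by (subst sum.swap) (simp add: sum_divide_distrib)

lemma cube_avg_cong: "(\<And>n. n \<in> cube A K \<Longrightarrow> f n = g n) \<Longrightarrow> cube_avg A K f = cube_avg A K g"
  unfolding cube_avg_def by (simp cong: sum.cong)

lemma cube_avg_abs_diff:
  assumes "\<And>n. n \<in> cube A K \<Longrightarrow> \<bar>f n - g n\<bar> \<le> h n"
  shows "\<bar>cube_avg A K f - cube_avg A K g\<bar> \<le> cube_avg A K h"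
proof -
  have "f n - g n \<le> h n" "- h n \<le> f n - g n" if "n \<in> cube A K" for n
    using assms[OF that] by (simp_all add: abs_le_iff)
  then have "cube_avg A K (\<lambda>n. f n - g n) \<le> cube_avg A K h"
      "cube_avg A K (\<lambda>n. -1 * h n) \<le> cube_avg A K (\<lambda>n. f n - g n)"
    by (auto intro!: cube_avg_mono)
  then show ?thesis unfolding cube_avg_cmult cube_avg_diff by (simp add: abs_le_iff)
qed

lemma cube_avg_of_bool:
  "finite A \<Longrightarrow> cube_avg A K (\<lambda>n. of_bool (P n)) = real (card {n \<in> cube A K. P n}) / real K ^ card A"
  unfolding cube_avg_def of_bool_def by (simp add: finite_cube sum.If_cases Int_def)

definition block :: "int set \<Rightarrow> nat \<Rightarrow> (int \<Rightarrow> int) \<Rightarrow> (int \<Rightarrow> int) \<Rightarrow> int \<Rightarrow> int" where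
  "block A L m r = (\<lambda>\<alpha>\<in>A. int L * m \<alpha> + r \<alpha>)"

text \<open>Division with remainder of every coordinate by \<open>L\<close>.\<close>

lemma cube_avg_blocks:
  assumes A: "finite A" and L: "0 < L"
  shows "cube_avg A (L * K) f = cube_avg A K (\<lambda>m. cube_avg A L (\<lambda>r. f (block A L m r)))"
proof -
  have "(\<Sum>n\<in>cube A (L * K). f n) = (\<Sum>(m, r)\<in>cube A K \<times> cube A L. f (block A L m r))"
  proof (rule sum.reindex_bij_witness[where
        i = "\<lambda>(m, r). block A L m r" and
        j = "\<lambda>n. (\<lambda>\<alpha>\<in>A. n \<alpha> div int L, \<lambda>\<alpha>\<in>A. n \<alpha> mod int L)"], goal_cases)
    case (1 n)
    then show ?case by (auto simp: block_def cube_def PiE_def extensional_def fun_eq_iff)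
  next
    case (2 n)
    have "n \<alpha> div int L < int K" if "\<alpha> \<in> A" for \<alpha>
    proof (rule ccontr)
      assume "\<not> n \<alpha> div int L < int K"
      then have "int L * int K \<le> int L * (n \<alpha> div int L)" by (intro mult_left_mono) auto
      moreover have "int L * (n \<alpha> div int L) + n \<alpha> mod int L = n \<alpha>" by simp
      moreover have "0 \<le> n \<alpha> mod int L" using L by simp
      ultimately show False using cube_mem[OF 2 that] unfolding of_nat_mult by linarith
    qed
    moreover have "0 \<le> n \<alpha> div int L" if "\<alpha> \<in> A" for \<alpha>
      using cube_mem[OF 2 that] L by (simp add: pos_imp_zdiv_nonneg_iff)
    ultimately show ?case using L by (auto simp: cube_def)
  next
    case (3 mr)
    then obtain m r where mr: "mr = (m, r)" "m \<in> cube A K" "r \<in> cube A L" by auto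
    have "(int L * m \<alpha> + r \<alpha>) div int L = m \<alpha>" "(int L * m \<alpha> + r \<alpha>) mod int L = r \<alpha>"
      if "\<alpha> \<in> A" for \<alpha>
      using cube_mem[OF mr(3) that] L by simp_all
    then show ?case using mr by (auto simp: block_def cube_def PiE_def extensional_def fun_eq_iff)
  next
    case (4 mr)
    then obtain m r where mr: "mr = (m, r)" "m \<in> cube A K" "r \<in> cube A L" by auto
    have "int L * m \<alpha> + r \<alpha> < int (L * K) \<and> 0 \<le> int L * m \<alpha> + r \<alpha>" if "\<alpha> \<in> A" for \<alpha>
    proof -
      have "int L * (m \<alpha> + 1) \<le> int L * int K"
        using cube_mem[OF mr(2) that] L by (intro mult_left_mono) auto
      then show ?thesis
        using cube_mem[OF mr(2) that] cube_mem[OF mr(3) that] by (simp add: algebra_simps)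
    qed
    then show ?case using mr by (simp add: block_def cube_def)
  next
    case (5 n)
    have "block A L (\<lambda>\<alpha>\<in>A. n \<alpha> div int L) (\<lambda>\<alpha>\<in>A. n \<alpha> mod int L) = n"
      using 5 by (auto simp: block_def cube_def PiE_def extensional_def fun_eq_iff)
    then show ?case by simp
  qed
  then show ?thesis
    by (simp add: cube_avg_def sum.cartesian_product sum_divide_distrib[symmetric] power_mult_distrib
        mult.commute)
qed

text \<open>Once the other coordinates are fixed, the value of \<open>h\<close> determines the coordinate at \<open>\<gamma>\<close>, which
  leaves at most \<open>card T\<close> possibilities for it. Degenerate configurations are rare for this reason.\<close>

lemma card_cube_determined_le:
  assumes A: "finite A" "\<gamma> \<in> A" and T: "finite T" "\<And>n. n \<in> cube A K \<Longrightarrow> P n \<Longrightarrow> h n \<in> T"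
    and det: "\<And>n n'. \<lbrakk>\<And>\<alpha>. \<alpha> \<in> A - {\<gamma>} \<Longrightarrow> n \<alpha> = n' \<alpha>; h n = h n'\<rbrakk> \<Longrightarrow> n \<gamma> = n' \<gamma>"
  shows "card {n \<in> cube A K. P n} \<le> K ^ (card A - 1) * card T"
proof -
  \<comment> \<open>The other coordinates together with \<open>h\<close> determine the whole point.\<close>
  let ?g = "\<lambda>n. (restrict n (A - {\<gamma>}), h n)"
  have "inj_on ?g {n \<in> cube A K. P n}"
  proof (rule inj_onI)
    fix n n' assume n: "n \<in> {n \<in> cube A K. P n}" "n' \<in> {n \<in> cube A K. P n}" "?g n = ?g n'"
    have r: "restrict n (A - {\<gamma>}) = restrict n' (A - {\<gamma>})" using n(3) by simp
    have eq: "n \<alpha> = n' \<alpha>" if "\<alpha> \<in> A - {\<gamma>}" for \<alpha>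
      using fun_cong[OF r, of \<alpha>] that by simp
    then have "n \<gamma> = n' \<gamma>" using det[of n n'] n(3) by simp
    then show "n = n'" using n(1,2) eq
      by (intro PiE_ext[of n A "\<lambda>_. {0..<int K}" n']) (auto simp: cube_def)
  qed
  moreover have "?g ` {n \<in> cube A K. P n} \<subseteq> cube (A - {\<gamma>}) K \<times> T"
    using T(2) by (auto simp: cube_def PiE_def Pi_def)
  ultimately have "card {n \<in> cube A K. P n} \<le> card (cube (A - {\<gamma>}) K \<times> T)"
    using A T(1) finite_cube[of "A - {\<gamma>}" K] by (intro card_inj_on_le[of ?g]) auto
  then show ?thesis using A by (simp add: card_cartesian_product card_cube)
qed

lemma cube_avg_determined_le:
  assumes "finite A" "\<gamma> \<in> A" "finite T" "\<And>n. n \<in> cube A K \<Longrightarrow> P n \<Longrightarrow> h n \<in> T"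
    and "\<And>n n'. \<lbrakk>\<And>\<alpha>. \<alpha> \<in> A - {\<gamma>} \<Longrightarrow> n \<alpha> = n' \<alpha>; h n = h n'\<rbrakk> \<Longrightarrow> n \<gamma> = n' \<gamma>"
    and "0 < K"
  shows "cube_avg A K (\<lambda>n. of_bool (P n)) \<le> real (card T) / real K"
proof -
  obtain t where t: "card A = Suc t" using assms(1,2) by (metis card_Suc_Diff1)
  have "card {n \<in> cube A K. P n} \<le> K ^ (card A - 1) * card T"
    by (rule card_cube_determined_le[OF assms(1-3), where h = h])
      (rule assms(4), assumption+, rule assms(5), assumption+)
  then have "real (card {n \<in> cube A K. P n}) \<le> real (K ^ t * card T)"
    using t by (simp only: of_nat_le_iff diff_Suc_1)
  then have "real (card {n \<in> cube A K. P n}) / real K ^ Suc t \<le> real (K ^ t * card T) / real K ^ Suc t"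
    by (rule divide_right_mono) simp
  also have "\<dots> = real (card T) / real K" using assms(6) by (simp add: field_simps)
  finally show ?thesis using assms(1) t by (simp add: cube_avg_of_bool)
qed

text \<open>The excess is an affine function of the height over \<open>\<gamma>\<close> with nonzero slope, hence injective in
  that height.\<close>

lemma cube_avg_nearly_collinear_le:
  assumes A: "finite A" and K: "0 < K"
  shows "cube_avg A K (\<lambda>n. of_bool (nearly_collinear A B n))
    \<le> real (card A) ^ 3 * real (card {-B..B}) / real K"
proof -
  define P where "P = (\<lambda>(\<alpha>, \<beta>, \<gamma>) n. \<alpha> \<noteq> \<beta> \<and> \<gamma> \<noteq> \<alpha> \<and> \<gamma> \<noteq> \<beta> \<and> \<bar>excess \<alpha> \<beta> \<gamma> n\<bar> \<le> B)"
  have "cube_avg A K (\<lambda>n. of_bool (nearly_collinear A B n))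
      \<le> cube_avg A K (\<lambda>n. \<Sum>t\<in>A \<times> A \<times> A. of_bool (P t n))"
  proof (rule cube_avg_mono)
    fix n
    show "of_bool (nearly_collinear A B n) \<le> (\<Sum>t\<in>A \<times> A \<times> A. of_bool (P t n) :: real)"
    proof (cases "nearly_collinear A B n")
      case True
      then obtain \<alpha> \<beta> \<gamma> where t: "(\<alpha>, \<beta>, \<gamma>) \<in> A \<times> A \<times> A" "P (\<alpha>, \<beta>, \<gamma>) n"
        unfolding nearly_collinear_def P_def by auto
      have "of_bool (P (\<alpha>, \<beta>, \<gamma>) n) \<le> (\<Sum>t\<in>A \<times> A \<times> A. of_bool (P t n) :: real)"
        using t A by (intro member_le_sum) auto
      then show ?thesis using t True by simp
    qed (auto intro: sum_nonneg)
  qed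
  also have "\<dots> = (\<Sum>t\<in>A \<times> A \<times> A. cube_avg A K (\<lambda>n. of_bool (P t n)))"
    by (rule cube_avg_sum)
  also have "\<dots> \<le> (\<Sum>t\<in>A \<times> A \<times> A. real (card {-B..B}) / real K)"
  proof (rule sum_mono)
    fix t assume "t \<in> A \<times> A \<times> A"
    then obtain \<alpha> \<beta> \<gamma> where t: "t = (\<alpha>, \<beta>, \<gamma>)" "\<alpha> \<in> A" "\<beta> \<in> A" "\<gamma> \<in> A" by auto
    show "cube_avg A K (\<lambda>n. of_bool (P t n)) \<le> real (card {-B..B}) / real K"
    proof (cases "\<alpha> \<noteq> \<beta> \<and> \<gamma> \<noteq> \<alpha> \<and> \<gamma> \<noteq> \<beta>")
      case True
      show ?thesis
      proof (rule cube_avg_determined_le[OF A t(4) _ _ _ K, where h = "excess \<alpha> \<beta> \<gamma>"])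
        show "excess \<alpha> \<beta> \<gamma> n \<in> {-B..B}" if "P t n" for n
          using that by (auto simp: P_def t(1))
        fix n n' :: "int \<Rightarrow> int"
        assume eq: "\<And>\<alpha>. \<alpha> \<in> A - {\<gamma>} \<Longrightarrow> n \<alpha> = n' \<alpha>" "excess \<alpha> \<beta> \<gamma> n = excess \<alpha> \<beta> \<gamma> n'"
        have "n \<alpha> = n' \<alpha>" "n \<beta> = n' \<beta>" using eq(1) t True by auto
        then show "n \<gamma> = n' \<gamma>" using eq(2) True by (simp add: excess_def)
      qed simp
    next
      case False
      then have "P t n = False" for n by (auto simp: P_def t(1))
      then show ?thesis by (simp add: cube_avg_def)
    qed
  qed
  also have "\<dots> = real (card A) ^ 3 * real (card {-B..B}) / real K"
    by (simp add: card_cartesian_product power3_eq_cube)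
  finally show ?thesis .
qed

section \<open>Limiting frequencies of hull edges\<close>

text \<open>A bound for the excess of heights between \<open>0\<close> and \<open>1\<close>. If the excesses of \<open>m\<close> exceed it in
  absolute value, then adding to \<open>L * m\<close> a vector with entries below \<open>L\<close> cannot change their signs.\<close>

definition collinearity_bound :: "int set \<Rightarrow> int" where
  "collinearity_bound A = 3 * (Max A - Min A)\<^sup>2"

lemma abs_diff_le_width:
  fixes A :: "int set"
  shows "finite A \<Longrightarrow> \<alpha> \<in> A \<Longrightarrow> \<beta> \<in> A \<Longrightarrow> \<bar>\<alpha> - \<beta>\<bar> \<le> Max A - Min A"
  using Max_ge[of A \<alpha>] Max_ge[of A \<beta>] Min_le[of A \<alpha>] Min_le[of A \<beta>] by linarith

lemma abs_excess_le:
  assumes A: "finite A" "\<alpha> \<in> A" "\<beta> \<in> A" "\<gamma> \<in> A"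
    and r: "\<And>\<delta>. \<delta> \<in> A \<Longrightarrow> \<bar>r \<delta>\<bar> \<le> L"
  shows "\<bar>excess \<alpha> \<beta> \<gamma> r\<bar> \<le> collinearity_bound A * L"
proof -
  let ?D = "Max A - Min A"
  have D: "\<bar>x - y\<bar> \<le> ?D" if "x \<in> A" "y \<in> A" for x y using abs_diff_le_width[OF A(1) that] .
  have D0: "0 \<le> ?D" using D[OF A(2,2)] by simp
  have term_le: "\<bar>(x - y) * r \<delta>\<bar> \<le> ?D * L" if "x \<in> A" "y \<in> A" "\<delta> \<in> A" for x y \<delta>
    unfolding abs_mult using D r that D0 by (intro mult_mono) auto
  have "\<bar>(\<beta> - \<alpha>) * r \<gamma> - (\<beta> - \<gamma>) * r \<alpha> - (\<gamma> - \<alpha>) * r \<beta>\<bar> \<le> 3 * (?D * L)"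
    using term_le[of \<beta> \<alpha> \<gamma>] term_le[of \<beta> \<gamma> \<alpha>] term_le[of \<gamma> \<alpha> \<beta>] A by linarith
  then have "\<bar>excess \<alpha> \<beta> \<gamma> r\<bar> \<le> ?D * (3 * (?D * L))"
    unfolding excess_def abs_mult using D[OF A(3,2)] D0 by (intro mult_mono) auto
  then show ?thesis by (simp add: collinearity_bound_def power2_eq_square algebra_simps)
qed

lemma excess_block:
  assumes "\<alpha> \<in> A" "\<beta> \<in> A" "\<gamma> \<in> A"
  shows "excess \<alpha> \<beta> \<gamma> (block A L m r) = int L * excess \<alpha> \<beta> \<gamma> m + excess \<alpha> \<beta> \<gamma> r"
  using assms by (simp add: excess_def block_def algebra_simps)

text \<open>Inside a block the excess varies by at most \<open>collinearity_bound A * L\<close>, while its leading part is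
  \<open>L\<close> times an integer of larger absolute value.\<close>

lemma hull_edge_block:
  assumes A: "finite A" and L: "0 < L" and r: "r \<in> cube A L"
    and m: "\<not> nearly_collinear A (collinearity_bound A) m"
  shows "hull_edge A (block A L m r) \<alpha> \<beta> \<longleftrightarrow> hull_edge A m \<alpha> \<beta>"
proof -
  let ?B = "collinearity_bound A"
  have "0 < excess \<alpha> \<beta> \<gamma> (block A L m r) \<longleftrightarrow> 0 < excess \<alpha> \<beta> \<gamma> m"
    if mem: "\<alpha> \<in> A" "\<beta> \<in> A" "\<alpha> \<noteq> \<beta>" "\<gamma> \<in> A - {\<alpha>, \<beta>}" for \<gamma>
  proof -
    have e: "excess \<alpha> \<beta> \<gamma> (block A L m r) = int L * excess \<alpha> \<beta> \<gamma> m + excess \<alpha> \<beta> \<gamma> r"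
      using mem by (intro excess_block) auto
    have r_le: "\<bar>excess \<alpha> \<beta> \<gamma> r\<bar> \<le> ?B * int L"
    proof (rule abs_excess_le)
      show "\<bar>r \<delta>\<bar> \<le> int L" if "\<delta> \<in> A" for \<delta> using cube_mem[OF r that] by simp
    qed (use A mem in auto)
    have "?B < \<bar>excess \<alpha> \<beta> \<gamma> m\<bar>" using m mem unfolding nearly_collinear_def by fastforce
    then consider "?B + 1 \<le> excess \<alpha> \<beta> \<gamma> m" | "?B + 1 \<le> - excess \<alpha> \<beta> \<gamma> m" by linarith
    then show ?thesis
    proof cases
      case 1
      have "int L * (?B + 1) \<le> int L * excess \<alpha> \<beta> \<gamma> m" using 1 by (intro mult_left_mono) auto
      then have "0 < excess \<alpha> \<beta> \<gamma> (block A L m r)" using e r_le L by (simp add: algebra_simps)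
      moreover have "0 \<le> ?B" by (simp add: collinearity_bound_def)
      ultimately show ?thesis using 1 by simp
    next
      case 2
      have "int L * (?B + 1) \<le> int L * (- excess \<alpha> \<beta> \<gamma> m)" using 2 by (intro mult_left_mono) auto
      then have "excess \<alpha> \<beta> \<gamma> (block A L m r) < 0" using e r_le L by (simp add: algebra_simps)
      moreover have "0 \<le> ?B" by (simp add: collinearity_bound_def)
      ultimately show ?thesis using 2 by simp
    qed
  qed
  then show ?thesis unfolding hull_edge_def by auto
qed

lemma cube_avg_blocks_abs_diff_le:
  assumes A: "finite A" and L: "0 < L"
    and F: "\<And>m. m \<in> cube A K \<Longrightarrow> \<bar>cube_avg A L (\<lambda>r. F (block A L m r)) - G m\<bar> \<le> x * of_bool (bad m)"
  shows "\<bar>cube_avg A (L * K) F - cube_avg A K G\<bar> \<le> x * cube_avg A K (\<lambda>m. of_bool (bad m))"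
  unfolding cube_avg_blocks[OF A L] cube_avg_cmult[symmetric]
  by (rule cube_avg_abs_diff) (rule F)

text \<open>Both \<open>q K\<close> and \<open>q L\<close> are close to \<open>q (K * L)\<close>, hence to each other. In this way the limit is
  obtained without a continuous model of the random heights.\<close>

lemma convergent_of_almost_scale_invariant:
  fixes q :: "nat \<Rightarrow> real"
  assumes q: "\<And>L K. 0 < L \<Longrightarrow> 0 < K \<Longrightarrow> \<bar>q (L * K) - q K\<bar> \<le> C / real K"
  shows "convergent q"
proof -
  have C: "0 \<le> C" using q[of 1 1] by simp
  have close: "\<bar>q K - q L\<bar> \<le> C / real K + C / real L" if "0 < K" "0 < L" for K L
    using q[of L K] q[of K L] that by (simp add: mult.commute)
  have "Cauchy q"
  proof (rule metric_CauchyI)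
    fix e :: real assume e: "0 < e"
    obtain N where N: "2 * C / e < real N" using reals_Archimedean2 by blast
    have "dist (q m) (q n) < e" if mn: "Suc N \<le> m" "Suc N \<le> n" for m n
    proof -
      have small: "C / real k < e / 2" if "Suc N \<le> k" for k
      proof -
        have "2 * C / e < real k" using N that by linarith
        then show ?thesis using e that by (simp add: field_simps)
      qed
      have "\<bar>q m - q n\<bar> \<le> C / real m + C / real n" using close[of m n] mn by simp
      then show ?thesis using small[OF mn(1)] small[OF mn(2)] unfolding dist_real_def by linarith
    qed
    then show "\<exists>M. \<forall>m\<ge>M. \<forall>n\<ge>M. dist (q m) (q n) < e" by blast
  qed
  then show ?thesis by (simp add: Cauchy_convergent)
qed

lemma convergent_hull_edge_frequency:
  assumes A: "finite A"
  shows "convergent (\<lambda>K. cube_avg A K (\<lambda>n. of_bool (hull_edge A n \<alpha> \<beta>)))"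
proof (rule convergent_of_almost_scale_invariant)
  let ?B = "collinearity_bound A"
  fix L K :: nat assume LK: "0 < L" "0 < K"
  have "\<bar>cube_avg A (L * K) (\<lambda>n. of_bool (hull_edge A n \<alpha> \<beta>))
      - cube_avg A K (\<lambda>n. of_bool (hull_edge A n \<alpha> \<beta>))\<bar>
      \<le> 1 * cube_avg A K (\<lambda>m. of_bool (nearly_collinear A ?B m))"
  proof (rule cube_avg_blocks_abs_diff_le[OF A LK(1)])
    fix m assume "m \<in> cube A K"
    let ?e = "\<lambda>n. of_bool (hull_edge A n \<alpha> \<beta>) :: real"
    have "\<bar>cube_avg A L (\<lambda>r. ?e (block A L m r)) - cube_avg A L (\<lambda>r. ?e m)\<bar>
        \<le> cube_avg A L (\<lambda>r. 1 * of_bool (nearly_collinear A ?B m))"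
      by (rule cube_avg_abs_diff) (auto simp: hull_edge_block[OF A LK(1)])
    then show "\<bar>cube_avg A L (\<lambda>r. ?e (block A L m r)) - ?e m\<bar>
        \<le> 1 * of_bool (nearly_collinear A ?B m)"
      by (simp add: cube_avg_const[OF A LK(1)])
  qed
  also have "\<dots> \<le> real (card A) ^ 3 * real (card {-?B..?B}) / real K"
    using cube_avg_nearly_collinear_le[OF A LK(2)] by simp
  finally show "\<bar>cube_avg A (L * K) (\<lambda>n. of_bool (hull_edge A n \<alpha> \<beta>))
      - cube_avg A K (\<lambda>n. of_bool (hull_edge A n \<alpha> \<beta>))\<bar>
      \<le> real (card A) ^ 3 * real (card {-?B..?B}) / real K" .
qed

lemma card_cube_equal_coordinates:
  assumes A: "finite A" "\<alpha> \<in> A" "\<beta> \<in> A" "\<alpha> \<noteq> \<beta>"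
  shows "card {r \<in> cube A d. r \<alpha> = r \<beta>} = d ^ (card A - 1)"
proof -
  have "bij_betw (\<lambda>r. restrict r (A - {\<beta>})) {r \<in> cube A d. r \<alpha> = r \<beta>} (cube (A - {\<beta>}) d)"
    by (rule bij_betw_byWitness[where f' = "\<lambda>r. r(\<beta> := r \<alpha>)"])
      (use A in \<open>auto simp: cube_def PiE_def Pi_def extensional_def fun_eq_iff\<close>)
  then have "card {r \<in> cube A d. r \<alpha> = r \<beta>} = card (cube (A - {\<beta>}) d)" by (rule bij_betw_same_card)
  then show ?thesis using A by (simp add: card_cube)
qed

text \<open>The differences of block origins are multiples of \<open>d\<close>, so the slope is integral precisely where the
  two offsets within the block agree. This is one place out of \<open>d\<close> and cancels the weight \<open>d\<close>.\<close>

lemma integral_edge_frequency_multiple: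
  assumes A: "finite A" "\<alpha> \<in> A" "\<beta> \<in> A" and d: "0 < d" "int d = \<beta> - \<alpha>" and K: "0 < K"
  defines "B \<equiv> collinearity_bound A"
  shows "\<bar>cube_avg A (d * K) (\<lambda>n. real d * of_bool (hull_edge A n \<alpha> \<beta> \<and> \<beta> - \<alpha> dvd n \<alpha> - n \<beta>))
      - cube_avg A K (\<lambda>n. of_bool (hull_edge A n \<alpha> \<beta>))\<bar>
    \<le> real d * (real (card A) ^ 3 * real (card {-B..B}) / real K)"
proof -
  let ?f = "\<lambda>n. real d * of_bool (hull_edge A n \<alpha> \<beta> \<and> \<beta> - \<alpha> dvd n \<alpha> - n \<beta>)"
  have ne: "\<alpha> \<noteq> \<beta>" using d by auto
  have dvd_block: "\<beta> - \<alpha> dvd block A d m r \<alpha> - block A d m r \<beta> \<longleftrightarrow> r \<alpha> = r \<beta>" if r: "r \<in> cube A d" for m r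
  proof -
    have "block A d m r \<alpha> - block A d m r \<beta> = int d * (m \<alpha> - m \<beta>) + (r \<alpha> - r \<beta>)"
      using A by (simp add: block_def algebra_simps)
    then have "\<beta> - \<alpha> dvd block A d m r \<alpha> - block A d m r \<beta> \<longleftrightarrow> int d dvd r \<alpha> - r \<beta>"
      using d(2) by (simp add: dvd_add_right_iff)
    also have "\<dots> \<longleftrightarrow> r \<alpha> = r \<beta>"
      using cube_mem[OF r A(2)] cube_mem[OF r A(3)] zdvd_imp_le[of "int d" "r \<alpha> - r \<beta>"]
        zdvd_imp_le[of "int d" "r \<beta> - r \<alpha>"] dvd_diff_commute[of "int d" "r \<alpha>" "r \<beta>"]
      by (cases "r \<alpha>" "r \<beta>" rule: linorder_cases) auto
    finally show ?thesis .
  qed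
  \<comment> \<open>The two offsets agree with probability \<open>1 / d\<close>.\<close>
  have uniform: "cube_avg A d (\<lambda>r. real d * of_bool (r \<alpha> = r \<beta>)) = 1"
  proof -
    obtain t where "card A = Suc t" using A(1,2) by (metis card_Suc_Diff1)
    then show ?thesis
      using d(1) card_cube_equal_coordinates[OF A ne, of d]
      by (simp add: cube_avg_cmult cube_avg_of_bool[OF A(1)])
  qed
  have "\<bar>cube_avg A (d * K) ?f - cube_avg A K (\<lambda>n. of_bool (hull_edge A n \<alpha> \<beta>))\<bar>
      \<le> real d * cube_avg A K (\<lambda>m. of_bool (nearly_collinear A B m))"
  proof (rule cube_avg_blocks_abs_diff_le[OF A(1) d(1)])
    fix m assume "m \<in> cube A K"
    show "\<bar>cube_avg A d (\<lambda>r. ?f (block A d m r)) - of_bool (hull_edge A m \<alpha> \<beta>)\<bar>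
        \<le> real d * of_bool (nearly_collinear A B m)"
    proof (cases "nearly_collinear A B m")
      case False
      have "cube_avg A d (\<lambda>r. ?f (block A d m r))
          = cube_avg A d (\<lambda>r. of_bool (hull_edge A m \<alpha> \<beta>) * (real d * of_bool (r \<alpha> = r \<beta>)))"
        by (rule cube_avg_cong)
          (use False dvd_block hull_edge_block[OF A(1) d(1)] in \<open>simp add: B_def\<close>)
      also have "\<dots> = of_bool (hull_edge A m \<alpha> \<beta>)"
        unfolding cube_avg_cmult using uniform by (simp add: cube_avg_cmult)
      finally show ?thesis by simp
    next
      case True
      have "cube_avg A d (\<lambda>r. ?f (block A d m r)) \<le> cube_avg A d (\<lambda>r. real d)"
        by (rule cube_avg_mono) simp
      then have "cube_avg A d (\<lambda>r. ?f (block A d m r)) \<le> real d"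
        using cube_avg_const[OF A(1) d(1)] by simp
      moreover have "0 \<le> cube_avg A d (\<lambda>r. ?f (block A d m r))"
        by (rule cube_avg_nonneg) simp
      ultimately show ?thesis using True d(1) by (auto simp: abs_le_iff)
    qed
  qed
  also have "\<dots> \<le> real d * (real (card A) ^ 3 * real (card {-B..B}) / real K)"
    using cube_avg_nearly_collinear_le[OF A(1) K] by (intro mult_left_mono) auto
  finally show ?thesis .
qed

lemma filterlim_div_const_at_top:
  assumes "0 < d"
  shows "filterlim (\<lambda>K::nat. K div d) at_top at_top"
  unfolding filterlim_at_top
proof
  fix Z
  have "Z \<le> K div d" if "Z * d \<le> K" for K
    using div_le_mono[OF that, of d] assms by simp
  then show "eventually (\<lambda>K. Z \<le> K div d) at_top"
    unfolding eventually_at_top_linorder by blast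
qed

text \<open>A cube of arbitrary side is compared with the largest subcube whose side is a multiple of \<open>\<beta> - \<alpha>\<close>;
  the proportion \<open>\<rho>\<close> of points in the subcube tends to one.\<close>

lemma integral_edge_frequency_tendsto:
  assumes A: "finite A" "\<alpha> \<in> A" "\<beta> \<in> A" "\<alpha> < \<beta>"
    and q: "(\<lambda>K. cube_avg A K (\<lambda>n. of_bool (hull_edge A n \<alpha> \<beta>))) \<longlonglongrightarrow> q"
  shows "(\<lambda>K. cube_avg A K (\<lambda>n. if hull_edge A n \<alpha> \<beta> \<and> \<beta> - \<alpha> dvd n \<alpha> - n \<beta> then of_int (\<beta> - \<alpha>) else 0))
    \<longlonglongrightarrow> q"
proof -
  define d where "d = nat (\<beta> - \<alpha>)"
  have d: "0 < d" "int d = \<beta> - \<alpha>" using A(4) by (simp_all add: d_def)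
  define f where "f n = real d * of_bool (hull_edge A n \<alpha> \<beta> \<and> \<beta> - \<alpha> dvd n \<alpha> - n \<beta>)" for n
  define t where "t = card A"
  define C where "C = real d * (real (card A) ^ 3 * real (card {-collinearity_bound A..collinearity_bound A}))"
  have f_eq: "f = (\<lambda>n. real d * of_bool (hull_edge A n \<alpha> \<beta> \<and> \<beta> - \<alpha> dvd n \<alpha> - n \<beta>))"
    by (simp add: f_def fun_eq_iff)
  have f_bounds: "0 \<le> f n" "f n \<le> real d" for n by (auto simp: f_def)
  have div_lim: "filterlim (\<lambda>K. K div d) at_top at_top" by (rule filterlim_div_const_at_top[OF d(1)])
  have multiple: "(\<lambda>K. cube_avg A (d * K) f) \<longlonglongrightarrow> q"
  proof -
    have "(\<lambda>K. cube_avg A (d * K) f - cube_avg A K (\<lambda>n. of_bool (hull_edge A n \<alpha> \<beta>))) \<longlonglongrightarrow> 0"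
    proof (rule Lim_null_comparison)
      show "\<forall>\<^sub>F K in sequentially.
          norm (cube_avg A (d * K) f - cube_avg A K (\<lambda>n. of_bool (hull_edge A n \<alpha> \<beta>))) \<le> C / real K"
        using eventually_gt_at_top[of 0]
        by eventually_elim
          (use integral_edge_frequency_multiple[OF A(1-3) d] in \<open>simp add: f_eq C_def\<close>)
      show "(\<lambda>K. C / real K) \<longlonglongrightarrow> 0" by (rule lim_const_over_n)
    qed
    from tendsto_add[OF this q] show ?thesis by simp
  qed
  define \<rho> where "\<rho> K = (real (d * (K div d)) / real K) ^ t" for K
  have \<rho>: "\<rho> \<longlonglongrightarrow> 1"
  proof -
    have "(\<lambda>K. real (d * (K div d)) / real K) \<longlonglongrightarrow> 1"
    proof -
      have "(\<lambda>K. real (K mod d) / real K) \<longlonglongrightarrow> 0"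
      proof (rule Lim_null_comparison)
        show "\<forall>\<^sub>F K in sequentially. norm (real (K mod d) / real K) \<le> real d / real K"
          using d(1) by (intro always_eventually) (auto intro!: divide_right_mono simp: less_imp_le)
        show "(\<lambda>K. real d / real K) \<longlonglongrightarrow> 0" by (rule lim_const_over_n)
      qed
      then have "(\<lambda>K. 1 - real (K mod d) / real K) \<longlonglongrightarrow> 1 - 0" by (intro tendsto_intros)
      moreover have "\<forall>\<^sub>F K in sequentially. 1 - real (K mod d) / real K = real (d * (K div d)) / real K"
        using eventually_gt_at_top[of 0]
      proof eventually_elim
        case (elim K)
        have "real K = real (d * (K div d)) + real (K mod d)"
          by (simp only: of_nat_add[symmetric] mult_div_mod_eq)
        then show ?case using elim by (simp add: field_simps)
      qed
      ultimately show ?thesis using Lim_transform_eventually by fastforce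
    qed
    from tendsto_power[OF this, of t] have "(\<lambda>K. \<rho> K) \<longlonglongrightarrow> 1"
      unfolding \<rho>_def power_one .
    then show ?thesis .
  qed
  \<comment> \<open>The summand lies between \<open>0\<close> and \<open>d\<close>, so the points outside the subcube contribute at most
    \<open>d * (1 - \<rho> K)\<close> to the average.\<close>
  have sandwich: "cube_avg A (d * (K div d)) f * \<rho> K \<le> cube_avg A K f \<and>
      cube_avg A K f \<le> cube_avg A (d * (K div d)) f * \<rho> K + real d * (1 - \<rho> K)"
    if "d \<le> K" for K
  proof -
    define K' where "K' = d * (K div d)"
    have K': "0 < K'" "K' \<le> K" using that d(1) by (simp_all add: K'_def div_greater_zero_iff)
    have sub: "cube A K' \<subseteq> cube A K" using K' by (intro cube_mono)
    have split: "(\<Sum>n\<in>cube A K. f n) = (\<Sum>n\<in>cube A K - cube A K'. f n) + (\<Sum>n\<in>cube A K'. f n)"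
      using sub finite_cube[OF A(1)] by (rule sum.subset_diff)
    have "(\<Sum>n\<in>cube A K - cube A K'. f n) \<le> real (card (cube A K - cube A K')) * real d"
      using f_bounds by (intro sum_bounded_above) auto
    moreover have "real (card (cube A K - cube A K')) = real K ^ t - real K' ^ t"
      using sub finite_cube[OF A(1)] K'
      by (simp add: card_Diff_subset card_cube[OF A(1)] t_def of_nat_diff power_mono)
    moreover have "0 \<le> (\<Sum>n\<in>cube A K - cube A K'. f n)" using f_bounds by (intro sum_nonneg) auto
    moreover have "(\<Sum>n\<in>cube A K'. f n) = cube_avg A K' f * real K' ^ t"
      using K' by (simp add: cube_avg_def t_def)
    ultimately have
      "cube_avg A K' f * real K' ^ t / real K ^ t \<le> (\<Sum>n\<in>cube A K. f n) / real K ^ t"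
      "(\<Sum>n\<in>cube A K. f n) / real K ^ t
        \<le> (cube_avg A K' f * real K' ^ t + (real K ^ t - real K' ^ t) * real d) / real K ^ t"
      using split by (intro divide_right_mono; simp)+
    moreover have \<rho>_K: "\<rho> K = real K' ^ t / real K ^ t" by (simp add: \<rho>_def K'_def power_divide)
    moreover have "(cube_avg A K' f * real K' ^ t + (real K ^ t - real K' ^ t) * real d) / real K ^ t
        = cube_avg A K' f * \<rho> K + real d * (1 - \<rho> K)"
    proof -
      have "real K ^ t \<noteq> 0" using K' by simp
      then show ?thesis by (simp add: \<rho>_K add_divide_distrib diff_divide_distrib algebra_simps)
    qed
    ultimately show ?thesis
      unfolding K'_def[symmetric] cube_avg_def[of A K] t_def[symmetric] by simp
  qed
  have lower: "(\<lambda>K. cube_avg A (d * (K div d)) f * \<rho> K) \<longlonglongrightarrow> q * 1"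
    by (intro tendsto_mult \<rho> filterlim_compose[OF multiple div_lim])
  have upper: "(\<lambda>K. cube_avg A (d * (K div d)) f * \<rho> K + real d * (1 - \<rho> K)) \<longlonglongrightarrow> q * 1 + real d * (1 - 1)"
    by (intro tendsto_intros lower \<rho>)
  have "(\<lambda>K. cube_avg A K f) \<longlonglongrightarrow> q"
  proof (rule tendsto_sandwich)
    show "\<forall>\<^sub>F K in sequentially. cube_avg A (d * (K div d)) f * \<rho> K \<le> cube_avg A K f"
      "\<forall>\<^sub>F K in sequentially. cube_avg A K f \<le> cube_avg A (d * (K div d)) f * \<rho> K + real d * (1 - \<rho> K)"
      using eventually_ge_at_top[of d] by (eventually_elim; use sandwich in simp)+
  qed (use lower upper in simp_all)
  moreover have "(if hull_edge A n \<alpha> \<beta> \<and> \<beta> - \<alpha> dvd n \<alpha> - n \<beta> then of_int (\<beta> - \<alpha>) else 0) = f n" for n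
    using d(2) by (simp add: f_def flip: d(2))
  ultimately show ?thesis by simp
qed

section \<open>The expected number of hull edges\<close>

definition strict_min :: "int set \<Rightarrow> (int \<Rightarrow> int) \<Rightarrow> int \<Rightarrow> bool" where
  "strict_min S n \<beta> \<longleftrightarrow> \<beta> \<in> S \<and> (\<forall>\<gamma>\<in>S - {\<beta>}. n \<beta> < n \<gamma>)"

lemma strict_min_unique: "strict_min S n \<alpha> \<Longrightarrow> strict_min S n \<beta> \<Longrightarrow> \<alpha> = \<beta>"
  unfolding strict_min_def by (metis DiffI less_asym singletonD)

lemma strict_min_exists:
  assumes "finite S" "S \<noteq> {}" "inj_on n S"
  shows "\<exists>\<beta>. strict_min S n \<beta>"
proof -
  obtain \<beta> where \<beta>: "\<beta> \<in> S" "\<And>\<gamma>. \<gamma> \<in> S \<Longrightarrow> n \<beta> \<le> n \<gamma>"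
    using arg_min_if_finite[OF assms(1,2), of n] by (metis linorder_not_less)
  have "n \<beta> < n \<gamma>" if "\<gamma> \<in> S - {\<beta>}" for \<gamma>
    using \<beta>(2)[of \<gamma>] inj_onD[OF assms(3) _ \<beta>(1), of \<gamma>] that by fastforce
  then show ?thesis using \<beta>(1) unfolding strict_min_def by blast
qed

lemma cube_avg_tied_le:
  assumes A: "finite A" and K: "0 < K"
  shows "cube_avg A K (\<lambda>n. of_bool (\<not> inj_on n A)) \<le> real (card A) ^ 2 / real K"
proof -
  define P :: "int \<times> int \<Rightarrow> (int \<Rightarrow> int) \<Rightarrow> bool"
    where "P = (\<lambda>(\<alpha>, \<beta>) n. \<alpha> \<noteq> \<beta> \<and> n \<alpha> = n \<beta>)"
  have "cube_avg A K (\<lambda>n. of_bool (\<not> inj_on n A))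
      \<le> cube_avg A K (\<lambda>n. \<Sum>t\<in>A \<times> A. of_bool (P t n))"
  proof (rule cube_avg_mono)
    fix n :: "int \<Rightarrow> int"
    show "of_bool (\<not> inj_on n A) \<le> (\<Sum>t\<in>A \<times> A. of_bool (P t n) :: real)"
    proof (cases "inj_on n A")
      case False
      then obtain \<alpha> \<beta> where t: "(\<alpha>, \<beta>) \<in> A \<times> A" "P (\<alpha>, \<beta>) n"
        unfolding inj_on_def P_def by auto
      have "of_bool (P (\<alpha>, \<beta>) n) \<le> (\<Sum>t\<in>A \<times> A. of_bool (P t n) :: real)"
        using t A by (intro member_le_sum) auto
      then show ?thesis using t False by simp
    qed (auto intro: sum_nonneg)
  qed
  also have "\<dots> = (\<Sum>t\<in>A \<times> A. cube_avg A K (\<lambda>n. of_bool (P t n)))"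
    by (rule cube_avg_sum)
  also have "\<dots> \<le> (\<Sum>t\<in>A \<times> A. 1 / real K)"
  proof (rule sum_mono)
    fix t assume "t \<in> A \<times> A"
    then obtain \<alpha> \<beta> where t: "t = (\<alpha>, \<beta>)" "\<alpha> \<in> A" "\<beta> \<in> A" by auto
    show "cube_avg A K (\<lambda>n. of_bool (P t n)) \<le> 1 / real K"
    proof (cases "\<alpha> = \<beta>")
      case False
      have "cube_avg A K (\<lambda>n. of_bool (P t n)) \<le> real (card {0::int}) / real K"
      proof (rule cube_avg_determined_le[OF A t(3) _ _ _ K, where h = "\<lambda>n. n \<alpha> - n \<beta>"])
        show "n \<alpha> - n \<beta> \<in> {0}" if "P t n" for n using that by (simp add: P_def t(1))
        fix n n' :: "int \<Rightarrow> int"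
        assume eq: "\<And>\<alpha>. \<alpha> \<in> A - {\<beta>} \<Longrightarrow> n \<alpha> = n' \<alpha>" "n \<alpha> - n \<beta> = n' \<alpha> - n' \<beta>"
        have "n \<alpha> = n' \<alpha>" using eq(1) t False by auto
        then show "n \<beta> = n' \<beta>" using eq(2) by simp
      qed simp
      then show ?thesis by simp
    next
      case True
      then have "P t n = False" for n by (auto simp: P_def t(1))
      then show ?thesis by (simp add: cube_avg_def)
    qed
  qed
  also have "\<dots> = real (card A) ^ 2 / real K"
    by (simp add: card_cartesian_product power2_eq_square)
  finally show ?thesis .
qed

text \<open>Exchanging two coordinates is a symmetry of the cube.\<close>

lemma strict_min_frequency_eq:
  assumes S: "S \<subseteq> A" "\<beta> \<in> S" "\<beta>' \<in> S"
  shows "cube_avg A K (\<lambda>n. of_bool (strict_min S n \<beta>)) = cube_avg A K (\<lambda>n. of_bool (strict_min S n \<beta>'))"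
proof -
  let ?t = "Transposition.transpose \<beta> \<beta>'"
  have tA: "?t \<alpha> \<in> A \<longleftrightarrow> \<alpha> \<in> A" and tS: "?t \<alpha> \<in> S \<longleftrightarrow> \<alpha> \<in> S" for \<alpha>
    using S by (auto simp: Transposition.transpose_def)
  have cube: "n \<circ> ?t \<in> cube A K" if "n \<in> cube A K" for n
    using that tA by (auto simp: cube_def PiE_def Pi_def extensional_def)
  have swap: "strict_min S (n \<circ> ?t) \<beta>' \<longleftrightarrow> strict_min S n \<beta>" for n
  proof
    assume m: "strict_min S (n \<circ> ?t) \<beta>'"
    have "n \<beta> < n \<gamma>" if "\<gamma> \<in> S - {\<beta>}" for \<gamma>
    proof -
      have "?t \<gamma> \<in> S - {\<beta>'}" using that tS[of \<gamma>] by (auto simp: Transposition.transpose_def split: if_splits)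
      then have "(n \<circ> ?t) \<beta>' < (n \<circ> ?t) (?t \<gamma>)" using m unfolding strict_min_def by blast
      then show ?thesis by simp
    qed
    then show "strict_min S n \<beta>" using S unfolding strict_min_def by blast
  next
    assume m: "strict_min S n \<beta>"
    have "(n \<circ> ?t) \<beta>' < (n \<circ> ?t) \<gamma>" if "\<gamma> \<in> S - {\<beta>'}" for \<gamma>
    proof -
      have "?t \<gamma> \<in> S - {\<beta>}" using that tS[of \<gamma>] by (auto simp: Transposition.transpose_def split: if_splits)
      then have "n \<beta> < n (?t \<gamma>)" using m unfolding strict_min_def by blast
      then show ?thesis by simp
    qed
    then show "strict_min S (n \<circ> ?t) \<beta>'" using S unfolding strict_min_def by blast
  qed
  have "(\<Sum>n\<in>cube A K. of_bool (strict_min S n \<beta>) :: real) = (\<Sum>n\<in>cube A K. of_bool (strict_min S n \<beta>'))"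
    by (rule sum.reindex_bij_witness[where i = "\<lambda>n. n \<circ> ?t" and j = "\<lambda>n. n \<circ> ?t"])
      (use cube swap in \<open>auto simp: comp_assoc\<close>)
  then show ?thesis by (simp add: cube_avg_def)
qed

text \<open>By symmetry all elements of \<open>S\<close> have the same chance of being lowest, and some element is strictly
  lowest unless two heights agree.\<close>

lemma strict_min_frequency_tendsto:
  assumes A: "finite A" and S: "S \<subseteq> A" "\<beta> \<in> S"
  shows "(\<lambda>K. cube_avg A K (\<lambda>n. of_bool (strict_min S n \<beta>))) \<longlonglongrightarrow> 1 / real (card S)"
proof -
  have fin: "finite S" using A S(1) by (rule rev_finite_subset)
  have card: "0 < card S" using fin S(2) by (auto simp: card_gt_0_iff)
  define m where "m K = cube_avg A K (\<lambda>n. of_bool (strict_min S n \<beta>))" for K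
  have total: "real (card S) * m K = cube_avg A K (\<lambda>n. of_bool (\<exists>\<gamma>. strict_min S n \<gamma>))" for K
  proof -
    have "(\<Sum>\<gamma>\<in>S. of_bool (strict_min S n \<gamma>) :: real) = of_bool (\<exists>\<gamma>. strict_min S n \<gamma>)" for n
    proof (cases "\<exists>\<gamma>. strict_min S n \<gamma>")
      case True
      then obtain \<gamma> where \<gamma>: "strict_min S n \<gamma>" by blast
      have "strict_min S n \<delta> \<longleftrightarrow> \<delta> = \<gamma>" for \<delta> using \<gamma> strict_min_unique by blast
      moreover have "\<gamma> \<in> S" using \<gamma> by (simp add: strict_min_def)
      ultimately show ?thesis using fin by (simp add: of_bool_def sum.delta)
    qed simp
    then have "cube_avg A K (\<lambda>n. of_bool (\<exists>\<gamma>. strict_min S n \<gamma>))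
        = (\<Sum>\<gamma>\<in>S. cube_avg A K (\<lambda>n. of_bool (strict_min S n \<gamma>)))"
      by (simp flip: cube_avg_sum)
    also have "\<dots> = (\<Sum>\<gamma>\<in>S. m K)"
      unfolding m_def using strict_min_frequency_eq[OF S(1) _ S(2)] by (intro sum.cong) auto
    finally show ?thesis by simp
  qed
  have "(\<lambda>K. real (card S) * m K) \<longlonglongrightarrow> 1"
  proof (rule tendsto_sandwich)
    show "\<forall>\<^sub>F K in sequentially. 1 - real (card A) ^ 2 / real K \<le> real (card S) * m K"
      using eventually_gt_at_top[of 0]
    proof eventually_elim
      case (elim K)
      have "cube_avg A K (\<lambda>n. 1 - of_bool (\<not> inj_on n A)) \<le> real (card S) * m K"
        unfolding total
      proof (rule cube_avg_mono)
        fix n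
        show "1 - of_bool (\<not> inj_on n A) \<le> (of_bool (\<exists>\<gamma>. strict_min S n \<gamma>) :: real)"
          using strict_min_exists[OF fin _ inj_on_subset[OF _ S(1)], of n] S(2) by auto
      qed
      then show ?case
        using cube_avg_tied_le[OF A elim] cube_avg_const[OF A elim, of 1] unfolding cube_avg_diff by simp
    qed
    show "\<forall>\<^sub>F K in sequentially. real (card S) * m K \<le> 1"
      using eventually_gt_at_top[of 0]
    proof eventually_elim
      case (elim K)
      show ?case
        unfolding total using cube_avg_const[OF A elim, of 1]
          cube_avg_mono[of A K "\<lambda>n. of_bool (\<exists>\<gamma>. strict_min S n \<gamma>)" "\<lambda>n. 1"] by simp
    qed
    have "(\<lambda>K. 1 - real (card A) ^ 2 / real K) \<longlonglongrightarrow> 1 - 0"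
      by (intro tendsto_diff tendsto_const lim_const_over_n)
    then show "(\<lambda>K. 1 - real (card A) ^ 2 / real K) \<longlonglongrightarrow> 1" by simp
  qed simp
  then have "(\<lambda>K. real (card S) * m K / real (card S)) \<longlonglongrightarrow> 1 / real (card S)"
    by (rule tendsto_divide) (use card in auto)
  then show ?thesis using card by (simp add: m_def)
qed

text \<open>Edges are oriented upwards, and \<open>\<sigma> = 1\<close> or \<open>\<sigma> = -1\<close> selects those that go to the right or to the
  left. The sign lets one argument serve for both sides of the lowest point.\<close>

definition rising_edges :: "int set \<Rightarrow> (int \<Rightarrow> int) \<Rightarrow> int \<Rightarrow> (int \<times> int) set" where
  "rising_edges A n \<sigma> = {(\<alpha>, \<beta>) \<in> A \<times> A. hull_edge A n \<alpha> \<beta> \<and> n \<alpha> < n \<beta> \<and> 0 < \<sigma> * (\<beta> - \<alpha>)}"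

definition beyond :: "int set \<Rightarrow> int \<Rightarrow> int \<Rightarrow> int set" where
  "beyond A \<sigma> \<beta> = {\<gamma> \<in> A. 0 \<le> \<sigma> * (\<gamma> - \<beta>)}"

lemma finite_rising_edges: "finite A \<Longrightarrow> finite (rising_edges A n \<sigma>)"
  by (rule finite_subset[of _ "A \<times> A"]) (auto simp: rising_edges_def)

lemma excess_at_end:
  "excess \<alpha> \<beta> \<gamma> n = (\<beta> - \<alpha>)\<^sup>2 * (n \<gamma> - n \<beta>) - (\<beta> - \<alpha>) * (\<gamma> - \<beta>) * (n \<beta> - n \<alpha>)"
  by (simp add: excess_def power2_eq_square algebra_simps)

lemma excess_at_start:
  "excess \<alpha> \<beta> \<gamma> n = (\<beta> - \<alpha>)\<^sup>2 * (n \<gamma> - n \<alpha>) - (\<beta> - \<alpha>) * (\<gamma> - \<alpha>) * (n \<beta> - n \<alpha>)"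
  by (simp add: excess_def power2_eq_square algebra_simps)

lemma excess_commute: "excess \<beta> \<alpha> \<gamma> n = excess \<alpha> \<beta> \<gamma> n"
  by (simp add: excess_def algebra_simps)

lemma hull_edge_commute: "hull_edge A n \<beta> \<alpha> \<longleftrightarrow> hull_edge A n \<alpha> \<beta>"
  unfolding hull_edge_def excess_commute[of \<beta> \<alpha>] by (auto simp: insert_commute)

lemma sign_cases: "\<bar>\<sigma>\<bar> = (1::int) \<Longrightarrow> (\<sigma> = 1 \<Longrightarrow> P) \<Longrightarrow> (\<sigma> = -1 \<Longrightarrow> P) \<Longrightarrow> P"
  by linarith

lemma same_side_mult_pos:
  assumes "\<bar>\<sigma>\<bar> = (1::int)" "0 < \<sigma> * x" "0 < \<sigma> * y"
  shows "0 < x * y"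
  using assms by (elim sign_cases) (auto simp: mult_neg_neg)

text \<open>Beyond its upper end, an edge continues as a rising line that all further points lie above.\<close>

lemma rising_edge_ends_at_min:
  assumes \<sigma>: "\<bar>\<sigma>\<bar> = 1" and e: "(\<alpha>, \<beta>) \<in> rising_edges A n \<sigma>"
  shows "strict_min (beyond A \<sigma> \<beta>) n \<beta>" "\<not> strict_min A n \<beta>"
proof -
  have e': "\<alpha> \<in> A" "\<beta> \<in> A" "hull_edge A n \<alpha> \<beta>" "n \<alpha> < n \<beta>" "0 < \<sigma> * (\<beta> - \<alpha>)"
    using e by (auto simp: rising_edges_def)
  have "n \<beta> < n \<gamma>" if "\<gamma> \<in> beyond A \<sigma> \<beta> - {\<beta>}" for \<gamma>
  proof -
    have \<gamma>: "\<gamma> \<in> A" "0 < \<sigma> * (\<gamma> - \<beta>)"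
      using that \<sigma> by (auto simp: beyond_def less_le)
    have "\<gamma> \<noteq> \<alpha>" "\<gamma> \<noteq> \<beta>" using \<gamma>(2) e'(5) by (auto simp: algebra_simps)
    then have "0 < excess \<alpha> \<beta> \<gamma> n" using e'(3) \<gamma>(1) by (simp add: hull_edge_def)
    moreover have "0 < (\<beta> - \<alpha>) * (\<gamma> - \<beta>) * (n \<beta> - n \<alpha>)"
      by (rule mult_pos_pos) (use same_side_mult_pos[OF \<sigma> e'(5) \<gamma>(2)] e'(4) in auto)
    ultimately have "0 < (\<beta> - \<alpha>)\<^sup>2 * (n \<gamma> - n \<beta>)" unfolding excess_at_end by linarith
    then show ?thesis by (simp add: zero_less_mult_iff)
  qed
  then show "strict_min (beyond A \<sigma> \<beta>) n \<beta>"
    using e'(2) unfolding strict_min_def beyond_def by simp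
  show "\<not> strict_min A n \<beta>"
  proof
    assume "strict_min A n \<beta>"
    then have "n \<beta> < n \<alpha>" using e'(1,4) by (cases "\<alpha> = \<beta>") (auto simp: strict_min_def)
    then show False using e'(4) by simp
  qed
qed

text \<open>Each of two edges with the same upper end would pass strictly below the lower end of the other,
  which is impossible for two lines through a common point.\<close>

lemma rising_edges_inj:
  assumes \<sigma>: "\<bar>\<sigma>\<bar> = 1"
  shows "inj_on snd (rising_edges A n \<sigma>)"
proof (rule inj_onI)
  fix e e' assume ee: "e \<in> rising_edges A n \<sigma>" "e' \<in> rising_edges A n \<sigma>" "snd e = snd e'"
  obtain \<alpha> \<beta> \<alpha>' where eq: "e = (\<alpha>, \<beta>)" "e' = (\<alpha>', \<beta>)" using ee(3) by (metis prod.collapse)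
  have pos: "0 < \<sigma> * (\<beta> - \<alpha>)" "0 < \<sigma> * (\<beta> - \<alpha>')"
    and edge: "\<alpha> \<in> A" "\<alpha>' \<in> A" "hull_edge A n \<alpha> \<beta>" "hull_edge A n \<alpha>' \<beta>"
    using ee eq by (auto simp: rising_edges_def)
  show "e = e'"
  proof (rule ccontr)
    assume "e \<noteq> e'"
    then have ne: "\<alpha> \<noteq> \<alpha>'" using eq by simp
    \<comment> \<open>Both excesses are multiples of \<open>x\<close>, by factors of opposite sign.\<close>
    define x where "x = (\<beta> - \<alpha>') * (n \<beta> - n \<alpha>) - (\<beta> - \<alpha>) * (n \<beta> - n \<alpha>')"
    have "0 < excess \<alpha> \<beta> \<alpha>' n" "0 < excess \<alpha>' \<beta> \<alpha> n"
      using edge ne pos by (auto simp: hull_edge_def)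
    moreover have "excess \<alpha> \<beta> \<alpha>' n = (\<beta> - \<alpha>) * x" "excess \<alpha>' \<beta> \<alpha> n = (\<beta> - \<alpha>') * (- x)"
      by (simp_all add: excess_def x_def algebra_simps)
    ultimately have "0 < (\<beta> - \<alpha>) * x" "0 < (\<beta> - \<alpha>') * (- x)" by simp_all
    with pos \<sigma> show False by (elim sign_cases) (auto simp: zero_less_mult_iff mult_less_0_iff)
  qed
qed

lemma card_rising_edges_le:
  assumes A: "finite A" and \<sigma>: "\<bar>\<sigma>\<bar> = 1"
  shows "real (card (rising_edges A n \<sigma>))
    \<le> (\<Sum>\<beta>\<in>A. of_bool (strict_min (beyond A \<sigma> \<beta>) n \<beta>) - of_bool (strict_min A n \<beta>))"
proof -
  let ?R = "{\<beta> \<in> A. strict_min (beyond A \<sigma> \<beta>) n \<beta> \<and> \<not> strict_min A n \<beta>}"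
  have "snd ` rising_edges A n \<sigma> \<subseteq> ?R"
  proof
    fix \<beta> assume "\<beta> \<in> snd ` rising_edges A n \<sigma>"
    then obtain \<alpha> where "(\<alpha>, \<beta>) \<in> rising_edges A n \<sigma>" by auto
    then show "\<beta> \<in> ?R"
      using rising_edge_ends_at_min[OF \<sigma>, of \<alpha> \<beta> A n] by (auto simp: rising_edges_def)
  qed
  then have "card (rising_edges A n \<sigma>) \<le> card ?R"
    using A by (intro card_inj_on_le[OF rising_edges_inj[OF \<sigma>]]) auto
  moreover have "real (card ?R) = (\<Sum>\<beta>\<in>A. of_bool (strict_min (beyond A \<sigma> \<beta>) n \<beta> \<and> \<not> strict_min A n \<beta>))"
    using A by (simp add: of_bool_def sum.If_cases Int_def)
  moreover have "strict_min A n \<beta> \<Longrightarrow> strict_min (beyond A \<sigma> \<beta>) n \<beta>" for \<beta>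
    by (auto simp: strict_min_def beyond_def)
  then have "(\<Sum>\<beta>\<in>A. of_bool (strict_min (beyond A \<sigma> \<beta>) n \<beta> \<and> \<not> strict_min A n \<beta>))
      = (\<Sum>\<beta>\<in>A. of_bool (strict_min (beyond A \<sigma> \<beta>) n \<beta>) - of_bool (strict_min A n \<beta>) :: real)"
    by (intro sum.cong) auto
  ultimately show ?thesis by simp
qed

text \<open>From the lowest point \<open>\<mu>\<close>, the flattest of the lines to the points on the chosen side is an edge:
  points on that side lie above it by minimality of the slope, points on the other side because the
  line falls towards them.\<close>

lemma rising_edge_exists:
  assumes A: "finite A" and \<sigma>: "\<bar>\<sigma>\<bar> = 1" and generic: "\<not> nearly_collinear A 0 n"
    and \<mu>: "strict_min A n \<mu>" and \<beta>0: "\<beta>0 \<in> A" "0 < \<sigma> * (\<beta>0 - \<mu>)"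
  shows "rising_edges A n \<sigma> \<noteq> {}"
proof -
  define T where "T = {\<beta> \<in> A. 0 < \<sigma> * (\<beta> - \<mu>)}"
  \<comment> \<open>The unsigned slope of the line from \<open>\<mu>\<close> to the point over \<open>\<beta>\<close>, positive when it rises away
    from \<open>\<mu>\<close>.\<close>
  define slope where "slope \<beta> = of_int (n \<beta> - n \<mu>) / (of_int (\<sigma> * (\<beta> - \<mu>)) :: real)" for \<beta>
  have T: "finite T" "T \<noteq> {}" using A \<beta>0 by (auto simp: T_def)
  obtain \<beta> where \<beta>: "\<beta> \<in> T" "\<And>\<gamma>. \<gamma> \<in> T \<Longrightarrow> slope \<beta> \<le> slope \<gamma>"
    using arg_min_if_finite[OF T, of slope] by (metis linorder_not_less)
  have \<beta>A: "\<beta> \<in> A" "0 < \<sigma> * (\<beta> - \<mu>)" using \<beta>(1) by (auto simp: T_def)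
  have \<mu>A: "\<mu> \<in> A" and above: "\<And>\<gamma>. \<gamma> \<in> A - {\<mu>} \<Longrightarrow> n \<mu> < n \<gamma>" using \<mu> by (auto simp: strict_min_def)
  have ne: "\<mu> \<noteq> \<beta>" using \<beta>A by auto
  have "0 < excess \<mu> \<beta> \<gamma> n" if \<gamma>: "\<gamma> \<in> A - {\<mu>, \<beta>}" for \<gamma>
  proof (cases "0 < \<sigma> * (\<gamma> - \<mu>)")
    case True
    then have "slope \<beta> \<le> slope \<gamma>" using \<beta>(2) \<gamma> by (simp add: T_def)
    moreover have "(0::real) < of_int (\<sigma> * (\<gamma> - \<mu>))" "(0::real) < of_int (\<sigma> * (\<beta> - \<mu>))"
      using True \<beta>A(2) by (simp_all only: of_int_0_less_iff)
    ultimately have "of_int (n \<beta> - n \<mu>) * of_int (\<sigma> * (\<gamma> - \<mu>)) \<le> (of_int (n \<gamma> - n \<mu>) * of_int (\<sigma> * (\<beta> - \<mu>)) :: real)"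
      by (simp only: slope_def pos_le_divide_eq times_divide_eq_left pos_divide_le_eq)
    then have "(n \<beta> - n \<mu>) * (\<sigma> * (\<gamma> - \<mu>)) \<le> (n \<gamma> - n \<mu>) * (\<sigma> * (\<beta> - \<mu>))"
      by (simp only: of_int_mult[symmetric] of_int_le_iff)
    then have "(\<sigma> * (\<beta> - \<mu>)) * ((n \<beta> - n \<mu>) * (\<sigma> * (\<gamma> - \<mu>))) \<le> (\<sigma> * (\<beta> - \<mu>)) * ((n \<gamma> - n \<mu>) * (\<sigma> * (\<beta> - \<mu>)))"
      using \<beta>A(2) by (intro mult_left_mono) auto
    moreover have "excess \<mu> \<beta> \<gamma> n = (\<sigma> * (\<beta> - \<mu>)) * ((n \<gamma> - n \<mu>) * (\<sigma> * (\<beta> - \<mu>)))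
        - (\<sigma> * (\<beta> - \<mu>)) * ((n \<beta> - n \<mu>) * (\<sigma> * (\<gamma> - \<mu>)))"
      using \<sigma> by (elim sign_cases) (simp_all add: excess_at_start power2_eq_square algebra_simps)
    ultimately have "0 \<le> excess \<mu> \<beta> \<gamma> n" by linarith
    moreover have "excess \<mu> \<beta> \<gamma> n \<noteq> 0"
      using generic \<gamma> \<mu>A \<beta>A ne unfolding nearly_collinear_def by fastforce
    ultimately show ?thesis by simp
  next
    case False
    then have "0 < \<sigma> * (\<mu> - \<gamma>)" using \<gamma> \<sigma> by (elim sign_cases) auto
    then have "0 < (\<beta> - \<mu>) * (\<mu> - \<gamma>)" using same_side_mult_pos[OF \<sigma> \<beta>A(2)] by blast
    then have "0 < (\<beta> - \<mu>) * (\<mu> - \<gamma>) * (n \<beta> - n \<mu>)"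
      by (rule mult_pos_pos) (use above[of \<beta>] \<beta>A ne in auto)
    moreover have "0 < (\<beta> - \<mu>)\<^sup>2 * (n \<gamma> - n \<mu>)"
      by (rule mult_pos_pos) (use above[of \<gamma>] \<gamma> ne in auto)
    ultimately show ?thesis unfolding excess_at_start by (simp add: algebra_simps)
  qed
  then have "(\<mu>, \<beta>) \<in> rising_edges A n \<sigma>"
    using \<mu>A \<beta>A ne above[of \<beta>] by (auto simp: rising_edges_def hull_edge_def)
  then show ?thesis by blast
qed

text \<open>Going through \<open>A\<close> against the direction \<open>\<sigma>\<close>, the number of points from \<open>\<beta>\<close> onwards runs through
  \<open>1, \<dots>, card A\<close>.\<close>

lemma sum_inverse_card_beyond:
  assumes A: "finite A" and \<sigma>: "\<bar>\<sigma>\<bar> = 1"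
  shows "(\<Sum>\<beta>\<in>A. 1 / real (card (beyond A \<sigma> \<beta>))) = harm (card A)"
proof -
  let ?c = "\<lambda>\<beta>. card (beyond A \<sigma> \<beta>)"
  have fin: "finite (beyond A \<sigma> \<beta>)" for \<beta> using A by (simp add: beyond_def)
  have less: "?c \<beta>' < ?c \<beta>" if "\<beta> \<in> A" "\<beta>' \<in> A" "\<sigma> * \<beta> < \<sigma> * \<beta>'" for \<beta> \<beta>'
  proof (rule psubset_card_mono[OF fin])
    have "\<beta> \<in> beyond A \<sigma> \<beta> - beyond A \<sigma> \<beta>'" using that by (simp add: beyond_def algebra_simps)
    moreover have "beyond A \<sigma> \<beta>' \<subseteq> beyond A \<sigma> \<beta>" using that by (auto simp: beyond_def algebra_simps)
    ultimately show "beyond A \<sigma> \<beta>' \<subset> beyond A \<sigma> \<beta>" by blast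
  qed
  have inj: "inj_on ?c A"
  proof (rule inj_onI)
    fix \<beta> \<beta>' assume b: "\<beta> \<in> A" "\<beta>' \<in> A" "?c \<beta> = ?c \<beta>'"
    then have "\<sigma> * \<beta> = \<sigma> * \<beta>'" using less[of \<beta> \<beta>'] less[of \<beta>' \<beta>] by (cases "\<sigma> * \<beta>" "\<sigma> * \<beta>'" rule: linorder_cases) auto
    then show "\<beta> = \<beta>'" using \<sigma> by auto
  qed
  have "?c ` A \<subseteq> {1..card A}"
  proof
    fix k assume "k \<in> ?c ` A"
    then obtain \<beta> where \<beta>: "\<beta> \<in> A" "k = ?c \<beta>" by blast
    have "\<beta> \<in> beyond A \<sigma> \<beta>" using \<beta>(1) by (simp add: beyond_def)
    then have "0 < ?c \<beta>" using fin card_gt_0_iff by blast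
    moreover have "?c \<beta> \<le> card A" using A by (intro card_mono) (auto simp: beyond_def)
    ultimately show "k \<in> {1..card A}" using \<beta>(2) by simp
  qed
  then have image: "?c ` A = {1..card A}"
    using card_image[OF inj] by (intro card_subset_eq) auto
  have "(\<Sum>\<beta>\<in>A. 1 / real (?c \<beta>)) = (\<Sum>k\<in>?c ` A. 1 / real k)"
    by (simp add: sum.reindex[OF inj])
  then show ?thesis unfolding image by (simp add: harm_def inverse_eq_divide)
qed

definition edge_count :: "int set \<Rightarrow> (int \<Rightarrow> int) \<Rightarrow> real" where
  "edge_count A n = (\<Sum>(\<alpha>, \<beta>)\<in>ordered_pairs A. of_bool (hull_edge A n \<alpha> \<beta>))"

text \<open>Every edge whose ends have different heights is rising for exactly one of the two directions.\<close>

lemma edge_count_bounds: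
  assumes A: "finite A"
  shows "real (card (rising_edges A n 1)) + real (card (rising_edges A n (-1))) \<le> edge_count A n"
    and "edge_count A n \<le> real (card (rising_edges A n 1)) + real (card (rising_edges A n (-1)))
           + real (card A) ^ 2 * of_bool (\<not> inj_on n A)"
proof -
  define H where "H = {e \<in> ordered_pairs A. hull_edge A n (fst e) (snd e)}"
  define H1 where "H1 = {e \<in> H. n (fst e) < n (snd e)}"
  define H2 where "H2 = {e \<in> H. n (snd e) < n (fst e)}"
  have fin: "finite H" "finite H1" "finite H2"
    using finite_ordered_pairs[OF A] by (simp_all add: H_def H1_def H2_def)
  have count: "edge_count A n = real (card H)"
    using finite_ordered_pairs[OF A]
    by (simp add: edge_count_def H_def case_prod_unfold of_bool_def sum.If_cases Int_def)
  have R1: "rising_edges A n 1 = H1"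
    by (auto simp: rising_edges_def H1_def H_def ordered_pairs_def)
  have "rising_edges A n (-1) = prod.swap ` H2"
  proof (intro equalityI subsetI)
    fix e assume "e \<in> rising_edges A n (-1)"
    then have "prod.swap e \<in> H2"
      using hull_edge_commute[of A n "snd e" "fst e"]
      by (auto simp: rising_edges_def H2_def H_def ordered_pairs_def)
    then have "prod.swap (prod.swap e) \<in> prod.swap ` H2" by (rule imageI)
    then show "e \<in> prod.swap ` H2" by simp
  next
    fix e assume "e \<in> prod.swap ` H2"
    then obtain e' where "e' \<in> H2" "e = prod.swap e'" by blast
    then show "e \<in> rising_edges A n (-1)"
      using hull_edge_commute[of A n "fst e'" "snd e'"]
      by (auto simp: rising_edges_def H2_def H_def ordered_pairs_def)
  qed
  then have R2: "card (rising_edges A n (-1)) = card H2" by (simp add: card_image)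
  have union: "card (H1 \<union> H2) = card H1 + card H2"
    using fin by (intro card_Un_disjoint) (auto simp: H1_def H2_def)
  have "card (H1 \<union> H2) \<le> card H" using fin by (intro card_mono) (auto simp: H1_def H2_def)
  then show "real (card (rising_edges A n 1)) + real (card (rising_edges A n (-1))) \<le> edge_count A n"
    using union by (simp add: count R1 R2)
  show "edge_count A n \<le> real (card (rising_edges A n 1)) + real (card (rising_edges A n (-1)))
           + real (card A) ^ 2 * of_bool (\<not> inj_on n A)"
  proof (cases "inj_on n A")
    case True
    have "H \<subseteq> H1 \<union> H2"
    proof
      fix e assume e: "e \<in> H"
      then have "fst e \<in> A" "snd e \<in> A" "fst e \<noteq> snd e" by (auto simp: H_def ordered_pairs_def)
      then have "n (fst e) \<noteq> n (snd e)" using True by (auto dest: inj_onD)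
      then show "e \<in> H1 \<union> H2" using e by (auto simp: H1_def H2_def)
    qed
    then have "card H \<le> card (H1 \<union> H2)" using fin by (intro card_mono) auto
    then show ?thesis using union True by (simp add: count R1 R2)
  next
    case False
    have "card H \<le> card (A \<times> A)" using A by (intro card_mono) (auto simp: H_def ordered_pairs_def)
    then have "real (card H) \<le> real (card A ^ 2)"
      by (simp only: card_cartesian_product power2_eq_square of_nat_le_iff)
    then have "edge_count A n \<le> real (card A) ^ 2 * of_bool (\<not> inj_on n A)"
      using False by (simp add: count)
    then show ?thesis by (rule order_trans) simp
  qed
qed

lemma card_rising_edges_ge:
  assumes A: "finite A" and \<sigma>: "\<bar>\<sigma>\<bar> = 1"
    and ext: "x \<in> A" "\<And>\<mu>. \<mu> \<in> A \<Longrightarrow> \<mu> \<noteq> x \<Longrightarrow> 0 < \<sigma> * (x - \<mu>)"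
  shows "1 - of_bool (strict_min A n x) - of_bool (nearly_collinear A 0 n) - of_bool (\<not> inj_on n A)
    \<le> real (card (rising_edges A n \<sigma>))"
proof (cases "strict_min A n x \<or> nearly_collinear A 0 n \<or> \<not> inj_on n A")
  case True
  then show ?thesis by auto
next
  case False
  then obtain \<mu> where \<mu>: "strict_min A n \<mu>" using strict_min_exists[of A n] A ext(1) by blast
  then have "\<mu> \<in> A" "\<mu> \<noteq> x" using False by (auto simp: strict_min_def)
  then have "rising_edges A n \<sigma> \<noteq> {}"
    using rising_edge_exists[OF A \<sigma> _ \<mu> ext(1)] False ext(2) by blast
  then have "0 < card (rising_edges A n \<sigma>)"
    using finite_rising_edges[OF A] by (simp add: card_gt_0_iff)
  then have "1 \<le> real (card (rising_edges A n \<sigma>))" by simp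
  then show ?thesis by (simp add: False)
qed

lemma cube_avg_nearly_collinear_tendsto:
  assumes A: "finite A"
  shows "(\<lambda>K. cube_avg A K (\<lambda>n. of_bool (nearly_collinear A B n))) \<longlonglongrightarrow> 0"
proof (rule Lim_null_comparison)
  show "\<forall>\<^sub>F K in sequentially. norm (cube_avg A K (\<lambda>n. of_bool (nearly_collinear A B n)))
      \<le> real (card A) ^ 3 * real (card {-B..B}) / real K"
    using eventually_gt_at_top[of 0]
  proof eventually_elim
    case (elim K)
    have "0 \<le> cube_avg A K (\<lambda>n. of_bool (nearly_collinear A B n))" by (rule cube_avg_nonneg) simp
    then show ?case using cube_avg_nearly_collinear_le[OF A elim, of B] by simp
  qed
qed (rule lim_const_over_n)

lemma cube_avg_tied_tendsto:
  assumes A: "finite A"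
  shows "(\<lambda>K. cube_avg A K (\<lambda>n. of_bool (\<not> inj_on n A))) \<longlonglongrightarrow> 0"
proof (rule Lim_null_comparison)
  show "\<forall>\<^sub>F K in sequentially. norm (cube_avg A K (\<lambda>n. of_bool (\<not> inj_on n A)))
      \<le> real (card A) ^ 2 / real K"
    using eventually_gt_at_top[of 0]
  proof eventually_elim
    case (elim K)
    have "0 \<le> cube_avg A K (\<lambda>n. of_bool (\<not> inj_on n A))" by (rule cube_avg_nonneg) simp
    then show ?case using cube_avg_tied_le[OF A elim] by simp
  qed
qed (rule lim_const_over_n)

lemma rising_edges_avg_upper:
  assumes A: "finite A" "A \<noteq> {}" and \<sigma>: "\<bar>\<sigma>\<bar> = 1"
  shows "\<exists>u. u \<longlonglongrightarrow> harm (card A) - 1 \<and> (\<forall>K. cube_avg A K (\<lambda>n. real (card (rising_edges A n \<sigma>))) \<le> u K)"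
proof (intro exI conjI allI)
  let ?u = "\<lambda>K. \<Sum>\<beta>\<in>A. cube_avg A K (\<lambda>n. of_bool (strict_min (beyond A \<sigma> \<beta>) n \<beta>))
      - cube_avg A K (\<lambda>n. of_bool (strict_min A n \<beta>))"
  have "?u \<longlonglongrightarrow> (\<Sum>\<beta>\<in>A. 1 / real (card (beyond A \<sigma> \<beta>)) - 1 / real (card A))"
    by (intro tendsto_sum tendsto_diff strict_min_frequency_tendsto[OF A(1)]) (auto simp: beyond_def)
  also have "(\<Sum>\<beta>\<in>A. 1 / real (card (beyond A \<sigma> \<beta>)) - 1 / real (card A)) = harm (card A) - 1"
    using A by (simp add: sum_subtractf sum_inverse_card_beyond[OF A(1) \<sigma>])
  finally show "?u \<longlonglongrightarrow> harm (card A) - 1" .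
  fix K
  have "cube_avg A K (\<lambda>n. real (card (rising_edges A n \<sigma>)))
      \<le> cube_avg A K (\<lambda>n. \<Sum>\<beta>\<in>A. of_bool (strict_min (beyond A \<sigma> \<beta>) n \<beta>) - of_bool (strict_min A n \<beta>))"
    by (intro cube_avg_mono card_rising_edges_le[OF A(1) \<sigma>])
  also have "\<dots> = ?u K" unfolding cube_avg_sum cube_avg_diff ..
  finally show "cube_avg A K (\<lambda>n. real (card (rising_edges A n \<sigma>))) \<le> ?u K" .
qed

lemma rising_edges_avg_lower:
  assumes A: "finite A" "A \<noteq> {}" and \<sigma>: "\<bar>\<sigma>\<bar> = 1"
  shows "\<exists>l. l \<longlonglongrightarrow> 1 - 1 / real (card A)
    \<and> (\<forall>\<^sub>F K in sequentially. l K \<le> cube_avg A K (\<lambda>n. real (card (rising_edges A n \<sigma>))))"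
proof -
  obtain x where x: "x \<in> A" "\<And>\<mu>. \<mu> \<in> A \<Longrightarrow> \<mu> \<noteq> x \<Longrightarrow> 0 < \<sigma> * (x - \<mu>)"
  proof (rule sign_cases[OF \<sigma>])
    assume s: "\<sigma> = 1"
    show thesis
      by (rule that[of "Max A"]) (use A Max_ge[OF A(1)] in \<open>auto simp: s less_le\<close>)
  next
    assume s: "\<sigma> = -1"
    show thesis
      by (rule that[of "Min A"]) (use A Min_le[OF A(1)] in \<open>auto simp: s less_le\<close>)
  qed
  let ?l = "\<lambda>K. 1 - cube_avg A K (\<lambda>n. of_bool (strict_min A n x))
      - cube_avg A K (\<lambda>n. of_bool (nearly_collinear A 0 n)) - cube_avg A K (\<lambda>n. of_bool (\<not> inj_on n A))"
  have "?l \<longlonglongrightarrow> 1 - 1 / real (card A) - 0 - 0"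
    by (intro tendsto_diff tendsto_const strict_min_frequency_tendsto[OF A(1) subset_refl x(1)]
        cube_avg_nearly_collinear_tendsto[OF A(1)] cube_avg_tied_tendsto[OF A(1)])
  moreover have "\<forall>\<^sub>F K in sequentially. ?l K \<le> cube_avg A K (\<lambda>n. real (card (rising_edges A n \<sigma>)))"
    using eventually_gt_at_top[of 0]
  proof eventually_elim
    case (elim K)
    have "cube_avg A K (\<lambda>n. 1 - of_bool (strict_min A n x) - of_bool (nearly_collinear A 0 n)
        - of_bool (\<not> inj_on n A)) \<le> cube_avg A K (\<lambda>n. real (card (rising_edges A n \<sigma>)))"
      by (intro cube_avg_mono card_rising_edges_ge[OF A(1) \<sigma> x])
    then show ?case unfolding cube_avg_diff cube_avg_const[OF A(1) elim] .
  qed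
  ultimately show ?thesis by (intro exI[of _ ?l]) simp
qed

text \<open>The average of \<open>integral_width\<close> and the average number of edges have the same limit. The first is
  what the random model produces, the second is what can be estimated.\<close>

theorem integral_width_avg_tendsto:
  assumes A: "finite A" "2 \<le> card A"
  shows "\<exists>E. (\<lambda>K. cube_avg A K (\<lambda>n. of_int (integral_width A n))) \<longlonglongrightarrow> E
    \<and> 2 - 2 / real (card A) \<le> E \<and> E \<le> 2 * ln (real (card A))"
proof -
  have ne: "A \<noteq> {}" using A by auto
  define q where "q e = lim (\<lambda>K. cube_avg A K (\<lambda>n. of_bool (hull_edge A n (fst e) (snd e))))" for e
  have q: "(\<lambda>K. cube_avg A K (\<lambda>n. of_bool (hull_edge A n (fst e) (snd e)))) \<longlonglongrightarrow> q e" for e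
    unfolding q_def using convergent_hull_edge_frequency[OF A(1)] by (simp add: convergent_LIMSEQ_iff)
  define E where "E = (\<Sum>e\<in>ordered_pairs A. q e)"
  have width: "(\<lambda>K. cube_avg A K (\<lambda>n. of_int (integral_width A n))) \<longlonglongrightarrow> E"
  proof -
    have "(\<lambda>K. \<Sum>e\<in>ordered_pairs A. cube_avg A K (\<lambda>n. if hull_edge A n (fst e) (snd e)
        \<and> snd e - fst e dvd n (fst e) - n (snd e) then of_int (snd e - fst e) else 0)) \<longlonglongrightarrow> E"
      unfolding E_def
      by (intro tendsto_sum integral_edge_frequency_tendsto[OF A(1) _ _ _ q]) (auto simp: ordered_pairs_def)
    moreover have "of_int (integral_width A n) = (\<Sum>e\<in>ordered_pairs A. if hull_edge A n (fst e) (snd e)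
        \<and> snd e - fst e dvd n (fst e) - n (snd e) then of_int (snd e - fst e) else (0::real))" for n
      unfolding integral_width_def of_int_sum by (intro sum.cong) (auto simp: case_prod_unfold)
    ultimately show ?thesis by (simp only: cube_avg_sum)
  qed
  have edges: "(\<lambda>K. cube_avg A K (edge_count A)) \<longlonglongrightarrow> E"
  proof -
    have "edge_count A = (\<lambda>n. \<Sum>e\<in>ordered_pairs A. of_bool (hull_edge A n (fst e) (snd e)))"
      by (simp add: edge_count_def fun_eq_iff case_prod_unfold)
    then have "cube_avg A K (edge_count A)
        = (\<Sum>e\<in>ordered_pairs A. cube_avg A K (\<lambda>n. of_bool (hull_edge A n (fst e) (snd e))))" for K
      by (simp only: cube_avg_sum)
    then show ?thesis unfolding E_def using q by (simp only:) (intro tendsto_sum)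
  qed
  let ?r = "\<lambda>\<sigma> K. cube_avg A K (\<lambda>n. real (card (rising_edges A n \<sigma>)))"
  have lower: "2 - 2 / real (card A) \<le> E"
  proof -
    obtain l l' where l: "l \<longlonglongrightarrow> 1 - 1 / real (card A)" "\<forall>\<^sub>F K in sequentially. l K \<le> ?r 1 K"
        "l' \<longlonglongrightarrow> 1 - 1 / real (card A)" "\<forall>\<^sub>F K in sequentially. l' K \<le> ?r (-1) K"
      using rising_edges_avg_lower[OF A(1) ne, of 1] rising_edges_avg_lower[OF A(1) ne, of "-1"] by auto
    have "\<forall>\<^sub>F K in sequentially. l K + l' K \<le> cube_avg A K (edge_count A)"
      using l(2,4)
    proof eventually_elim
      case (elim K)
      have "cube_avg A K (\<lambda>n. real (card (rising_edges A n 1)) + real (card (rising_edges A n (-1))))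
          \<le> cube_avg A K (edge_count A)"
        by (intro cube_avg_mono edge_count_bounds[OF A(1)])
      then show ?case using elim by (simp add: cube_avg_add)
    qed
    from tendsto_le[OF trivial_limit_sequentially edges tendsto_add[OF l(1,3)] this]
    show ?thesis by simp
  qed
  have upper: "E \<le> 2 * ln (real (card A))"
  proof -
    obtain u u' where u: "u \<longlonglongrightarrow> harm (card A) - 1" "\<And>K. ?r 1 K \<le> u K"
        "u' \<longlonglongrightarrow> harm (card A) - 1" "\<And>K. ?r (-1) K \<le> u' K"
      using rising_edges_avg_upper[OF A(1) ne, of 1] rising_edges_avg_upper[OF A(1) ne, of "-1"] by auto
    \<comment> \<open>Horizontal edges are counted in neither direction; they require two equal heights.\<close>
    let ?t = "\<lambda>K. cube_avg A K (\<lambda>n. of_bool (\<not> inj_on n A))"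
    have "cube_avg A K (edge_count A) \<le> u K + u' K + real (card A) ^ 2 * ?t K" for K
    proof -
      have "cube_avg A K (edge_count A)
          \<le> cube_avg A K (\<lambda>n. real (card (rising_edges A n 1)) + real (card (rising_edges A n (-1)))
              + real (card A) ^ 2 * of_bool (\<not> inj_on n A))"
        by (intro cube_avg_mono edge_count_bounds[OF A(1)])
      then show ?thesis using u(2)[of K] u(4)[of K] by (simp add: cube_avg_add cube_avg_cmult)
    qed
    moreover have "(\<lambda>K. u K + u' K + real (card A) ^ 2 * ?t K)
        \<longlonglongrightarrow> (harm (card A) - 1) + (harm (card A) - 1) + real (card A) ^ 2 * 0"
      by (intro tendsto_intros u cube_avg_tied_tendsto[OF A(1)])
    ultimately have "E \<le> (harm (card A) - 1) + (harm (card A) - 1) + real (card A) ^ 2 * 0"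
      using edges by (intro LIMSEQ_le[of "\<lambda>K. cube_avg A K (edge_count A)" E]) auto
    moreover have "harm (card A) - 1 \<le> ln (real (card A))"
      using euler_mascheroni_sequence_decreasing[of 1 "card A"] A(2) by (simp add: harm_expand)
    ultimately show ?thesis by simp
  qed
  show ?thesis using width lower upper by blast
qed

section \<open>Random polynomials\<close>

lemma integral_width_bounds:
  "0 \<le> integral_width A n" "integral_width A n \<le> (\<Sum>(\<alpha>, \<beta>)\<in>ordered_pairs A. \<beta> - \<alpha>)"
  unfolding integral_width_def by (intro sum_nonneg sum_mono; auto simp: ordered_pairs_def)+

text \<open>Valuations range over an interval symmetric about zero, the cubes start at zero. Convex hulls and
  slopes do not see the difference.\<close>

lemma excess_translate: "excess \<alpha> \<beta> \<gamma> (\<lambda>\<delta>. n \<delta> - s) = excess \<alpha> \<beta> \<gamma> n"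
  by (simp add: excess_def algebra_simps)

lemma integral_width_translate: "integral_width A (\<lambda>\<delta>. n \<delta> - s) = integral_width A n"
  unfolding integral_width_def hull_edge_def excess_translate by simp

lemma nearly_collinear_translate: "nearly_collinear A B (\<lambda>\<delta>. n \<delta> - s) = nearly_collinear A B n"
  unfolding nearly_collinear_def excess_translate by simp

text \<open>If \<open>f\<close> is close to a constant on each event of a partition into equally likely events, then its
  expectation is close to the average of these constants. The valuations of the coefficients induce
  such a partition, on which the number of roots is constant except in degenerate cases.\<close>

lemma (in prob_space) expectation_near_partition_average:
  fixes f :: "'a \<Rightarrow> real"
  assumes I: "finite I" "\<And>n. n \<in> I \<Longrightarrow> E n \<in> events" "disjoint_family_on E I"
    and w: "\<And>n. n \<in> I \<Longrightarrow> prob (E n) = w" "real (card I) * w = 1"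
    and f: "f \<in> borel_measurable M" "\<And>\<omega>. \<omega> \<in> space M \<Longrightarrow> \<bar>f \<omega>\<bar> \<le> B"
    and near: "\<And>n \<omega>. n \<in> I \<Longrightarrow> \<omega> \<in> E n \<Longrightarrow> \<bar>f \<omega> - g n\<bar> \<le> h n"
  shows "\<bar>expectation f - (\<Sum>n\<in>I. g n) * w\<bar> \<le> (\<Sum>n\<in>I. h n) * w"
proof -
  \<comment> \<open>The step functions with the given values on the events.\<close>
  define step where "step u \<omega> = (\<Sum>n\<in>I. u n * indicator (E n) \<omega>)" for u :: "'b \<Rightarrow> real" and \<omega>
  have step_int: "integrable M (step u)" and step_exp: "expectation (step u) = (\<Sum>n\<in>I. u n) * w" for u
  proof -
    have int: "integrable M (\<lambda>\<omega>. u n * indicator (E n) \<omega>)" if "n \<in> I" for n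
      using I(2)[OF that] by (intro integrable_mult_right integrable_real_indicator) (auto simp: emeasure_eq_measure)
    show "integrable M (step u)" unfolding step_def using int by (intro Bochner_Integration.integrable_sum)
    have "expectation (step u) = (\<Sum>n\<in>I. expectation (\<lambda>\<omega>. u n * indicator (E n) \<omega>))"
      unfolding step_def using int by (rule Bochner_Integration.integral_sum)
    also have "\<dots> = (\<Sum>n\<in>I. u n * w)"
      using I(2) w(1) by (intro sum.cong) auto
    finally show "expectation (step u) = (\<Sum>n\<in>I. u n) * w" by (simp add: sum_distrib_right)
  qed
  have step_val: "step u \<omega> = u n" if "n \<in> I" "\<omega> \<in> E n" for u n \<omega>
  proof -
    have "indicator (E k) \<omega> = (if k = n then 1 else 0 :: real)" if "k \<in> I" for k
      using I(3) \<open>n \<in> I\<close> \<open>\<omega> \<in> E n\<close> that unfolding disjoint_family_on_def by (auto simp: indicator_def)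
    then have "step u \<omega> = (\<Sum>k\<in>I. if k = n then u k else 0)"
      unfolding step_def by (intro sum.cong) auto
    then show ?thesis using I(1) that(1) by simp
  qed
  have "prob (\<Union>n\<in>I. E n) = (\<Sum>n\<in>I. prob (E n))"
    using I by (intro finite_measure_finite_Union) auto
  also have "\<dots> = 1" using w by simp
  finally have total: "AE \<omega> in M. \<omega> \<in> (\<Union>n\<in>I. E n)"
  proof (rule prob_eq_1[THEN iffD1, rotated])
    show "(\<Union>n\<in>I. E n) \<in> events" using I by (intro sets.finite_UN) auto
  qed
  have f_int: "integrable M f"
    using f by (intro integrable_const_bound[of _ B]) auto
  have "expectation f - (\<Sum>n\<in>I. g n) * w = expectation (\<lambda>\<omega>. f \<omega> - step g \<omega>)"
    using f_int step_int by (simp add: step_exp)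
  also have "\<bar>\<dots>\<bar> \<le> expectation (\<lambda>\<omega>. \<bar>f \<omega> - step g \<omega>\<bar>)"
    by (rule integral_abs_bound)
  also have "\<dots> \<le> expectation (step h)"
  proof (rule integral_mono_AE)
    show "integrable M (\<lambda>\<omega>. \<bar>f \<omega> - step g \<omega>\<bar>)" using f_int step_int by simp
    show "integrable M (step h)" by (rule step_int)
    show "AE \<omega> in M. \<bar>f \<omega> - step g \<omega>\<bar> \<le> step h \<omega>"
      using total
    proof eventually_elim
      case (elim \<omega>)
      then obtain n where "n \<in> I" "\<omega> \<in> E n" by blast
      then show ?case using near[of n \<omega>] step_val[of n \<omega>] by simp
    qed
  qed
  finally show ?thesis by (simp add: step_exp)
qed

context alg_closed_residue_field
begin

lemma v_representative:
  assumes "digit_representatives v \<Delta>" "d \<in> residue_units v"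
  shows "v (representative \<Delta> d) = 0"
proof -
  have "\<exists>!a. a \<in> \<Delta> \<and> a \<in> d" using assms by (simp add: digit_representatives_def)
  then have "representative \<Delta> d \<in> \<Delta>" unfolding representative_def by (rule theI'[THEN conjunct1])
  then have "representative \<Delta> d \<in> carrier (valuation_ring v) - max_ideal v"
    using assms(1) by (auto simp: digit_representatives_def)
  then show ?thesis by (auto simp: max_ideal_def)
qed

lemma v_tail:
  assumes "e \<in> (\<lambda>m. 1 + m) ` max_ideal v"
  shows "v e = 0"
proof -
  obtain m where "e = 1 + m" "0 < v m" using assms by (auto simp: max_ideal_def)
  then show ?thesis using v_add_strict[of 1 m] by simp
qed

lemma v_compose_element:
  assumes "digit_representatives v \<Delta>" "d \<in> residue_units v" "e \<in> (\<lambda>m. 1 + m) ` max_ideal v"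
  shows "v (compose_element v p \<Delta> (r, d, e)) = ereal (of_int \<lfloor>r / c\<rfloor> * c)"
  unfolding compose_element_def prod.case v_mult v_representative[OF assms(1,2)] v_tail[OF assms(3)]
    v_powi[OF p_nonzero v_p] by (simp add: v_p)

lemma valuation_range_eq:
  assumes "0 < M"
  shows "valuation_range v p M = (\<lambda>k::int. of_int k * c) ` {- \<lfloor>M / c\<rfloor>..\<lfloor>M / c\<rfloor>}"
proof -
  have "- M \<le> of_int k * c \<and> of_int k * c \<le> M \<longleftrightarrow> - \<lfloor>M / c\<rfloor> \<le> k \<and> k \<le> \<lfloor>M / c\<rfloor>" for k :: int
  proof -
    have "of_int k * c \<le> M \<longleftrightarrow> k \<le> \<lfloor>M / c\<rfloor>" using c_pos by (simp add: le_floor_iff pos_le_divide_eq)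
    moreover have "- M \<le> of_int k * c \<longleftrightarrow> - k \<le> \<lfloor>M / c\<rfloor>"
      using c_pos by (simp add: le_floor_iff pos_le_divide_eq) linarith
    ultimately show ?thesis by linarith
  qed
  then show ?thesis by (auto simp: valuation_range_def v_p)
qed

text \<open>Fixing the valuations of all coefficients is an event of probability \<open>1 / K ^ card A\<close>, whatever the
  distributions of digits and tails are. On it the number of roots is \<open>integral_width\<close> unless three
  points are collinear, and in that case both numbers are bounded.\<close>

lemma expected_roots_near_cube_avg:
  assumes A: "finite A" "A \<noteq> {}" "\<And>\<alpha> \<beta>. \<alpha> \<in> A \<Longrightarrow> \<beta> \<in> A \<Longrightarrow> \<beta> - \<alpha> \<le> W"
    and \<Delta>: "digit_representatives v \<Delta>" and D1: "digit_distribution v D1" and D2: "tail_distribution v D2"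
    and M: "0 < M" and meas: "root_count v p \<Delta> A \<in> borel_measurable (random_polynomial v p A D1 D2 M)"
  defines "K \<equiv> 2 * nat \<lfloor>M / c\<rfloor> + 1"
    and "B \<equiv> of_int (Max A - Min A) + of_int (\<Sum>(\<alpha>, \<beta>)\<in>ordered_pairs A. \<beta> - \<alpha>)"
  shows "\<bar>expected_roots v p \<Delta> A D1 D2 M - cube_avg A K (\<lambda>n. of_int (integral_width A n))\<bar>
    \<le> B * cube_avg A K (\<lambda>n. of_bool (nearly_collinear A 0 n))"
proof -
  define N where "N = \<lfloor>M / c\<rfloor>"
  have N: "0 \<le> N" "int K = 2 * N + 1" using M c_pos by (simp_all add: N_def K_def)
  have K0: "0 < K" by (simp add: K_def)
  have DD: "prob_space D1" "space D1 = residue_units v" "prob_space D2" "space D2 = (\<lambda>m. 1 + m) ` max_ideal v"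
    using D1 D2 by (auto simp: digit_distribution_def tail_distribution_def)
  define Q where "Q = D1 \<Otimes>\<^sub>M D2"
  interpret Q: prob_space Q unfolding Q_def using DD by (intro prob_space_pair)
  define V where "V = measure_pmf (pmf_of_set (valuation_range v p M))"
  have V_prob: "prob_space V" unfolding V_def by (rule measure_pmf.prob_space_axioms)
  define R where "R = random_element v p D1 D2 M"
  have R: "R = V \<Otimes>\<^sub>M Q" by (simp add: R_def random_element_def V_def Q_def)
  have R_prob: "prob_space R" unfolding R by (intro prob_space_pair V_prob Q.prob_space_axioms)
  interpret PP: finite_product_prob_space "\<lambda>_. R" A
  proof -
    interpret R: prob_space R by (rule R_prob)
    show "finite_product_prob_space (\<lambda>_. R) A"
      by unfold_locales (rule A(1))
  qed
  have P: "random_polynomial v p A D1 D2 M = PiM A (\<lambda>_. R)" by (simp add: random_polynomial_def R_def)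
  have space_R: "space R = UNIV \<times> (residue_units v \<times> (\<lambda>m. 1 + m) ` max_ideal v)"
    by (simp add: R space_pair_measure V_def Q_def DD)
  have slice: "{of_int (k - N) * c} \<times> space Q \<in> sets R" for k
    unfolding R by (intro pair_measureI) (auto simp: V_def)
  have slice_prob: "measure R ({of_int (k - N) * c} \<times> space Q) = 1 / real K" if k: "k \<in> {0..<int K}" for k
  proof -
    have range: "valuation_range v p M = (\<lambda>k::int. of_int k * c) ` {-N..N}"
      using valuation_range_eq[OF M] by (simp add: N_def)
    have "inj_on (\<lambda>k::int. of_int k * c) {-N..N}" using c_pos by (intro inj_onI) simp
    then have "card (valuation_range v p M) = K" unfolding range using N by (simp add: card_image)
    moreover have "of_int (k - N) * c \<in> valuation_range v p M"
      unfolding range using k N by (intro imageI) auto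
    moreover have "finite (valuation_range v p M)" unfolding range by simp
    ultimately have "measure V {of_int (k - N) * c} = 1 / real K"
      unfolding V_def measure_pmf_single by (subst pmf_of_set) (auto simp: indicator_def)
    moreover have "emeasure R ({of_int (k - N) * c} \<times> space Q)
        = emeasure V {of_int (k - N) * c} * emeasure Q (space Q)"
      unfolding R by (rule Q.emeasure_pair_measure_Times) (auto simp: V_def)
    ultimately show ?thesis by (simp add: measure_def Q.emeasure_space_1)
  qed
  \<comment> \<open>The event that the coefficient of \<open>X^\<alpha>\<close> has valuation \<open>(n \<alpha> - N) * c\<close> for all \<open>\<alpha>\<close>; the shift by
    \<open>N\<close> moves the symmetric range of valuations to the cube.\<close>
  define E where "E n = (\<Pi>\<^sub>E \<alpha>\<in>A. {of_int (n \<alpha> - N) * c} \<times> space Q)" for n :: "int \<Rightarrow> int"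
  have E_prob: "PP.prob (E n) = (1 / real K) ^ card A" if n: "n \<in> cube A K" for n
  proof -
    have "PP.prob (E n) = (\<Prod>\<alpha>\<in>A. measure R ({of_int (n \<alpha> - N) * c} \<times> space Q))"
      unfolding E_def by (rule PP.finite_measure_PiM_emb) (rule slice)
    also have "\<dots> = (\<Prod>\<alpha>\<in>A. 1 / real K)"
      using cube_mem[OF n] by (intro prod.cong slice_prob) auto
    finally show ?thesis by simp
  qed
  have E_disj: "disjoint_family_on E (cube A K)"
    unfolding disjoint_family_on_def
  proof (intro ballI impI, rule ccontr)
    fix n n' assume n: "n \<in> cube A K" "n' \<in> cube A K" "n \<noteq> n'" "E n \<inter> E n' \<noteq> {}"
    then obtain \<omega> where \<omega>: "\<omega> \<in> E n" "\<omega> \<in> E n'" by blast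
    have "n \<alpha> = n' \<alpha>" if "\<alpha> \<in> A" for \<alpha>
    proof -
      have "fst (\<omega> \<alpha>) = of_int (n \<alpha> - N) * c" "fst (\<omega> \<alpha>) = of_int (n' \<alpha> - N) * c"
        using PiE_mem[OF \<omega>(1)[unfolded E_def] that] PiE_mem[OF \<omega>(2)[unfolded E_def] that] by auto
      then have "of_int (n \<alpha> - N) * c = of_int (n' \<alpha> - N) * c" by (simp only:)
      then show ?thesis using c_pos by simp
    qed
    then have "n = n'" using n(1,2) unfolding cube_def by (rule PiE_ext[rotated 2]) auto
    then show False using n(3) by simp
  qed
  have coeff_val: "v (compose_element v p \<Delta> (\<omega> \<alpha>)) = ereal (of_int \<lfloor>fst (\<omega> \<alpha>) / c\<rfloor> * c)"
    if "\<omega> \<in> space (PiM A (\<lambda>_. R))" "\<alpha> \<in> A" for \<omega> \<alpha>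
  proof -
    have "\<omega> \<alpha> \<in> space R" using that by (auto simp: space_PiM dest: PiE_mem)
    then obtain r d e where "\<omega> \<alpha> = (r, d, e)" "d \<in> residue_units v" "e \<in> (\<lambda>m. 1 + m) ` max_ideal v"
      unfolding space_R by auto
    then show ?thesis using v_compose_element[OF \<Delta>, of d e r] by simp
  qed
  have bound: "0 \<le> root_count v p \<Delta> A \<omega> \<and> root_count v p \<Delta> A \<omega> \<le> of_int (Max A - Min A)"
    if \<omega>: "\<omega> \<in> space (PiM A (\<lambda>_. R))" for \<omega>
  proof -
    obtain \<alpha> where \<alpha>: "\<alpha> \<in> A" using A(2) by blast
    have "compose_element v p \<Delta> (\<omega> \<alpha>) \<noteq> 0" using coeff_val[OF \<omega> \<alpha>] by auto
    from card_nonzero_roots_le[OF A(1) \<alpha>, of "\<lambda>\<alpha>. compose_element v p \<Delta> (\<omega> \<alpha>)", OF this]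
    have "root_count v p \<Delta> A \<omega> \<le> real (nat (Max A - Min A))" unfolding root_count_def by simp
    moreover have "Min A \<le> Max A" using A by simp
    ultimately show ?thesis by (simp add: root_count_def)
  qed
  have width_bound: "0 \<le> (of_int (integral_width A n) :: real)"
      "(of_int (integral_width A n) :: real) \<le> of_int (\<Sum>(\<alpha>, \<beta>)\<in>ordered_pairs A. \<beta> - \<alpha>)" for n
    using integral_width_bounds[of A n] by (simp_all only: of_int_0_le_iff of_int_le_iff)
  have near: "\<bar>root_count v p \<Delta> A \<omega> - of_int (integral_width A n)\<bar> \<le> B * of_bool (nearly_collinear A 0 n)"
    if n: "n \<in> cube A K" and \<omega>: "\<omega> \<in> E n" for n \<omega>
  proof -
    have "E n \<in> PP.events" unfolding E_def using slice by (intro sets_PiM_I_finite A(1))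
    then have sp: "\<omega> \<in> space (PiM A (\<lambda>_. R))" using \<omega> sets.sets_into_space by blast
    show ?thesis
    proof (cases "nearly_collinear A 0 n")
      case True
      then show ?thesis
        using bound[OF sp] width_bound[of n] unfolding B_def abs_le_iff by simp
    next
      case False
      have "v (compose_element v p \<Delta> (\<omega> \<alpha>)) = ereal (of_int (n \<alpha> - N) * c)" if "\<alpha> \<in> A" for \<alpha>
      proof -
        have "fst (\<omega> \<alpha>) = of_int (n \<alpha> - N) * c"
          using PiE_mem[OF \<omega>[unfolded E_def] that] by auto
        then have "fst (\<omega> \<alpha>) / c = of_int (n \<alpha> - N)" using c_pos by simp
        then have "\<lfloor>fst (\<omega> \<alpha>) / c\<rfloor> = n \<alpha> - N" by (simp only: floor_of_int)
        then show ?thesis using coeff_val[OF sp that] by simp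
      qed
      then have "int (card (nonzero_roots A (\<lambda>\<alpha>. compose_element v p \<Delta> (\<omega> \<alpha>))))
          = integral_width A (\<lambda>\<alpha>. n \<alpha> - N)"
        by (intro card_nonzero_roots A) (use False in \<open>auto simp: nearly_collinear_translate\<close>)
      then have "root_count v p \<Delta> A \<omega> = of_int (integral_width A n)"
        unfolding root_count_def integral_width_translate by (metis of_int_of_nat_eq)
      then show ?thesis using False by simp
    qed
  qed
  have "\<bar>PP.expectation (root_count v p \<Delta> A) - (\<Sum>n\<in>cube A K. of_int (integral_width A n)) * (1 / real K) ^ card A\<bar>
      \<le> (\<Sum>n\<in>cube A K. B * of_bool (nearly_collinear A 0 n)) * (1 / real K) ^ card A"
  proof (rule PP.expectation_near_partition_average[OF finite_cube[OF A(1)] _ E_disj])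
    show "E n \<in> PP.events" for n unfolding E_def using slice by (intro sets_PiM_I_finite A(1))
    show "real (card (cube A K)) * (1 / real K) ^ card A = 1"
      using K0 by (simp add: card_cube[OF A(1)] power_divide)
    show "root_count v p \<Delta> A \<in> borel_measurable (PiM A (\<lambda>_. R))" using meas by (simp add: P)
    show "\<bar>root_count v p \<Delta> A \<omega>\<bar> \<le> of_int (Max A - Min A)" if "\<omega> \<in> space (PiM A (\<lambda>_. R))" for \<omega>
      using bound[OF that] by simp
  qed (use E_prob near in auto)
  then show ?thesis
    unfolding expected_roots_def P cube_avg_cmult[symmetric] cube_avg_def
    by (simp add: power_divide sum_distrib_left)
qed

end

lemma filterlim_cube_side_at_top:
  assumes "0 < c"
  shows "filterlim (\<lambda>M::real. 2 * nat \<lfloor>M / c\<rfloor> + 1) at_top at_top"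
  unfolding filterlim_at_top
proof
  fix Z :: nat
  have "Z \<le> 2 * nat \<lfloor>M / c\<rfloor> + 1" if "real Z * c \<le> M" for M
  proof -
    have "real Z \<le> M / c" using that assms by (simp add: pos_le_divide_eq)
    then have "int Z \<le> \<lfloor>M / c\<rfloor>" by (simp add: le_floor_iff)
    then show ?thesis by linarith
  qed
  then show "eventually (\<lambda>M. Z \<le> 2 * nat \<lfloor>M / c\<rfloor> + 1) at_top"
    unfolding eventually_at_top_linorder by blast
qed

theorem theorem1p3:
  fixes v :: "'a::field \<Rightarrow> ereal" and p :: 'a and \<Delta> :: "'a set" and A :: "int set"
  assumes "discrete_valuation v"
    and "valuation_complete v"
    and "uniformizer v p"
    and "digit_representatives v \<Delta>"
    and "finite A"
    and "card A \<ge> 2"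
    and "algebraically_closed (residue_field v)"
    and "ring_char (residue_field v) = 0 \<or>
         int (ring_char (residue_field v)) > Max ((\<lambda>(\<alpha>, \<beta>). \<bar>\<alpha> - \<beta>\<bar>) ` (A \<times> A))"
  shows "\<exists>E::real.
    (\<forall>D1 D2. digit_distribution v D1 \<longrightarrow> tail_distribution v D2 \<longrightarrow>
       (\<forall>M>0. root_count v p \<Delta> A \<in> borel_measurable (random_polynomial v p A D1 D2 M)) \<longrightarrow>
       (expected_roots v p \<Delta> A D1 D2 \<longlongrightarrow> E) at_top) \<and>
    2 - 2 / real (card A) \<le> E \<and> E \<le> 2 * ln (real (card A))"
proof -
  define W where "W = Max ((\<lambda>(\<alpha>, \<beta>). \<bar>\<alpha> - \<beta>\<bar>) ` (A \<times> A))"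
  have W: "\<beta> - \<alpha> \<le> W" if "\<alpha> \<in> A" "\<beta> \<in> A" for \<alpha> \<beta>
  proof -
    have "\<bar>\<beta> - \<alpha>\<bar> \<in> (\<lambda>(\<alpha>, \<beta>). \<bar>\<alpha> - \<beta>\<bar>) ` (A \<times> A)" using that by force
    then have "\<bar>\<beta> - \<alpha>\<bar> \<le> W" unfolding W_def using assms(5) by (intro Max_ge) auto
    then show ?thesis by simp
  qed
  have ne: "A \<noteq> {}" using assms(6) by auto
  obtain c where c: "discretely_valued_field v p c"
    using discretely_valued_fieldI[OF assms(1,3)] by blast
  interpret alg_closed_residue_field v p c W
    using alg_closed_residue_fieldI[OF c assms(2,7)] assms(8) by (simp add: W_def)
  obtain E where E: "(\<lambda>K. cube_avg A K (\<lambda>n. of_int (integral_width A n))) \<longlonglongrightarrow> E"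
      "2 - 2 / real (card A) \<le> E" "E \<le> 2 * ln (real (card A))"
    using integral_width_avg_tendsto[OF assms(5,6)] by blast
  define B :: real where "B = of_int (Max A - Min A) + of_int (\<Sum>(\<alpha>, \<beta>)\<in>ordered_pairs A. \<beta> - \<alpha>)"
  define K where "K M = 2 * nat \<lfloor>M / c\<rfloor> + 1" for M
  have K: "filterlim K at_top at_top"
    using filterlim_cube_side_at_top[OF c_pos] unfolding K_def .
  have "(expected_roots v p \<Delta> A D1 D2 \<longlongrightarrow> E) at_top"
    if D: "digit_distribution v D1" "tail_distribution v D2"
      and meas: "\<forall>M>0. root_count v p \<Delta> A \<in> borel_measurable (random_polynomial v p A D1 D2 M)" for D1 D2
  proof -
    let ?w = "\<lambda>M. cube_avg A (K M) (\<lambda>n. of_int (integral_width A n))"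
    have "((\<lambda>M. expected_roots v p \<Delta> A D1 D2 M - ?w M) \<longlongrightarrow> 0) at_top"
    proof (rule Lim_null_comparison)
      show "\<forall>\<^sub>F M in at_top. norm (expected_roots v p \<Delta> A D1 D2 M - ?w M)
          \<le> B * cube_avg A (K M) (\<lambda>n. of_bool (nearly_collinear A 0 n))"
        using eventually_gt_at_top[of 0]
      proof eventually_elim
        case (elim M)
        then show ?case
          using expected_roots_near_cube_avg[OF assms(5) ne W assms(4) D elim] meas
          by (simp add: B_def K_def)
      qed
      have "((\<lambda>M. B * cube_avg A (K M) (\<lambda>n. of_bool (nearly_collinear A 0 n))) \<longlongrightarrow> B * 0) at_top"
        by (intro tendsto_mult tendsto_const
            filterlim_compose[OF cube_avg_nearly_collinear_tendsto[OF assms(5)] K])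
      then show "((\<lambda>M. B * cube_avg A (K M) (\<lambda>n. of_bool (nearly_collinear A 0 n))) \<longlongrightarrow> 0) at_top"
        by simp
    qed
    from tendsto_add[OF this filterlim_compose[OF E(1) K]] show ?thesis by simp
  qed
  then show ?thesis using E(2,3) by blast
qed

end
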